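(* Let $m\ge 1$, let $V_m$ be a surface obtained by the construction described in the context (with exponents $k=3$, $l=2$), let $E_m\subset V_m$ be its last exceptional curve, and let $V_m^*=V_m\setminus E_m$. Then the Kobayashi-Royden pseudometric $K_{V_m}$ of $V_m$ vanishes on $TV_m^*$, i.e. $K_{V_m}(\nu)=0$ for every $\nu\in TV_m^*$.
   Context: Kobayashi-Royden pseudometric. For $r>0$ let $\Delta_r\subset\mathbb{C}_z$ be the disc of radius $r$ centered at $0$ and $\mathrm{Hol}(\Delta_r,X)$ the set of holomorphic maps from $\Delta_r$ to a complex manifold $X$. For $\nu\in T_xX$, $$K_X(\nu)=\inf\Big\{\tfrac1r \;\Big|\; \varphi\in\mathrm{Hol}(\Delta_r,X),\ \varphi(0)=x,\ \mathrm{d}\varphi\big(\tfrac{\mathrm{d}}{\mathrm{d}z}\big|_0\big)=\nu\Big\}.$$ Construction of $V_m$. All varieties are over $\mathbb{C}$. Let $L_0\subset\mathbb{C}^2_{u,v}$ be the curve $u^3-v^2=0$. Let $V_1'\to\mathbb{C}^2_{u,v}$ be the blow-up at the point $(1,1)$, $E_1'$ its exceptional divisor, $\tilde L_0\subset V_1'$ the proper transform of $L_0$, and put $V_1=V_1'\setminus\tilde L_0$, $E_1=E_1'\setminus\tilde L_0$. For $i=2,\dots,m$ let $V_i'\to V_{i-1}$ be the blow-up at a (freely chosen) point of $E_{i-1}$, $E_i'$ its exceptional divisor, $\tilde E_{i-1}\subset V_i'$ the proper transform of $E_{i-1}$, and put $V_i=V_i'\setminus\tilde E_{i-1}$, $E_i=E_i'\setminus\tilde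 E_{i-1}$. Thus $V_m$ is a smooth surface which is the disjoint union of an open subset $V_m^*\simeq\mathbb{C}^2\setminus L_0$ and the closed curve $E_m\simeq\mathbb{C}$. *)

theory Defs
  imports "HOL-Analysis.Analysis"
begin

section \<open>Complex manifolds\<close>

text \<open>A complex manifold of dimension \<open>CARD('n)\<close> is given by a holomorphic atlas; a chart is a pair
  of its domain and a map whose values outside the domain are irrelevant. The points, the topology
  and the tangent vectors are all derived from the atlas.\<close>

type_synonym ('a, 'n) chart = "'a set \<times> ('a \<Rightarrow> complex ^ 'n)"
type_synonym ('a, 'n) atlas = "('a, 'n) chart set"

definition points :: "('a, 'n) atlas \<Rightarrow> 'a set"
  where "points A = (\<Union>(U, \<phi>)\<in>A. U)"

text \<open>The coarsest topology for which the charts are continuous with open domains. If the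
  transition maps are homeomorphisms between open sets, the charts are homeomorphisms onto their
  images.\<close>

definition manifold_topology :: "('a, 'n::finite) atlas \<Rightarrow> 'a topology"
  where "manifold_topology A = topology_generated_by {U \<inter> \<phi> -` W | U \<phi> W. (U, \<phi>) \<in> A \<and> open W}"

text \<open>Holomorphic maps on an open set \<open>S\<close> in several variables: a complex linear derivative exists
  at every point of \<open>S\<close>.\<close>

definition holomorphic_vec_on :: "(complex ^ 'n::finite \<Rightarrow> complex ^ 'm::finite) \<Rightarrow> (complex ^ 'n) set \<Rightarrow> bool"
  where "holomorphic_vec_on f S \<longleftrightarrow>
    (\<forall>x\<in>S. \<exists>D. (f has_derivative D) (at x) \<and> (\<forall>c v. D (c *s v) = c *s D v))"

definition complex_manifold :: "('a, 'n::finite) atlas \<Rightarrow> bool"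
  where "complex_manifold A \<longleftrightarrow>
    Hausdorff_space (manifold_topology A) \<and> second_countable (manifold_topology A) \<and>
    (\<forall>(U, \<phi>)\<in>A. inj_on \<phi> U \<and> open (\<phi> ` U)) \<and>
    (\<forall>(U, \<phi>)\<in>A. \<forall>(W, \<psi>)\<in>A.
       open (\<phi> ` (U \<inter> W)) \<and> holomorphic_vec_on (\<psi> \<circ> inv_into U \<phi>) (\<phi> ` (U \<inter> W)))"

definition holomorphic_map ::
    "('a, 'n::finite) atlas \<Rightarrow> ('b, 'm::finite) atlas \<Rightarrow> ('a \<Rightarrow> 'b) \<Rightarrow> bool"
  where "holomorphic_map A B f \<longleftrightarrow>
    continuous_map (manifold_topology A) (manifold_topology B) f \<and>
    (\<forall>(U, \<phi>)\<in>A. \<forall>(W, \<psi>)\<in>B.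
       holomorphic_vec_on (\<psi> \<circ> f \<circ> inv_into U \<phi>) (\<phi> ` {x \<in> U. f x \<in> W}))"

definition biholomorphic_map ::
    "('a, 'n::finite) atlas \<Rightarrow> ('b, 'n) atlas \<Rightarrow> ('a \<Rightarrow> 'b) \<Rightarrow> bool"
  where "biholomorphic_map A B f \<longleftrightarrow>
    bij_betw f (points A) (points B) \<and> holomorphic_map A B f \<and>
    holomorphic_map B A (inv_into (points A) f)"

definition open_submanifold :: "('a, 'n) atlas \<Rightarrow> 'a set \<Rightarrow> ('a, 'n) atlas"
  where "open_submanifold A S = (\<lambda>(U, \<phi>). (U \<inter> S, \<phi>)) ` A"

definition complex_plane :: "(complex ^ 2, 2) atlas"
  where "complex_plane = {(UNIV, \<lambda>x. x)}"

section \<open>The Kobayashi-Royden pseudometric\<close>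

text \<open>A tangent vector at \<open>x\<close> is the family of its coordinate vectors in all the charts around
  \<open>x\<close>, which transform by the derivatives of the transition maps; the value \<open>0\<close> at all other
  charts makes the representation unique.\<close>

definition tangent_space :: "('a, 'n::finite) atlas \<Rightarrow> 'a \<Rightarrow> (('a, 'n) chart \<Rightarrow> complex ^ 'n) set"
  where "tangent_space A x = {\<nu>.
    (\<forall>(U, \<phi>)\<in>A. \<forall>(W, \<psi>)\<in>A. x \<in> U \<and> x \<in> W \<longrightarrow>
       \<nu> (W, \<psi>) = frechet_derivative (\<psi> \<circ> inv_into U \<phi>) (at (\<phi> x)) (\<nu> (U, \<phi>))) \<and>
    (\<forall>U \<phi>. \<not> ((U, \<phi>) \<in> A \<and> x \<in> U) \<longrightarrow> \<nu> (U, \<phi>) = 0)}"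

definition holomorphic_disc :: "('a, 'n::finite) atlas \<Rightarrow> real \<Rightarrow> (complex \<Rightarrow> 'a) \<Rightarrow> bool"
  where "holomorphic_disc A r f \<longleftrightarrow>
    continuous_map (top_of_set (ball 0 r)) (manifold_topology A) f \<and>
    (\<forall>(U, \<phi>)\<in>A. \<forall>i. (\<lambda>z. \<phi> (f z) $ i) holomorphic_on {z \<in> ball 0 r. f z \<in> U})"

definition disc_velocity :: "('a, 'n::finite) atlas \<Rightarrow> (complex \<Rightarrow> 'a) \<Rightarrow> (('a, 'n) chart \<Rightarrow> complex ^ 'n) \<Rightarrow> bool"
  where "disc_velocity A f \<nu> \<longleftrightarrow>
    (\<forall>(U, \<phi>)\<in>A. f 0 \<in> U \<longrightarrow>
       (\<forall>i. ((\<lambda>z. \<phi> (f z) $ i) has_field_derivative \<nu> (U, \<phi>) $ i) (at 0)))"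

text \<open>The base point \<open>x\<close> of \<open>\<nu>\<close> is a separate argument. For \<open>\<nu> \<in> tangent_space A x\<close> the set below
  is nonempty and consists of positive numbers, so that the real infimum is the intended one.\<close>

definition kobayashi_royden :: "('a, 'n::finite) atlas \<Rightarrow> 'a \<Rightarrow> (('a, 'n) chart \<Rightarrow> complex ^ 'n) \<Rightarrow> real"
  where "kobayashi_royden A x \<nu> =
    Inf {1 / r | r f. r > 0 \<and> holomorphic_disc A r f \<and> f 0 = x \<and> disc_velocity A f \<nu>}"

section \<open>Blow-ups of points on surfaces\<close>

definition complex_line :: "complex ^ 2 \<Rightarrow> (complex ^ 2) set"
  where "complex_line w = range (\<lambda>c. c *s w)"

text \<open>The blow-up of \<open>\<complex>\<^sup>2\<close> at the origin is the incidence variety of the pairs \<open>(x, l)\<close> with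
  \<open>x \<in> l \<in> \<P>\<^sup>1\<close>, where \<open>\<P>\<^sup>1\<close> is the set of complex lines through the origin. Its two standard charts are
  the inverses of the following parametrisations of the sets where \<open>l\<close> is not the second,
  respectively not the first, coordinate axis.\<close>

definition blowup_param1 :: "complex ^ 2 \<Rightarrow> (complex ^ 2) \<times> (complex ^ 2) set"
  where "blowup_param1 p = (vector [p $ 1, p $ 1 * p $ 2], complex_line (vector [1, p $ 2]))"

definition blowup_param2 :: "complex ^ 2 \<Rightarrow> (complex ^ 2) \<times> (complex ^ 2) set"
  where "blowup_param2 p = (vector [p $ 1 * p $ 2, p $ 2], complex_line (vector [p $ 1, 1]))"

definition blowup_plane :: "((complex ^ 2) \<times> (complex ^ 2) set, 2) atlas"
  where "blowup_plane =
    {(range blowup_param1, inv blowup_param1), (range blowup_param2, inv blowup_param2)}"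

text \<open>\<open>\<pi> : X' \<rightarrow> X\<close> is the blow-up of the surface \<open>X\<close> at \<open>p\<close>: it is biholomorphic away from \<open>p\<close>, and
  over a coordinate neighbourhood of \<open>p\<close> (with \<open>p\<close> at the origin) it is the restriction of the
  blow-up of \<open>\<complex>\<^sup>2\<close>. This determines \<open>\<pi>\<close> up to isomorphism over \<open>X\<close>.\<close>

definition is_blowup :: "('b, 2) atlas \<Rightarrow> ('b \<Rightarrow> 'a) \<Rightarrow> ('a, 2) atlas \<Rightarrow> 'a \<Rightarrow> bool"
  where "is_blowup X' \<pi> X p \<longleftrightarrow>
    complex_manifold X \<and> complex_manifold X' \<and> p \<in> points X \<and> holomorphic_map X' X \<pi> \<and>
    biholomorphic_map (open_submanifold X' {y. \<pi> y \<noteq> p}) (open_submanifold X (- {p})) \<pi> \<and>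
    (\<exists>U D \<zeta> \<Psi>.
       openin (manifold_topology X) U \<and> p \<in> U \<and> open D \<and>
       biholomorphic_map (open_submanifold X U) (open_submanifold complex_plane D) \<zeta> \<and> \<zeta> p = 0 \<and>
       biholomorphic_map (open_submanifold X' {y. \<pi> y \<in> U})
         (open_submanifold blowup_plane {(x, l). x \<in> D}) \<Psi> \<and>
       (\<forall>y\<in>points X'. \<pi> y \<in> U \<longrightarrow> fst (\<Psi> y) = \<zeta> (\<pi> y)))"

definition exceptional_divisor :: "('b, 2) atlas \<Rightarrow> ('b \<Rightarrow> 'a) \<Rightarrow> 'a \<Rightarrow> 'b set"
  where "exceptional_divisor X' \<pi> p = {y \<in> points X'. \<pi> y = p}"

definition proper_transform :: "('b, 2) atlas \<Rightarrow> ('b \<Rightarrow> 'a) \<Rightarrow> 'a \<Rightarrow> 'a set \<Rightarrow> 'b set"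
  where "proper_transform X' \<pi> p C =
    manifold_topology X' closure_of {y \<in> points X'. \<pi> y \<in> C - {p}}"

section \<open>The surfaces \<open>V\<^sub>m\<close>\<close>

definition cusp_curve :: "(complex ^ 2) set"
  where "cusp_curve = {p. (p $ 1) ^ 3 - (p $ 2) ^ 2 = 0}"

text \<open>\<open>tower_surface m V E\<close>: the pair \<open>(V, E)\<close> is a possible outcome \<open>(V\<^sub>m, E\<^sub>m)\<close> of the construction
  after \<open>m \<ge> 1\<close> blow-ups, the centres of all but the first being arbitrary points of the previous
  exceptional curve. All the surfaces have points in one type \<open>'a\<close>, which is no restriction, since
  blow-ups are only considered up to isomorphism.\<close>

inductive tower_surface :: "nat \<Rightarrow> ('a, 2) atlas \<Rightarrow> 'a set \<Rightarrow> bool"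
  where
    first: "tower_surface 1
        (open_submanifold V' (- proper_transform V' \<pi> p cusp_curve))
        (exceptional_divisor V' \<pi> p - proper_transform V' \<pi> p cusp_curve)"
      if "is_blowup V' \<pi> complex_plane p" and "p = vector [1, 1]"
    for V' :: "('a, 2) atlas" and \<pi> :: "'a \<Rightarrow> complex ^ 2"
  | step: "tower_surface (Suc m)
        (open_submanifold V' (- proper_transform V' \<pi> p E))
        (exceptional_divisor V' \<pi> p - proper_transform V' \<pi> p E)"
      if "tower_surface m V E" and "p \<in> E" and "is_blowup V' \<pi> V p"
    for V' :: "('a, 2) atlas" and \<pi> :: "'a \<Rightarrow> 'a"

end

(*
  Composing with the blow-downs identifies V - E with the complement of the cusp u^3 = v^2, and a
  curve in the plane that meets the cusp only at (1,1) lifts to V as soon as, at every such meeting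
  point, it has sufficiently high contact with the projection of a curve in V that crosses E
  transversally.  Near (1,1) the functions q = u^3 / v^2 and v / u are coordinates.  For the curve
  (a h^2, b h^3) with h nowhere zero, q = a^3 / b^2 does not depend on h, and v / u = h b / a.  Hence
  one may choose a and b freely without common zeros such that a^3 - b^2 has only finitely many
  zeros, and then satisfy the contact conditions by interpolating the logarithm of h.  As the
  1-jet of the curve at 0 can also be prescribed, every tangent vector of V - E is the velocity
  of an entire curve in V.
*)

theory Submission
  imports Defs "HOL-Complex_Analysis.Conformal_Mappings" "HOL-Library.Landau_Symbols"
begin

section \<open>Vector-valued derivatives\<close>

text \<open>The obstacle is that all centres but the first are arbitrary, so explicit congruences
  for lifting would have to carry the free parameters of every centre. The induction over the tower
  carries two coordinate-free facts instead. One is that some finite order of contact suffices for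
  lifting: each blow-up costs finitely many orders, governed by the order to which the projected
  curve meets the centre. The other is that the pull-back of \<open>cusp\<close> has nonzero
  derivative along some curve through each point of E. It is inherited because the points of tangent
  direction lie in the proper transform, which is removed.

  The weights 2 and 3 make \<open>cusp\<close> homogeneous, so the factor h multiplies
  \<open>a ^ 3 - b ^ 2\<close> by \<open>h ^ 6\<close> and creates no new meetings with the cusp. At
  a meeting this difference may vanish to higher order, so the curve to be approximated is the
  transversal one after a possibly ramified change of parameter. This is why lifting is established
  along all curves that meet E at isolated parameters, not only along transversal ones.\<close>

lemma bounded_linear_axis: "bounded_linear (axis i :: 'a::euclidean_space \<Rightarrow> 'a ^ 'n)"
  by (rule linear_conv_bounded_linear[THEN iffD1], rule linearI) (auto simp: axis_def vec_eq_iff)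

lemma has_derivative_vecI:
  fixes F :: "'a::real_normed_vector \<Rightarrow> complex ^ 'n"
  assumes "\<And>i. ((\<lambda>x. F x $ i) has_derivative (\<lambda>h. D h $ i)) (at x within S)"
  shows "(F has_derivative D) (at x within S)"
proof -
  have "((\<lambda>w. \<Sum>i\<in>UNIV. axis i (F w $ i)) has_derivative (\<lambda>h. \<Sum>i\<in>UNIV. axis i (D h $ i))) (at x within S)"
    using assms by (intro has_derivative_sum bounded_linear.has_derivative[OF bounded_linear_axis])
  moreover have "(\<Sum>i\<in>UNIV. axis i (v $ i)) = v" for v :: "complex ^ 'n"
    by (simp add: vec_eq_iff axis_def if_distrib cong: if_cong)
  ultimately show ?thesis by simp
qed

text \<open>Writing the derivative as \<open>h *s d\<close> with complex \<open>h\<close> builds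
  complex linearity into it, so the chain rule for Frechet derivatives can be applied to curves and
  the result read off componentwise.\<close>

lemma has_derivative_vec_curve:
  fixes c :: "complex \<Rightarrow> complex ^ 'n"
  shows "(c has_derivative (\<lambda>h. h *s d)) (at z within S) \<longleftrightarrow>
    (\<forall>i. ((\<lambda>w. c w $ i) has_field_derivative d $ i) (at z within S))" (is "?L = ?R")
proof
  assume ?L
  show ?R
  proof
    fix i
    have "((\<lambda>w. c w $ i) has_derivative (\<lambda>h. (h *s d) $ i)) (at z within S)"
      using bounded_linear.has_derivative[OF bounded_linear_vec_nth \<open>?L\<close>] .
    then show "((\<lambda>w. c w $ i) has_field_derivative d $ i) (at z within S)"
      by (simp add: has_field_derivative_def mult_commute_abs)
  qed
next
  assume ?R
  then show ?L by (intro has_derivative_vecI) (simp add: has_field_derivative_def mult_commute_abs)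
qed

lemma continuous_on_vec_iff:
  fixes c :: "'b::topological_space \<Rightarrow> 'a::topological_space ^ 'n"
  shows "continuous_on S c \<longleftrightarrow> (\<forall>i. continuous_on S (\<lambda>w. c w $ i))"
  by (auto intro: continuous_intros) (auto simp: continuous_on_def intro: vec_tendstoI)

lemma holomorphic_vec_on_mono: "holomorphic_vec_on f S \<Longrightarrow> T \<subseteq> S \<Longrightarrow> holomorphic_vec_on f T"
  by (auto simp: holomorphic_vec_on_def)

lemma holomorphic_vec_on_compose:
  assumes "holomorphic_vec_on f S" "holomorphic_vec_on g T" "f ` S \<subseteq> T"
  shows "holomorphic_vec_on (g \<circ> f) S"
  unfolding holomorphic_vec_on_def
proof
  fix x assume "x \<in> S"
  obtain D where D: "(f has_derivative D) (at x)" "\<forall>c v. D (c *s v) = c *s D v"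
    using assms(1) \<open>x \<in> S\<close> by (auto simp: holomorphic_vec_on_def)
  obtain D' where D': "(g has_derivative D') (at (f x))" "\<forall>c v. D' (c *s v) = c *s D' v"
    using assms(2,3) \<open>x \<in> S\<close> unfolding holomorphic_vec_on_def by blast
  have "(g \<circ> f has_derivative D' \<circ> D) (at x)"
    using diff_chain_at[OF D(1) D'(1)] .
  then show "\<exists>D. (g \<circ> f has_derivative D) (at x) \<and> (\<forall>c v. D (c *s v) = c *s D v)"
    using D(2) D'(2) by (intro exI[of _ "D' \<circ> D"]) auto
qed

lemma holomorphic_vec_on_cong:
  assumes "open S" "holomorphic_vec_on f S" "\<And>x. x \<in> S \<Longrightarrow> f x = g x"
  shows "holomorphic_vec_on g S"
  unfolding holomorphic_vec_on_def
proof
  fix x assume "x \<in> S"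
  obtain D where D: "(f has_derivative D) (at x)" "\<forall>c v. D (c *s v) = c *s D v"
    using assms(2) \<open>x \<in> S\<close> by (auto simp: holomorphic_vec_on_def)
  have "(g has_derivative D) (at x)"
    using has_derivative_transform_within_open[OF D(1) assms(1) \<open>x \<in> S\<close>] assms(3) by auto
  then show "\<exists>D. (g has_derivative D) (at x) \<and> (\<forall>c v. D (c *s v) = c *s D v)"
    using D(2) by auto
qed

lemma holomorphic_vec_on_local:
  assumes "\<And>x. x \<in> S \<Longrightarrow> \<exists>T. open T \<and> x \<in> T \<and> holomorphic_vec_on f T"
  shows "holomorphic_vec_on f S"
  using assms unfolding holomorphic_vec_on_def by blast

lemma holomorphic_vec_on_continuous:
  "holomorphic_vec_on f S \<Longrightarrow> continuous_on S f"
  unfolding holomorphic_vec_on_def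
  by (meson continuous_at_imp_continuous_on has_derivative_continuous)

text \<open>A complex linear \<open>D\<close> sends the velocity form \<open>h *s d\<close> to
  \<open>h *s D d\<close>, which is again the derivative of a holomorphic curve.\<close>

lemma holomorphic_vec_on_curve:
  assumes c: "\<And>i. (\<lambda>z. c z $ i) holomorphic_on S" and "open S" "holomorphic_vec_on F T" "c ` S \<subseteq> T"
  shows "(\<lambda>z. F (c z) $ i) holomorphic_on S"
  unfolding holomorphic_on_def
proof
  fix z assume z: "z \<in> S"
  obtain D where D: "(F has_derivative D) (at (c z))" "\<forall>k v. D (k *s v) = k *s D v"
    using assms(3,4) z unfolding holomorphic_vec_on_def by blast
  define d where "d = (\<chi> i. deriv (\<lambda>z. c z $ i) z)"
  have "(c has_derivative (\<lambda>h. h *s d)) (at z)"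
    unfolding has_derivative_vec_curve d_def using holomorphic_derivI[OF c \<open>open S\<close> z] by simp
  from diff_chain_at[OF this D(1)] have "(F \<circ> c has_derivative (\<lambda>h. h *s D d)) (at z)"
    using D(2) by (simp add: o_def)
  then have "((\<lambda>z. F (c z) $ i) has_field_derivative D d $ i) (at z)"
    by (simp add: has_derivative_vec_curve o_def)
  then show "(\<lambda>z. F (c z) $ i) field_differentiable at z within S"
    using field_differentiable_at_within field_differentiable_def by blast
qed

lemma vec2_eq_iff: "(v :: 'a::zero ^ 2) = w \<longleftrightarrow> v $ 1 = w $ 1 \<and> v $ 2 = w $ 2"
  by (simp add: vec_eq_iff forall_2)

lemma vec2_decompose: "(v :: complex ^ 2) = v $ 1 *s vector [1, 0] + v $ 2 *s vector [0, 1]"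
  by (simp add: vec2_eq_iff)

section \<open>Complex-valued holomorphic functions of several variables\<close>

definition holomorphic_scalar_on :: "(complex ^ 'n::finite \<Rightarrow> complex) \<Rightarrow> (complex ^ 'n) set \<Rightarrow> bool"
  where "holomorphic_scalar_on f S \<longleftrightarrow>
    (\<forall>x\<in>S. \<exists>D. (f has_derivative D) (at x) \<and> (\<forall>c v. D (c *s v) = c * D v))"

named_theorems holomorphic_scalar_intros

lemma holomorphic_scalar_nth [holomorphic_scalar_intros]:
  assumes "holomorphic_vec_on F S"
  shows "holomorphic_scalar_on (\<lambda>x. F x $ i) S"
  unfolding holomorphic_scalar_on_def
proof
  fix x assume "x \<in> S"
  then obtain D where D: "(F has_derivative D) (at x)" "\<forall>c v. D (c *s v) = c *s D v"
    using assms unfolding holomorphic_vec_on_def by blast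
  show "\<exists>D. ((\<lambda>x. F x $ i) has_derivative D) (at x) \<and> (\<forall>c v. D (c *s v) = c * D v)"
    using bounded_linear.has_derivative[OF bounded_linear_vec_nth D(1)] D(2)
    by (intro exI[of _ "\<lambda>h. D h $ i"]) auto
qed

lemma holomorphic_vec_id [holomorphic_scalar_intros]: "holomorphic_vec_on (\<lambda>x. x) S"
  unfolding holomorphic_vec_on_def by (auto intro!: exI[of _ "\<lambda>x. x"])

lemma holomorphic_scalar_compose:
  assumes "holomorphic_scalar_on f S" "g holomorphic_on T" "open T" "f ` S \<subseteq> T"
  shows "holomorphic_scalar_on (\<lambda>x. g (f x)) S"
  unfolding holomorphic_scalar_on_def
proof
  fix x assume x: "x \<in> S"
  then obtain D where D: "(f has_derivative D) (at x)" "\<forall>c v. D (c *s v) = c * D v"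
    using assms unfolding holomorphic_scalar_on_def by blast
  have "(g has_derivative (\<lambda>h. deriv g (f x) * h)) (at (f x))"
    using holomorphic_derivI[OF assms(2,3)] x assms(4) by (auto simp: has_field_derivative_def)
  from diff_chain_at[OF D(1) this]
  show "\<exists>D. ((\<lambda>x. g (f x)) has_derivative D) (at x) \<and> (\<forall>c v. D (c *s v) = c * D v)"
    using D(2) by (intro exI[of _ "\<lambda>h. deriv g (f x) * D h"]) (auto simp: o_def)
qed

lemma holomorphic_scalar_mult [holomorphic_scalar_intros]:
  assumes "holomorphic_scalar_on f S" "holomorphic_scalar_on g S"
  shows "holomorphic_scalar_on (\<lambda>x. f x * g x) S"
  unfolding holomorphic_scalar_on_def
proof
  fix x assume x: "x \<in> S"
  obtain D where D: "(f has_derivative D) (at x)" "\<forall>c v. D (c *s v) = c * D v"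
    using assms(1) x unfolding holomorphic_scalar_on_def by blast
  obtain D' where D': "(g has_derivative D') (at x)" "\<forall>c v. D' (c *s v) = c * D' v"
    using assms(2) x unfolding holomorphic_scalar_on_def by blast
  show "\<exists>D. ((\<lambda>x. f x * g x) has_derivative D) (at x) \<and> (\<forall>c v. D (c *s v) = c * D v)"
    using has_derivative_mult[OF D(1) D'(1)] D(2) D'(2)
    by (intro exI[of _ "\<lambda>h. f x * D' h + D h * g x"]) (auto simp: algebra_simps)
qed

lemma holomorphic_scalar_diff [holomorphic_scalar_intros]:
  assumes "holomorphic_scalar_on f S" "holomorphic_scalar_on g S"
  shows "holomorphic_scalar_on (\<lambda>x. f x - g x) S"
  unfolding holomorphic_scalar_on_def
proof
  fix x assume x: "x \<in> S"
  obtain D where D: "(f has_derivative D) (at x)" "\<forall>c v. D (c *s v) = c * D v"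
    using assms(1) x unfolding holomorphic_scalar_on_def by blast
  obtain D' where D': "(g has_derivative D') (at x)" "\<forall>c v. D' (c *s v) = c * D' v"
    using assms(2) x unfolding holomorphic_scalar_on_def by blast
  show "\<exists>D. ((\<lambda>x. f x - g x) has_derivative D) (at x) \<and> (\<forall>c v. D (c *s v) = c * D v)"
    using has_derivative_diff[OF D(1) D'(1)] D(2) D'(2)
    by (intro exI[of _ "\<lambda>h. D h - D' h"]) (auto simp: algebra_simps)
qed

lemma holomorphic_scalar_power [holomorphic_scalar_intros]:
  "holomorphic_scalar_on f S \<Longrightarrow> holomorphic_scalar_on (\<lambda>x. f x ^ n) S"
  by (rule holomorphic_scalar_compose[where g = "\<lambda>z. z ^ n" and T = UNIV]) (auto intro!: holomorphic_intros)

lemma holomorphic_scalar_inverse [holomorphic_scalar_intros]: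
  "holomorphic_scalar_on f S \<Longrightarrow> (\<And>x. x \<in> S \<Longrightarrow> f x \<noteq> 0) \<Longrightarrow> holomorphic_scalar_on (\<lambda>x. 1 / f x) S"
  by (rule holomorphic_scalar_compose[where g = "\<lambda>z. 1 / z" and T = "- {0}"]) (auto intro!: holomorphic_intros)

lemma holomorphic_vec2I:
  assumes "holomorphic_scalar_on f S" "holomorphic_scalar_on g S"
  shows "holomorphic_vec_on (\<lambda>x. vector [f x, g x] :: complex ^ 2) S"
  unfolding holomorphic_vec_on_def
proof
  fix x assume x: "x \<in> S"
  obtain D where D: "(f has_derivative D) (at x)" "\<forall>c v. D (c *s v) = c * D v"
    using assms(1) x unfolding holomorphic_scalar_on_def by blast
  obtain D' where D': "(g has_derivative D') (at x)" "\<forall>c v. D' (c *s v) = c * D' v"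
    using assms(2) x unfolding holomorphic_scalar_on_def by blast
  have "((\<lambda>x. vector [f x, g x] :: complex^2) has_derivative (\<lambda>h. vector [D h, D' h])) (at x)"
  proof (rule has_derivative_vecI)
    fix i :: 2
    show "((\<lambda>x. (vector [f x, g x] :: complex^2) $ i) has_derivative (\<lambda>h. vector [D h, D' h] $ i)) (at x)"
      using exhaust_2[of i] D(1) D'(1) by auto
  qed
  then show "\<exists>D. ((\<lambda>x. vector [f x, g x] :: complex^2) has_derivative D) (at x) \<and> (\<forall>c v. D (c *s v) = c *s D v)"
    using D(2) D'(2) by (intro exI[of _ "\<lambda>h. vector [D h, D' h]"]) (auto simp: vec_eq_iff forall_2)
qed

lemma open_nth_nonzero: "open {p :: complex ^ 'n. p $ i \<noteq> 0}"
proof -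
  have "open ((\<lambda>p :: complex ^ 'n. p $ i) -` (- {0}))"
    by (intro continuous_open_vimage) auto
  then show ?thesis by (simp add: vimage_def)
qed

section \<open>Atlases\<close>

text \<open>The chart conditions of \<open>complex_manifold\<close>, separated from the topological
  axioms so that they can be verified by computations in charts for open submanifolds, the plane and
  its blow-up.\<close>

definition holomorphic_atlas :: "('a, 'n::finite) atlas \<Rightarrow> bool"
  where "holomorphic_atlas A \<longleftrightarrow>
    (\<forall>(U, \<phi>)\<in>A. inj_on \<phi> U \<and> open (\<phi> ` U)) \<and>
    (\<forall>(U, \<phi>)\<in>A. \<forall>(W, \<psi>)\<in>A.
       open (\<phi> ` (U \<inter> W)) \<and> holomorphic_vec_on (\<psi> \<circ> inv_into U \<phi>) (\<phi> ` (U \<inter> W)))"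

lemma complex_manifold_atlas: "complex_manifold A \<Longrightarrow> holomorphic_atlas A"
  by (simp add: complex_manifold_def holomorphic_atlas_def)

lemma atlas_inj: "holomorphic_atlas A \<Longrightarrow> (U, \<phi>) \<in> A \<Longrightarrow> inj_on \<phi> U"
  by (auto simp: holomorphic_atlas_def)

lemma atlas_transition:
  assumes "holomorphic_atlas A" "(U, \<phi>) \<in> A" "(W, \<psi>) \<in> A"
  shows "open (\<phi> ` (U \<inter> W))" "holomorphic_vec_on (\<psi> \<circ> inv_into U \<phi>) (\<phi> ` (U \<inter> W))"
  using assms by (auto simp: holomorphic_atlas_def)

lemma topspace_manifold: "topspace (manifold_topology A) = points A"
  unfolding manifold_topology_def topology_generated_by_topspace points_def
  by (auto split: prod.splits) (metis UNIV_I open_UNIV vimage_UNIV IntI case_prodI)+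

lemma chart_subset_points: "(U, \<phi>) \<in> A \<Longrightarrow> U \<subseteq> points A"
  by (auto simp: points_def)

lemma points_chart: "x \<in> points A \<Longrightarrow> \<exists>U \<phi>. (U, \<phi>) \<in> A \<and> x \<in> U"
  by (auto simp: points_def)

lemma openin_chart_vimage:
  "(U, \<phi>) \<in> A \<Longrightarrow> open W \<Longrightarrow> openin (manifold_topology A) (U \<inter> \<phi> -` W)"
  unfolding manifold_topology_def by (rule topology_generated_by_Basis) auto

lemma openin_chart: "(U, \<phi>) \<in> A \<Longrightarrow> openin (manifold_topology A) U"
  using openin_chart_vimage[of U \<phi> A UNIV] by simp

lemma continuous_map_manifold:
  "continuous_map T (manifold_topology A) f \<longleftrightarrow> f ` topspace T \<subseteq> points A \<and>
     (\<forall>U \<phi> W. (U, \<phi>) \<in> A \<longrightarrow> open W \<longrightarrow> openin T {x \<in> topspace T. f x \<in> U \<and> \<phi> (f x) \<in> W})"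
proof -
  have *: "f -` (U \<inter> \<phi> -` W) \<inter> topspace T = {x \<in> topspace T. f x \<in> U \<and> \<phi> (f x) \<in> W}" for U W and \<phi> :: "'b \<Rightarrow> complex^'c"
    by auto
  have "(\<Union> {U \<inter> \<phi> -` W |U \<phi> W. (U, \<phi>) \<in> A \<and> open W}) = points A"
    using topspace_manifold[of A] unfolding manifold_topology_def topology_generated_by_topspace .
  moreover have "(\<forall>N\<in>{U \<inter> \<phi> -` W |U \<phi> W. (U, \<phi>) \<in> A \<and> open W}. openin T (f -` N \<inter> topspace T)) \<longleftrightarrow>
      (\<forall>U \<phi> W. (U, \<phi>) \<in> A \<longrightarrow> open W \<longrightarrow> openin T (f -` (U \<inter> \<phi> -` W) \<inter> topspace T))"
    by blast
  ultimately show ?thesis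
    unfolding manifold_topology_def continuous_on_generated_topo_iff by (simp only: * Ball_def) (rule conj_commute)
qed

text \<open>The topology is given by a subbasis, hence the induction on the generation of the open
  set. Injectivity of the chart makes images commute with intersections; for a subbasic set the
  image is a preimage under the continuous transition map.\<close>

lemma open_chart_image:
  assumes A: "holomorphic_atlas A" "(U, \<phi>) \<in> A" and "openin (manifold_topology A) N"
  shows "open (\<phi> ` (U \<inter> N))"
proof -
  have "generate_topology_on {U \<inter> \<phi> -` W | U \<phi> W. (U, \<phi>) \<in> A \<and> open W} N"
    using assms(3) unfolding manifold_topology_def by (rule openin_topology_generated_by)
  then show ?thesis
  proof induction
    case (Int a b)
    have "\<phi> ` (U \<inter> (a \<inter> b)) = \<phi> ` (U \<inter> a) \<inter> \<phi> ` (U \<inter> b)"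
      using atlas_inj[OF A] by (auto simp: inj_on_def)
    then show ?case using Int by auto
  next
    case (UN K)
    have "\<phi> ` (U \<inter> \<Union>K) = (\<Union>k\<in>K. \<phi> ` (U \<inter> k))" by auto
    then show ?case using UN by auto
  next
    case (Basis s)
    then obtain U' \<phi>' W where s: "s = U' \<inter> \<phi>' -` W" "(U', \<phi>') \<in> A" "open W" by auto
    have "\<phi> ` (U \<inter> s) = \<phi> ` (U \<inter> U') \<inter> (\<phi>' \<circ> inv_into U \<phi>) -` W"
      using atlas_inj[OF A] by (auto simp: s)
    moreover have "open (\<dots>)"
      using atlas_transition[OF A s(2)] s(3) holomorphic_vec_on_continuous
      by (meson continuous_open_preimage)
    ultimately show ?case by simp
  qed auto
qed

lemma points_open_submanifold [simp]: "points (open_submanifold A T) = points A \<inter> T"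
  by (auto simp: points_def open_submanifold_def)

lemma open_submanifold_iff:
  "(U, \<phi>) \<in> open_submanifold A T \<longleftrightarrow> (\<exists>U'. (U', \<phi>) \<in> A \<and> U = U' \<inter> T)"
  by (auto simp: open_submanifold_def)

lemma continuous_map_open_submanifold:
  "continuous_map X (manifold_topology (open_submanifold A T)) f \<longleftrightarrow>
     continuous_map X (manifold_topology A) f \<and> f ` topspace X \<subseteq> T" (is "?L = ?R")
proof -
  have *: "{x \<in> topspace X. f x \<in> U \<and> f x \<in> T \<and> \<phi> (f x) \<in> W} = {x \<in> topspace X. f x \<in> U \<and> \<phi> (f x) \<in> W}"
    if "f ` topspace X \<subseteq> T" for U W and \<phi> :: "'b \<Rightarrow> complex^'c"
    using that by auto
  show ?thesis
    unfolding continuous_map_manifold open_submanifold_iff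
  proof safe
    fix U \<phi> W assume f: "f ` topspace X \<subseteq> points (open_submanifold A T)" and "(U, \<phi>) \<in> A" "open (W :: (complex^'c) set)"
      and "\<forall>U \<phi> W. (\<exists>U'. (U', \<phi>) \<in> A \<and> U = U' \<inter> T) \<longrightarrow> open W \<longrightarrow>
          openin X {x \<in> topspace X. f x \<in> U \<and> \<phi> (f x) \<in> W}"
    then have "openin X {x \<in> topspace X. f x \<in> U \<inter> T \<and> \<phi> (f x) \<in> W}" by blast
    then show "openin X {x \<in> topspace X. f x \<in> U \<and> \<phi> (f x) \<in> W}" using f *[of U \<phi> W] by simp
  qed (auto simp: *)
qed

lemma openin_open_submanifold:
  assumes "openin (manifold_topology A) N"
  shows "openin (manifold_topology (open_submanifold A T)) (N \<inter> T)"
proof -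
  have "continuous_map (manifold_topology (open_submanifold A T)) (manifold_topology A) (\<lambda>x. x)"
    using continuous_map_open_submanifold[of _ A T "\<lambda>x. x"] continuous_map_id
    by (metis id_def eq_id_iff)
  from openin_continuous_map_preimage[OF this assms]
  have "openin (manifold_topology (open_submanifold A T)) {x \<in> points A \<inter> T. x \<in> N}"
    by (simp add: topspace_manifold)
  moreover have "{x \<in> points A \<inter> T. x \<in> N} = N \<inter> T"
    using openin_subset[OF assms] by (auto simp: topspace_manifold)
  ultimately show ?thesis by simp
qed

text \<open>Both topologies are compared through the identity map, whose continuity in either
  direction is an instance of \<open>continuous_map_open_submanifold\<close>.\<close>

lemma topology_open_submanifold:
  "manifold_topology (open_submanifold A T) = subtopology (manifold_topology A) T"
proof (rule topology_eq[THEN iffD2], intro allI iffI)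
  fix N
  assume N: "openin (manifold_topology (open_submanifold A T)) N"
  have "continuous_map (subtopology (manifold_topology A) T) (manifold_topology (open_submanifold A T)) (\<lambda>x. x)"
    unfolding continuous_map_open_submanifold
    using continuous_map_from_subtopology[OF continuous_map_id] by (auto simp: id_def)
  from openin_continuous_map_preimage[OF this N]
  have "openin (subtopology (manifold_topology A) T) {x \<in> points A \<inter> T. x \<in> N}"
    by (simp add: topspace_manifold)
  moreover have "{x \<in> points A \<inter> T. x \<in> N} = N"
    using openin_subset[OF N] by (auto simp: topspace_manifold)
  ultimately show "openin (subtopology (manifold_topology A) T) N" by simp
next
  fix N
  assume "openin (subtopology (manifold_topology A) T) N"
  then show "openin (manifold_topology (open_submanifold A T)) N"
    using openin_open_submanifold by (auto simp: openin_subtopology)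
qed

lemma openin_open_submanifold_imp:
  assumes "openin (manifold_topology (open_submanifold A T)) N" "openin (manifold_topology A) (points A \<inter> T)"
  shows "openin (manifold_topology A) N"
proof -
  obtain M where M: "openin (manifold_topology A) M" "N = M \<inter> T"
    using assms(1) by (auto simp: topology_open_submanifold openin_subtopology)
  have "N = M \<inter> (points A \<inter> T)"
    using openin_subset[OF M(1)] M(2) by (auto simp: topspace_manifold)
  then show ?thesis using M(1) assms(2) by auto
qed

lemma holomorphic_atlas_open_submanifold:
  assumes A: "holomorphic_atlas A" and T: "openin (manifold_topology A) (points A \<inter> T)"
  shows "holomorphic_atlas (open_submanifold A T)"
proof -
  \<comment> \<open>\<open>inv_into\<close> depends on the set as well as on the map; on the smaller
    image the inverses of the original and of the restricted chart agree.\<close>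
  have inv: "inv_into (U \<inter> T) \<phi> y = inv_into U \<phi> y" if "(U, \<phi>) \<in> A" "y \<in> \<phi> ` (U \<inter> T)" for U \<phi> y
    using that atlas_inj[OF A that(1)]
    by (metis (no_types, opaque_lifting) f_inv_into_f inv_into_into inf.cobounded1 inj_on_subset inv_into_f_f subsetD)
  have op: "open (\<phi> ` (U \<inter> T \<inter> (W \<inter> T)))" if "(U, \<phi>) \<in> A" "(W, \<psi>) \<in> A" for U \<phi> W and \<psi> :: "'a \<Rightarrow> complex^'b"
  proof -
    have "openin (manifold_topology A) (W \<inter> (points A \<inter> T))"
      using openin_chart[OF that(2)] T by auto
    then have "open (\<phi> ` (U \<inter> (W \<inter> (points A \<inter> T))))"
      by (rule open_chart_image[OF A that(1)])
    moreover have "U \<inter> (W \<inter> (points A \<inter> T)) = U \<inter> T \<inter> (W \<inter> T)"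
      using chart_subset_points[OF that(1)] by auto
    ultimately show ?thesis by simp
  qed
  have tr: "holomorphic_vec_on (\<psi> \<circ> inv_into (U \<inter> T) \<phi>) (\<phi> ` (U \<inter> T \<inter> (W \<inter> T)))" 
    if "(U, \<phi>) \<in> A" "(W, \<psi>) \<in> A" for U \<phi> W \<psi>
  proof (rule holomorphic_vec_on_cong[OF op[OF that]])
    show "holomorphic_vec_on (\<psi> \<circ> inv_into U \<phi>) (\<phi> ` (U \<inter> T \<inter> (W \<inter> T)))"
      by (rule holomorphic_vec_on_mono[OF atlas_transition(2)[OF A that]]) auto
  qed (use inv[OF that(1)] in auto)
  show ?thesis
    unfolding holomorphic_atlas_def open_submanifold_def
    using op[of _ _ _] tr op[of U \<phi> U \<phi> for U \<phi>] atlas_inj[OF A]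
    by (auto simp: inj_on_Int)
qed

lemma chart_inv: "holomorphic_atlas A \<Longrightarrow> (U, \<phi>) \<in> A \<Longrightarrow> x \<in> U \<Longrightarrow> inv_into U \<phi> (\<phi> x) = x"
  by (simp add: atlas_inj)

section \<open>Holomorphic maps and curves\<close>

lemma holomorphic_map_continuous:
  "holomorphic_map A B F \<Longrightarrow> continuous_map (manifold_topology A) (manifold_topology B) F"
  by (simp add: holomorphic_map_def)

lemma holomorphic_map_points: "holomorphic_map A B F \<Longrightarrow> x \<in> points A \<Longrightarrow> F x \<in> points B"
  using holomorphic_map_continuous[of A B F]
  by (metis continuous_map_image_subset_topspace image_subset_iff topspace_manifold)

lemma holomorphic_map_charts:
  "holomorphic_map A B F \<Longrightarrow> (U, \<phi>) \<in> A \<Longrightarrow> (W, \<psi>) \<in> B \<Longrightarrow>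
     holomorphic_vec_on (\<psi> \<circ> F \<circ> inv_into U \<phi>) (\<phi> ` {x \<in> U. F x \<in> W})"
  by (auto simp: holomorphic_map_def)

lemma openin_holomorphic_map_preimage:
  assumes "holomorphic_map A B F" "openin (manifold_topology B) N"
  shows "openin (manifold_topology A) {x \<in> points A. F x \<in> N}"
  using openin_continuous_map_preimage[OF holomorphic_map_continuous[OF assms(1)] assms(2)]
  by (simp add: topspace_manifold)

text \<open>Holomorphy is checked near each point, where the composite factors through a chart
  \<open>Y\<close> of the middle manifold.\<close>

lemma holomorphic_map_compose:
  assumes A: "holomorphic_atlas A" and B: "holomorphic_atlas B"
    and F: "holomorphic_map A B F" and G: "holomorphic_map B C G"
  shows "holomorphic_map A C (\<lambda>x. G (F x))"
proof -
  have "holomorphic_vec_on (\<psi> \<circ> (\<lambda>x. G (F x)) \<circ> inv_into U \<phi>) (\<phi> ` {x \<in> U. G (F x) \<in> W})"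
    if U: "(U, \<phi>) \<in> A" and W: "(W, \<psi>) \<in> C" for U \<phi> W \<psi>
  proof (rule holomorphic_vec_on_local)
    fix y assume "y \<in> \<phi> ` {x \<in> U. G (F x) \<in> W}"
    then obtain x where x: "x \<in> U" "G (F x) \<in> W" "y = \<phi> x" by auto
    have "F x \<in> points B"
      using holomorphic_map_points[OF F] chart_subset_points[OF U] x by auto
    then obtain Y \<xi> where Y: "(Y, \<xi>) \<in> B" "F x \<in> Y" using points_chart by meson
    define N where "N = {x \<in> points A. F x \<in> Y \<inter> {y \<in> points B. G y \<in> W}}"
    have "openin (manifold_topology A) N"
      unfolding N_def using Y W
      by (intro openin_holomorphic_map_preimage[OF F] openin_Int openin_chart[OF Y(1)]
          openin_holomorphic_map_preimage[OF G] openin_chart[OF W])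
    then have op: "open (\<phi> ` (U \<inter> N))" by (rule open_chart_image[OF A U])
    have "holomorphic_vec_on ((\<psi> \<circ> G \<circ> inv_into Y \<xi>) \<circ> (\<xi> \<circ> F \<circ> inv_into U \<phi>)) (\<phi> ` (U \<inter> N))"
    proof (rule holomorphic_vec_on_compose)
      show "holomorphic_vec_on (\<xi> \<circ> F \<circ> inv_into U \<phi>) (\<phi> ` (U \<inter> N))"
        by (rule holomorphic_vec_on_mono[OF holomorphic_map_charts[OF F U Y(1)]]) (auto simp: N_def)
      show "holomorphic_vec_on (\<psi> \<circ> G \<circ> inv_into Y \<xi>) (\<xi> ` {y \<in> Y. G y \<in> W})"
        by (rule holomorphic_map_charts[OF G Y(1) W])
    qed (use chart_inv[OF A U] in \<open>auto simp: N_def\<close>)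
    then have "holomorphic_vec_on (\<psi> \<circ> (\<lambda>x. G (F x)) \<circ> inv_into U \<phi>) (\<phi> ` (U \<inter> N))"
      by (rule holomorphic_vec_on_cong[OF op])
        (auto simp: chart_inv[OF A U] chart_inv[OF B Y(1)] N_def)
    moreover have "y \<in> \<phi> ` (U \<inter> N)"
      using x Y \<open>F x \<in> points B\<close> chart_subset_points[OF U] by (auto simp: N_def)
    ultimately show "\<exists>T. open T \<and> y \<in> T \<and> holomorphic_vec_on (\<psi> \<circ> (\<lambda>x. G (F x)) \<circ> inv_into U \<phi>) T"
      using op by blast
  qed
  moreover have "continuous_map (manifold_topology A) (manifold_topology C) (\<lambda>x. G (F x))"
    using continuous_map_compose[OF holomorphic_map_continuous[OF F] holomorphic_map_continuous[OF G]]
    by (simp add: o_def)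
  ultimately show ?thesis by (auto simp: holomorphic_map_def)
qed

lemma holomorphic_map_open_submanifold:
  "holomorphic_map A (open_submanifold B T) F \<longleftrightarrow> holomorphic_map A B F \<and> F ` points A \<subseteq> T"
proof (cases "F ` points A \<subseteq> T")
  case True
  have "{x \<in> U. F x \<in> W \<inter> T} = {x \<in> U. F x \<in> W}" if "(U, \<phi>) \<in> A" for U W \<phi>
    using chart_subset_points[OF that] True by auto
  then have "(\<forall>(U, \<phi>)\<in>A. \<forall>(W, \<psi>)\<in>open_submanifold B T.
       holomorphic_vec_on (\<psi> \<circ> F \<circ> inv_into U \<phi>) (\<phi> ` {x \<in> U. F x \<in> W})) \<longleftrightarrow>
     (\<forall>(U, \<phi>)\<in>A. \<forall>(W, \<psi>)\<in>B.
       holomorphic_vec_on (\<psi> \<circ> F \<circ> inv_into U \<phi>) (\<phi> ` {x \<in> U. F x \<in> W}))"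
    unfolding open_submanifold_def by (intro ball_cong refl) (auto simp: case_prod_beta)
  then show ?thesis
    unfolding holomorphic_map_def continuous_map_open_submanifold topspace_manifold
    using True by simp
next
  case False
  then show ?thesis
    unfolding holomorphic_map_def continuous_map_open_submanifold topspace_manifold by simp
qed

lemma holomorphic_map_id:
  assumes A: "holomorphic_atlas A"
  shows "holomorphic_map A A (\<lambda>x. x)"
proof -
  have "(\<lambda>x. x) = (id :: 'a \<Rightarrow> 'a)" by auto
  moreover have "{x \<in> U. x \<in> W} = U \<inter> W" for U W :: "'a set" by auto
  ultimately show ?thesis
    using atlas_transition(2)[OF A] unfolding holomorphic_map_def by auto
qed

lemma holomorphic_map_restrict:
  assumes "holomorphic_atlas A" "openin (manifold_topology A) (points A \<inter> T)" "holomorphic_map A B F"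
  shows "holomorphic_map (open_submanifold A T) B F"
proof -
  have sub: "holomorphic_atlas (open_submanifold A T)"
    using assms by (intro holomorphic_atlas_open_submanifold)
  then have "holomorphic_map (open_submanifold A T) A (\<lambda>x. x)"
    using holomorphic_map_id holomorphic_map_open_submanifold by blast
  from holomorphic_map_compose[OF sub assms(1) this assms(3)] show ?thesis .
qed

text \<open>Generalises \<open>holomorphic_disc\<close> from centred discs to arbitrary parameter
  sets, so that curves can be restricted, lifted locally and glued.\<close>

definition holomorphic_curve :: "('a, 'n::finite) atlas \<Rightarrow> complex set \<Rightarrow> (complex \<Rightarrow> 'a) \<Rightarrow> bool"
  where "holomorphic_curve A S f \<longleftrightarrow>
    continuous_map (top_of_set S) (manifold_topology A) f \<and>
    (\<forall>(U, \<phi>)\<in>A. \<forall>i. (\<lambda>z. \<phi> (f z) $ i) holomorphic_on {z \<in> S. f z \<in> U})"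

lemma holomorphic_disc_curve: "holomorphic_disc A r f \<longleftrightarrow> holomorphic_curve A (ball 0 r) f"
  by (simp add: holomorphic_disc_def holomorphic_curve_def)

lemma curve_points: "holomorphic_curve A S f \<Longrightarrow> z \<in> S \<Longrightarrow> f z \<in> points A"
  unfolding holomorphic_curve_def
  using continuous_map_image_subset_topspace[of "top_of_set S" "manifold_topology A" f] by (auto simp: topspace_manifold)

lemma curve_open:
  assumes "holomorphic_curve A S f" "open S" "openin (manifold_topology A) N"
  shows "open {z \<in> S. f z \<in> N}"
  using openin_continuous_map_preimage[of "top_of_set S" _ f N] assms
  by (auto simp: holomorphic_curve_def openin_open_eq)

lemma curve_chart:
  "holomorphic_curve A S f \<Longrightarrow> (U, \<phi>) \<in> A \<Longrightarrow> (\<lambda>z. \<phi> (f z) $ i) holomorphic_on {z \<in> S. f z \<in> U}"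
  by (auto simp: holomorphic_curve_def)

lemma curve_subset: "holomorphic_curve A S f \<Longrightarrow> T \<subseteq> S \<Longrightarrow> holomorphic_curve A T f"
  unfolding holomorphic_curve_def
  by (auto intro: continuous_map_from_subtopology_mono intro!: holomorphic_on_subset[of _ "{z \<in> S. f z \<in> U}" "{z \<in> T. f z \<in> U}" for U]
      split: prod.splits)

lemma curveI:
  assumes "open S" "\<And>z. z \<in> S \<Longrightarrow> f z \<in> points A"
    and "\<And>U \<phi> W. (U, \<phi>) \<in> A \<Longrightarrow> open W \<Longrightarrow> open {z \<in> S. f z \<in> U \<and> \<phi> (f z) \<in> W}"
    and "\<And>U \<phi> i. (U, \<phi>) \<in> A \<Longrightarrow> (\<lambda>z. \<phi> (f z) $ i) holomorphic_on {z \<in> S. f z \<in> U}"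
  shows "holomorphic_curve A S f"
  unfolding holomorphic_curve_def continuous_map_manifold using assms
  by (auto simp: openin_open_eq)

text \<open>Will glue the lifts near the meeting points with the cusp to the curve away from
  them.\<close>

lemma curve_local:
  assumes "\<And>z. z \<in> S \<Longrightarrow> \<exists>T. open T \<and> z \<in> T \<and> holomorphic_curve A T f"
  shows "holomorphic_curve A S f"
proof -
  obtain T where T: "\<And>z. z \<in> S \<Longrightarrow> open (T z)" "\<And>z. z \<in> S \<Longrightarrow> z \<in> T z"
      "\<And>z. z \<in> S \<Longrightarrow> holomorphic_curve A (T z) f"
    using assms by metis
  \<comment> \<open>\<open>S\<close> is arbitrary, but the union of the neighbourhoods is open,
    which is what the gluing of holomorphic functions requires.\<close>
  define R where "R = (\<Union>z\<in>S. T z)"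
  have "open R" "S \<subseteq> R" using T by (auto simp: R_def)
  have "holomorphic_curve A R f"
  proof (rule curveI[OF \<open>open R\<close>])
    show "f z \<in> points A" if "z \<in> R" for z using that T(3) curve_points by (fastforce simp: R_def)
  next
    fix U \<phi> and W :: "(complex^'b) set" assume U: "(U, \<phi>) \<in> A" "open W"
    have "{z \<in> R. f z \<in> U \<and> \<phi> (f z) \<in> W} = (\<Union>s\<in>S. {z \<in> T s. f z \<in> U \<inter> \<phi> -` W})"
      by (auto simp: R_def)
    then show "open {z \<in> R. f z \<in> U \<and> \<phi> (f z) \<in> W}"
      using curve_open[OF T(3) T(1) openin_chart_vimage[OF U]] by auto
  next
    fix U \<phi> i assume U: "(U, \<phi>) \<in> A"
    have "(\<lambda>z. \<phi> (f z) $ i) holomorphic_on (\<Union>s\<in>S. {z \<in> T s. f z \<in> U})"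
      using curve_chart[OF T(3) U] curve_open[OF T(3) T(1) openin_chart[OF U]]
      by (intro holomorphic_on_UN_open) auto
    moreover have "(\<Union>s\<in>S. {z \<in> T s. f z \<in> U}) = {z \<in> R. f z \<in> U}" by (auto simp: R_def)
    ultimately show "(\<lambda>z. \<phi> (f z) $ i) holomorphic_on {z \<in> R. f z \<in> U}" by simp
  qed
  then show ?thesis using \<open>S \<subseteq> R\<close> by (rule curve_subset)
qed

lemma curve_cong:
  assumes "holomorphic_curve A S f" "\<And>z. z \<in> S \<Longrightarrow> f z = g z"
  shows "holomorphic_curve A S g"
proof -
  have eq: "{z \<in> S. f z \<in> U} = {z \<in> S. g z \<in> U}" for U using assms(2) by auto
  have "(\<lambda>z. \<phi> (g z) $ i) holomorphic_on {z \<in> S. g z \<in> U}" if "(U, \<phi>) \<in> A" for U \<phi> i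
    by (rule holomorphic_transform[OF curve_chart[OF assms(1) that, unfolded eq]]) (simp add: assms(2))
  moreover have "continuous_map (top_of_set S) (manifold_topology A) g"
    using assms by (auto simp: holomorphic_curve_def intro: continuous_map_eq)
  ultimately show ?thesis
    unfolding holomorphic_curve_def by auto
qed

lemma curve_open_submanifold:
  "holomorphic_curve (open_submanifold A T) S f \<longleftrightarrow> holomorphic_curve A S f \<and> f ` S \<subseteq> T"
proof (cases "f ` S \<subseteq> T")
  case True
  then have "{z \<in> S. f z \<in> U \<inter> T} = {z \<in> S. f z \<in> U}" for U by auto
  then have "(\<forall>(U, \<phi>)\<in>open_submanifold A T. \<forall>i. (\<lambda>z. \<phi> (f z) $ i) holomorphic_on {z \<in> S. f z \<in> U}) \<longleftrightarrow>
    (\<forall>(U, \<phi>)\<in>A. \<forall>i. (\<lambda>z. \<phi> (f z) $ i) holomorphic_on {z \<in> S. f z \<in> U})"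
    by (auto simp: open_submanifold_def)
  then show ?thesis
    unfolding holomorphic_curve_def continuous_map_open_submanifold using True by simp
next
  case False
  then show ?thesis
    unfolding holomorphic_curve_def continuous_map_open_submanifold by simp
qed

lemma curve_compose:
  assumes f: "holomorphic_curve A S f" and t: "\<tau> holomorphic_on R" "\<tau> ` R \<subseteq> S"
  shows "holomorphic_curve A R (\<lambda>z. f (\<tau> z))"
  unfolding holomorphic_curve_def
proof safe
  have "continuous_map (top_of_set R) (top_of_set S) \<tau>"
    using t holomorphic_on_imp_continuous_on by auto
  then show "continuous_map (top_of_set R) (manifold_topology A) (\<lambda>z. f (\<tau> z))"
    using f continuous_map_compose[of "top_of_set R" "top_of_set S" \<tau> "manifold_topology A" f]
    by (simp add: holomorphic_curve_def o_def)
  fix U \<phi> i assume U: "(U, \<phi>) \<in> A"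
  show "(\<lambda>z. \<phi> (f (\<tau> z)) $ i) holomorphic_on {z \<in> R. f (\<tau> z) \<in> U}"
    using holomorphic_on_compose_gen[OF holomorphic_on_subset[OF t(1)] curve_chart[OF f U, of i],
        of "{z \<in> R. f (\<tau> z) \<in> U}"] t(2) by (auto simp: o_def)
qed

lemma curve_holomorphic_map:
  assumes f: "holomorphic_curve A S f" "open S" and A: "holomorphic_atlas A" and F: "holomorphic_map A B F"
  shows "holomorphic_curve B S (\<lambda>z. F (f z))"
  unfolding holomorphic_curve_def
proof safe
  show "continuous_map (top_of_set S) (manifold_topology B) (\<lambda>z. F (f z))"
    using f continuous_map_compose[OF _ holomorphic_map_continuous[OF F]]
    by (auto simp: holomorphic_curve_def o_def)
  fix W \<psi> i assume W: "(W, \<psi>) \<in> B"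
  \<comment> \<open>These open sets cover the parameters to be treated. On each of them the curve
    stays in one chart of \<open>A\<close>, so the coordinates of its image are obtained from a
    chart expression of \<open>F\<close>.\<close>
  define T where "T U = {z \<in> S. f z \<in> U \<inter> {x \<in> points A. F x \<in> W}}" for U
  have op: "open (T U)" if "(U, \<phi>) \<in> A" for U \<phi> unfolding T_def
    by (intro curve_open[OF f] openin_Int openin_chart[OF that] openin_holomorphic_map_preimage[OF F] openin_chart[OF W])
  have hol: "(\<lambda>z. \<psi> (F (f z)) $ i) holomorphic_on T U" if U: "(U, \<phi>) \<in> A" for U \<phi>
  proof -
    have "(\<lambda>z. (\<psi> \<circ> F \<circ> inv_into U \<phi>) (\<phi> (f z)) $ i) holomorphic_on T U"
    proof (rule holomorphic_vec_on_curve[OF _ op[OF U] holomorphic_map_charts[OF F U W]])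
      show "(\<lambda>z. \<phi> (f z) $ i) holomorphic_on T U" for i
        by (rule holomorphic_on_subset[OF curve_chart[OF f(1) U]]) (auto simp: T_def)
    qed (auto simp: T_def)
    then show ?thesis
      by (rule holomorphic_transform) (auto simp: T_def chart_inv[OF A U])
  qed
  have "(\<lambda>z. \<psi> (F (f z)) $ i) holomorphic_on (\<Union>U\<in>fst ` A. T U)"
    using op hol by (intro holomorphic_on_UN_open) auto
  moreover have "{z \<in> S. F (f z) \<in> W} \<subseteq> (\<Union>U\<in>fst ` A. T U)"
  proof
    fix z assume z: "z \<in> {z \<in> S. F (f z) \<in> W}"
    then have "f z \<in> points A" using curve_points[OF f(1)] by auto
    then obtain U \<phi> where "(U, \<phi>) \<in> A" "f z \<in> U" using points_chart by meson
    then show "z \<in> (\<Union>U\<in>fst ` A. T U)" using z \<open>f z \<in> points A\<close> by (force simp: T_def)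
  qed
  ultimately show "(\<lambda>z. \<psi> (F (f z)) $ i) holomorphic_on {z \<in> S. F (f z) \<in> W}"
    by (rule holomorphic_on_subset)
qed

section \<open>The plane as a complex manifold\<close>

lemma holomorphic_atlas_plane: "holomorphic_atlas complex_plane"
proof -
  have "inv_into UNIV (\<lambda>x::complex^2. x) = (\<lambda>x. x)" by (simp add: inv_equality fun_eq_iff)
  moreover have "holomorphic_vec_on (\<lambda>x::complex^2. x) UNIV"
    unfolding holomorphic_vec_on_def by (auto intro!: exI[of _ "\<lambda>x. x"])
  ultimately show ?thesis by (auto simp: holomorphic_atlas_def complex_plane_def o_def)
qed

lemma points_plane [simp]: "points complex_plane = UNIV"
  by (auto simp: points_def complex_plane_def)

lemma openin_plane [simp]: "openin (manifold_topology complex_plane) N \<longleftrightarrow> open N"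
proof
  assume "openin (manifold_topology complex_plane) N"
  from open_chart_image[OF holomorphic_atlas_plane _ this, of UNIV "\<lambda>x. x"]
  show "open N" by (simp add: complex_plane_def)
next
  assume "open N"
  with openin_chart_vimage[of UNIV "\<lambda>x. x" complex_plane N]
  show "openin (manifold_topology complex_plane) N" by (simp add: complex_plane_def)
qed

lemma curve_plane:
  assumes "open S"
  shows "holomorphic_curve complex_plane S f \<longleftrightarrow> (\<forall>i. (\<lambda>z. f z $ i) holomorphic_on S)"
proof
  assume "holomorphic_curve complex_plane S f"
  then show "\<forall>i. (\<lambda>z. f z $ i) holomorphic_on S"
    by (auto simp: holomorphic_curve_def complex_plane_def)
next
  assume f: "\<forall>i. (\<lambda>z. f z $ i) holomorphic_on S"
  then have "continuous_on S f"
    by (auto simp: continuous_on_vec_iff intro: holomorphic_on_imp_continuous_on)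
  then have "open {z \<in> S. f z \<in> W}" if "open W" for W
    using continuous_open_preimage[OF _ assms that, of f] by (simp add: vimage_def Int_def)
  then show "holomorphic_curve complex_plane S f"
    using f by (intro curveI assms) (auto simp: complex_plane_def points_def)
qed

lemma holomorphic_map_plane_vec:
  assumes "holomorphic_map (open_submanifold complex_plane D) complex_plane F" "open D"
  shows "holomorphic_vec_on F D"
proof -
  have "holomorphic_vec_on ((\<lambda>x. x) \<circ> F \<circ> inv_into D (\<lambda>x. x)) ((\<lambda>x. x) ` {x \<in> D. F x \<in> UNIV})"
    by (rule holomorphic_map_charts[OF assms(1)]) (auto simp: open_submanifold_def complex_plane_def)
  then have "holomorphic_vec_on (F \<circ> inv_into D (\<lambda>x. x)) D"
    by (simp add: o_def)
  then show ?thesis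
    by (rule holomorphic_vec_on_cong[OF assms(2)]) (simp add: inv_into_f_f[of "\<lambda>x. x" D, unfolded inj_on_def])
qed

lemma holomorphic_map_plane_chart:
  assumes A: "holomorphic_atlas A" "(U, \<phi>) \<in> A" and "holomorphic_map A complex_plane F"
  shows "holomorphic_vec_on (F \<circ> inv_into U \<phi>) (\<phi> ` U)"
proof -
  have "holomorphic_vec_on ((\<lambda>x. x) \<circ> F \<circ> inv_into U \<phi>) (\<phi> ` {x \<in> U. F x \<in> UNIV})"
    by (rule holomorphic_map_charts[OF assms(3,2)]) (auto simp: complex_plane_def)
  then show ?thesis by (simp add: o_def)
qed

text \<open>Produces curves in a manifold from coordinate functions; the lifts to the blow-up of the
  plane are built with it.\<close>

lemma curve_of_chart:
  assumes A: "holomorphic_atlas A" "(U, \<phi>) \<in> A" and S: "open S"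
    and c: "\<And>i. (\<lambda>z. c z $ i) holomorphic_on S" "c ` S \<subseteq> \<phi> ` U"
  shows "holomorphic_curve A S (\<lambda>z. inv_into U \<phi> (c z))"
proof -
  have cont: "continuous_on S c"
    using c by (auto simp: continuous_on_vec_iff intro: holomorphic_on_imp_continuous_on)
  have cU: "inv_into U \<phi> (c z) \<in> U" if "z \<in> S" for z using that c(2) by (intro inv_into_into) auto
  have op: "open {z \<in> S. inv_into U \<phi> (c z) \<in> N}" if "openin (manifold_topology A) N" for N
  proof -
    have "{z \<in> S. inv_into U \<phi> (c z) \<in> N} = {z \<in> S. c z \<in> \<phi> ` (U \<inter> N)}"
    proof safe
      fix z assume z: "z \<in> S" "inv_into U \<phi> (c z) \<in> N"
      have "c z = \<phi> (inv_into U \<phi> (c z))"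
        using z(1) c(2) by (metis f_inv_into_f image_subset_iff)
      then show "c z \<in> \<phi> ` (U \<inter> N)" using cU[OF z(1)] z(2) by blast
    qed (simp add: chart_inv[OF A])
    then show ?thesis
      using continuous_open_preimage[OF cont S open_chart_image[OF A that]]
      by (simp add: vimage_def Int_def)
  qed
  show ?thesis
  proof (rule curveI[OF S])
    show "inv_into U \<phi> (c z) \<in> points A" if "z \<in> S" for z
      using cU[OF that] chart_subset_points[OF A(2)] by auto
    fix W \<psi> assume W: "(W, \<psi>) \<in> A"
    show "open {z \<in> S. inv_into U \<phi> (c z) \<in> W \<and> \<psi> (inv_into U \<phi> (c z)) \<in> W'}" if "open W'" for W'
      using op[OF openin_chart_vimage[OF W that]] by simp
    fix i
    have "(\<lambda>z. (\<psi> \<circ> inv_into U \<phi>) (c z) $ i) holomorphic_on {z \<in> S. inv_into U \<phi> (c z) \<in> W}"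
    proof (rule holomorphic_vec_on_curve[OF _ op[OF openin_chart[OF W]] atlas_transition(2)[OF A W]])
      show "c ` {z \<in> S. inv_into U \<phi> (c z) \<in> W} \<subseteq> \<phi> ` (U \<inter> W)"
      proof safe
        fix z assume z: "z \<in> S" "inv_into U \<phi> (c z) \<in> W"
        have "c z = \<phi> (inv_into U \<phi> (c z))"
          using z(1) c(2) by (metis f_inv_into_f image_subset_iff)
        then show "c z \<in> \<phi> ` (U \<inter> W)" using cU[OF z(1)] z(2) by blast
      qed
    qed (use c(1) in \<open>auto intro: holomorphic_on_subset\<close>)
    then show "(\<lambda>z. \<psi> (inv_into U \<phi> (c z)) $ i) holomorphic_on {z \<in> S. inv_into U \<phi> (c z) \<in> W}"
      by (simp add: o_def)
  qed
qed

section \<open>Order of contact\<close>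

lemma norm_smult_vec: "norm (t *s v) = norm t * norm (v :: complex ^ 'n)"
  by (simp add: norm_vec_def norm_mult L2_set_right_distrib)

lemma norm_vec_le_sum: "norm (v :: complex ^ 'n) \<le> (\<Sum>i\<in>UNIV. norm (v $ i))"
  unfolding norm_vec_def by (rule L2_set_le_sum) auto

text \<open>\<open>holomorphic_vec_on\<close> provides a derivative at each point but no continuity
  of the derivative, so a mean value estimate is not at hand. The bound comes from the Schwarz lemma
  on the complex line through \<open>x\<close> and \<open>y\<close>, applied to each component of
  \<open>f\<close>.\<close>

lemma holomorphic_vec_on_lipschitz:
  fixes f :: "complex ^ 'n \<Rightarrow> complex ^ 'm"
  assumes f: "holomorphic_vec_on f S" and S: "open S" "p \<in> S"
  shows "\<exists>C \<delta>. \<delta> > 0 \<and> C \<ge> 0 \<and> (\<forall>x\<in>ball p \<delta>. \<forall>y\<in>ball p \<delta>. norm (f y - f x) \<le> C * norm (y - x))"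
proof -
  define M where "M = norm (f p) + 1"
  have "M > 0" by (simp add: M_def add_nonneg_pos)
  have "isCont f p"
    using holomorphic_vec_on_continuous[OF f] S continuous_on_eq_continuous_at by blast
  then have "\<forall>\<^sub>F x in nhds p. dist (f x) (f p) < 1"
    using tendstoD[of f "f p" "nhds p" 1] by (simp add: continuous_at tendsto_at_iff_tendsto_nhds)
  moreover have "\<forall>\<^sub>F x in nhds p. x \<in> S" using S by (rule eventually_nhds_in_open)
  ultimately have "\<forall>\<^sub>F x in nhds p. dist (f x) (f p) < 1 \<and> x \<in> S" by (rule eventually_conj)
  then obtain e where e: "e > 0" "\<And>x. dist x p < e \<Longrightarrow> dist (f x) (f p) < 1 \<and> x \<in> S"
    by (auto simp: eventually_nhds_metric)
  have bd: "x \<in> S" "norm (f x) < M" if "dist x p < e" for x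
    using e(2)[OF that] norm_triangle_ineq2[of "f x" "f p"] by (auto simp: M_def dist_norm)
  define r where "r = e / 2"
  have r: "r > 0" "e = 2 * r" using e(1) by (auto simp: r_def)
  have comp: "norm (f y $ i - f x $ i) \<le> 2 * M / r * norm (y - x)"
    if x: "x \<in> ball p (r / 2)" and y: "y \<in> ball p (r / 2)" for x y i
  proof (cases "y = x")
    case False
    \<comment> \<open>With the parameter \<open>w\<close> stretched by \<open>T\<close>, the unit
      disc becomes a disc of radius \<open>r\<close> around \<open>x\<close> on that line, and
      \<open>y\<close> is reached at \<open>w = 1 / T\<close>.\<close>
    define T where "T = r / norm (y - x)"
    have yx: "norm (y - x) < r"
      using x y dist_triangle_half_r[of p y r x] by (simp add: dist_norm norm_minus_commute)
    have T: "T > 1" using yx False r by (simp add: T_def field_simps)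
    \<comment> \<open>Both values of \<open>f\<close> are smaller than \<open>M\<close> in norm, so
      division by \<open>2 * M\<close> maps the unit disc into itself.\<close>
    define h where "h w = (f (x + (of_real T * w) *s (y - x)) $ i - f x $ i) / of_real (2 * M)" for w
    have near: "dist (x + (of_real T * w) *s (y - x)) p < e" if "w \<in> ball 0 1" for w
    proof -
      have "norm (x + (of_real T * w) *s (y - x) - p) \<le> norm (x - p) + norm ((of_real T * w) *s (y - x))"
        using norm_triangle_ineq[of "x - p" "(of_real T * w) *s (y - x)"] by (simp add: algebra_simps)
      also have "norm ((of_real T * w) *s (y - x)) = r * norm w"
        unfolding norm_smult_vec using r(1) False by (simp add: norm_mult norm_divide T_def)
      also have "norm (x - p) + r * norm w < r + r * 1"
        using x that r by (intro add_strict_mono mult_strict_left_mono) (auto simp: dist_norm norm_minus_commute)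
      finally show ?thesis by (simp add: r dist_norm)
    qed
    have "(\<lambda>w. f (x + (of_real T * w) *s (y - x)) $ i) holomorphic_on ball 0 1"
    proof (rule holomorphic_vec_on_curve[OF _ _ f])
      show "(\<lambda>w. (x + (of_real T * w) *s (y - x)) $ i) holomorphic_on ball 0 1" for i
        by (auto intro!: holomorphic_intros)
    qed (use near bd in auto)
    then have hol: "h holomorphic_on ball 0 1"
      unfolding h_def using \<open>M > 0\<close> by (intro holomorphic_intros) auto
    have hlt: "norm (h w) < 1" if "norm w < 1" for w
    proof -
      let ?v = "x + (of_real T * w) *s (y - x)"
      have "norm (f ?v $ i - f x $ i) \<le> norm (f ?v $ i) + norm (f x $ i)" by (rule norm_triangle_ineq4)
      also have "\<dots> \<le> norm (f ?v) + norm (f x)" by (intro add_mono Finite_Cartesian_Product.norm_nth_le)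
      also have "\<dots> < M + M"
        using near[of w] that x r by (intro add_strict_mono bd) (auto simp: dist_commute)
      finally show ?thesis using \<open>M > 0\<close> by (simp add: h_def norm_divide norm_mult)
    qed
    have T': "norm (1 / of_real T :: complex) < 1" using T by (simp add: norm_divide)
    have "norm (h (1 / of_real T)) \<le> norm (1 / of_real T :: complex)"
      by (rule Schwarz_Lemma(1)[OF hol _ hlt T']) (simp add: h_def)
    moreover have "x + (of_real T * (1 / of_real T)) *s (y - x) = y" using T by simp
    ultimately have "norm ((f y $ i - f x $ i) / of_real (2 * M)) \<le> 1 / T"
      using T by (simp add: h_def norm_divide)
    then have "norm (f y $ i - f x $ i) / (2 * M) \<le> norm (y - x) / r"
      using \<open>M > 0\<close> by (simp add: norm_divide T_def norm_mult)
    then show ?thesis using \<open>M > 0\<close> r by (simp add: field_simps)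
  qed simp
  have "norm (f y - f x) \<le> (real CARD('m) * (2 * M / r)) * norm (y - x)"
    if "x \<in> ball p (r / 2)" "y \<in> ball p (r / 2)" for x y
  proof -
    have "norm (f y - f x) \<le> (\<Sum>i\<in>UNIV. norm ((f y - f x) $ i))" by (rule norm_vec_le_sum)
    also have "\<dots> \<le> (\<Sum>i\<in>(UNIV::'m set). 2 * M / r * norm (y - x))"
      by (rule sum_mono) (use comp[OF that] in simp)
    finally show ?thesis by simp
  qed
  then show ?thesis using r \<open>M > 0\<close>
    by (intro exI[of _ "real CARD('m) * (2 * M / r)"] exI[of _ "r / 2"]) auto
qed

lemma norm_vec2_le: "norm (v :: complex ^ 2) \<le> norm (v $ 1) + norm (v $ 2)"
  using norm_vec_le_sum[of v] by (simp add: sum_2)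

text \<open>The exponent is counted as in the O-notation: \<open>k = 0\<close> says merely that the
  difference stays bounded. The filter \<open>at z\<^sub>0\<close> leaves out the point
  itself.\<close>

definition vec_contact :: "complex \<Rightarrow> nat \<Rightarrow> (complex \<Rightarrow> complex ^ 'n) \<Rightarrow> (complex \<Rightarrow> complex ^ 'n) \<Rightarrow> bool"
  where "vec_contact z\<^sub>0 k a b \<longleftrightarrow>
    (\<lambda>z. norm (b z - a z)) \<in> O[at z\<^sub>0](\<lambda>z. norm (z - z\<^sub>0) ^ k)"

lemma vec_contact_iff:
  "vec_contact z\<^sub>0 k a b \<longleftrightarrow> (\<forall>i. (\<lambda>z. b z $ i - a z $ i) \<in> O[at z\<^sub>0](\<lambda>z. (z - z\<^sub>0) ^ k))" (is "?L = ?R")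
proof
  assume ?L
  show ?R
  proof
    fix i
    have "(\<lambda>z. norm (b z $ i - a z $ i)) \<in> O[at z\<^sub>0](\<lambda>z. norm (b z - a z))"
      using Finite_Cartesian_Product.norm_nth_le[of "b z - a z" i for z]
      by (intro bigoI[of _ 1]) auto
    also have "(\<lambda>z. norm (b z - a z)) \<in> O[at z\<^sub>0](\<lambda>z. norm (z - z\<^sub>0) ^ k)"
      using \<open>?L\<close> by (simp add: vec_contact_def)
    finally show "(\<lambda>z. b z $ i - a z $ i) \<in> O[at z\<^sub>0](\<lambda>z. (z - z\<^sub>0) ^ k)"
      by (simp flip: norm_power)
  qed
next
  assume ?R
  have "(\<lambda>z. norm (b z - a z)) \<in> O[at z\<^sub>0](\<lambda>z. \<Sum>i\<in>UNIV. norm (b z $ i - a z $ i))"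
    using norm_vec_le_sum[of "b z - a z" for z]
    by (intro bigoI[of _ 1]) (auto intro!: always_eventually order_trans[OF _ abs_ge_self])
  also have "(\<lambda>z. \<Sum>i\<in>UNIV. norm (b z $ i - a z $ i)) \<in> O[at z\<^sub>0](\<lambda>z. norm (z - z\<^sub>0) ^ k)"
    using \<open>?R\<close> by (intro big_sum_in_bigo) (simp flip: norm_power)
  finally show ?L by (simp add: vec_contact_def)
qed

lemma vec_contact_iff2:
  fixes a b :: "complex \<Rightarrow> complex ^ 2"
  shows "vec_contact z\<^sub>0 k a b \<longleftrightarrow> (\<lambda>z. b z $ 1 - a z $ 1) \<in> O[at z\<^sub>0](\<lambda>z. (z - z\<^sub>0) ^ k) \<and>
    (\<lambda>z. b z $ 2 - a z $ 2) \<in> O[at z\<^sub>0](\<lambda>z. (z - z\<^sub>0) ^ k)"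
  by (simp add: vec_contact_iff forall_2)

text \<open>Contact of order 0 does not force the curves to meet, so the common value is demanded
  separately. One chart may serve as a witness, since by \<open>vec_contact_map\<close> the estimate
  passes to all others.\<close>

definition curves_contact :: "('a, 'n::finite) atlas \<Rightarrow> complex \<Rightarrow> nat \<Rightarrow> (complex \<Rightarrow> 'a) \<Rightarrow> (complex \<Rightarrow> 'a) \<Rightarrow> bool"
  where "curves_contact A z\<^sub>0 k \<alpha> \<beta> \<longleftrightarrow> \<alpha> z\<^sub>0 = \<beta> z\<^sub>0 \<and>
    (\<exists>(U, \<phi>)\<in>A. \<alpha> z\<^sub>0 \<in> U \<and> vec_contact z\<^sub>0 k (\<lambda>z. \<phi> (\<alpha> z)) (\<lambda>z. \<phi> (\<beta> z)))"

lemma curve_eventually_in: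
  assumes "holomorphic_curve A S f" "open S" "z\<^sub>0 \<in> S" "openin (manifold_topology A) N" "f z\<^sub>0 \<in> N"
  shows "\<forall>\<^sub>F z in nhds z\<^sub>0. z \<in> S \<and> f z \<in> N"
  using eventually_nhds_in_open[OF curve_open[OF assms(1,2,4)], of z\<^sub>0] assms(3,5) by simp

lemma curve_chart_continuous:
  assumes f: "holomorphic_curve A S f" "open S" "z\<^sub>0 \<in> S" "(U, \<phi>) \<in> A" "f z\<^sub>0 \<in> U"
  shows "isCont (\<lambda>z. \<phi> (f z)) z\<^sub>0"
proof -
  have "continuous_on {z \<in> S. f z \<in> U} (\<lambda>z. \<phi> (f z))"
    using curve_chart[OF f(1,4)] by (auto simp: continuous_on_vec_iff intro: holomorphic_on_imp_continuous_on)
  then show ?thesis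
    using curve_open[OF f(1,2) openin_chart[OF f(4)]] f(3,5) continuous_on_eq_continuous_at by blast
qed

text \<open>The local Lipschitz bound turns an estimate for the arguments of \<open>F\<close> into
  one for its values.\<close>

lemma vec_contact_compose:
  assumes a: "isCont a z\<^sub>0" "isCont b z\<^sub>0" "a z\<^sub>0 = b z\<^sub>0" and k: "vec_contact z\<^sub>0 k a b"
    and F: "holomorphic_vec_on F S" "open S" "a z\<^sub>0 \<in> S"
  shows "vec_contact z\<^sub>0 k (\<lambda>z. F (a z)) (\<lambda>z. F (b z))"
proof -
  obtain C \<delta> where C: "\<delta> > 0" "C \<ge> 0"
      "\<And>x y. x \<in> ball (a z\<^sub>0) \<delta> \<Longrightarrow> y \<in> ball (a z\<^sub>0) \<delta> \<Longrightarrow> norm (F y - F x) \<le> C * norm (y - x)"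
    using holomorphic_vec_on_lipschitz[OF F] by metis
  have ev: "\<forall>\<^sub>F z in at z\<^sub>0. c z \<in> ball (c z\<^sub>0) \<delta>" if "isCont c z\<^sub>0" for c :: "complex \<Rightarrow> complex^'a"
    using tendstoD[OF that[unfolded isCont_def] C(1)] by (simp add: dist_commute)
  have "(\<lambda>z. norm (F (b z) - F (a z))) \<in> O[at z\<^sub>0](\<lambda>z. norm (b z - a z))"
  proof (rule bigoI[of _ C])
    show "\<forall>\<^sub>F z in at z\<^sub>0. norm (norm (F (b z) - F (a z))) \<le> C * norm (norm (b z - a z))"
      using ev[OF a(1)] ev[OF a(2)] by eventually_elim (use C(3) a(3) in auto)
  qed
  also have "(\<lambda>z. norm (b z - a z)) \<in> O[at z\<^sub>0](\<lambda>z. norm (z - z\<^sub>0) ^ k)"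
    using k by (simp add: vec_contact_def)
  finally show ?thesis by (simp add: vec_contact_def)
qed

lemma vec_contact_cong:
  assumes "vec_contact z\<^sub>0 k a b" "\<forall>\<^sub>F z in at z\<^sub>0. a z = a' z" "\<forall>\<^sub>F z in at z\<^sub>0. b z = b' z"
  shows "vec_contact z\<^sub>0 k a' b'"
proof -
  have "\<forall>\<^sub>F z in at z\<^sub>0. norm (b z - a z) = norm (b' z - a' z)"
    using assms(2,3) by eventually_elim simp
  from landau_o.big.in_cong[OF this] show ?thesis using assms(1) by (simp add: vec_contact_def)
qed

lemma vec_contact_mono:
  assumes "vec_contact z\<^sub>0 k a b" "j \<le> k"
  shows "vec_contact z\<^sub>0 j a b"
proof -
  have "(\<lambda>z. norm (z - z\<^sub>0) ^ k) \<in> O[at z\<^sub>0](\<lambda>z. norm (z - z\<^sub>0) ^ j)"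
  proof (rule bigoI[of _ 1])
    have "\<forall>\<^sub>F z in at z\<^sub>0. dist z z\<^sub>0 < 1" by (auto simp: eventually_at intro: exI[of _ 1])
    then show "\<forall>\<^sub>F z in at z\<^sub>0. norm (norm (z - z\<^sub>0) ^ k) \<le> 1 * norm (norm (z - z\<^sub>0) ^ j)"
      by eventually_elim (use assms(2) in \<open>auto simp: dist_norm intro!: power_decreasing\<close>)
  qed
  then show ?thesis
    using assms(1) unfolding vec_contact_def by (rule landau_o.big_trans[rotated])
qed

text \<open>Gives both the independence of the order of contact from the charts and its preservation
  by holomorphic maps: near \<open>z\<^sub>0\<close> the curves stay in one chart \<open>U\<close>,
  in which \<open>F\<close> has a coordinate expression.\<close>

lemma vec_contact_map:
  assumes A: "holomorphic_atlas A" and F: "holomorphic_map A B F"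
    and \<alpha>: "holomorphic_curve A R \<alpha>" and \<beta>: "holomorphic_curve A R \<beta>" and R: "open R" "z\<^sub>0 \<in> R"
    and k: "curves_contact A z\<^sub>0 k \<alpha> \<beta>" and W: "(W, \<psi>) \<in> B" "F (\<alpha> z\<^sub>0) \<in> W"
  shows "vec_contact z\<^sub>0 k (\<lambda>z. \<psi> (F (\<alpha> z))) (\<lambda>z. \<psi> (F (\<beta> z)))"
proof -
  obtain U \<phi> where U: "(U, \<phi>) \<in> A" "\<alpha> z\<^sub>0 \<in> U"
    and c: "\<alpha> z\<^sub>0 = \<beta> z\<^sub>0" "vec_contact z\<^sub>0 k (\<lambda>z. \<phi> (\<alpha> z)) (\<lambda>z. \<phi> (\<beta> z))"
    using k by (auto simp: curves_contact_def)
  define N where "N = {x \<in> points A. F x \<in> W}"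
  have N: "openin (manifold_topology A) N"
    unfolding N_def by (rule openin_holomorphic_map_preimage[OF F openin_chart[OF W(1)]])
  have "\<alpha> z\<^sub>0 \<in> points A" using curve_points[OF \<alpha> R(2)] .
  have contact: "vec_contact z\<^sub>0 k (\<lambda>z. (\<psi> \<circ> F \<circ> inv_into U \<phi>) (\<phi> (\<alpha> z))) (\<lambda>z. (\<psi> \<circ> F \<circ> inv_into U \<phi>) (\<phi> (\<beta> z)))"
  proof (rule vec_contact_compose[OF _ _ _ c(2)])
    show "isCont (\<lambda>z. \<phi> (\<alpha> z)) z\<^sub>0" by (rule curve_chart_continuous[OF \<alpha> R U])
    show "isCont (\<lambda>z. \<phi> (\<beta> z)) z\<^sub>0" using curve_chart_continuous[OF \<beta> R U(1)] U c by simp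
    show "holomorphic_vec_on (\<psi> \<circ> F \<circ> inv_into U \<phi>) (\<phi> ` (U \<inter> N))"
      by (rule holomorphic_vec_on_mono[OF holomorphic_map_charts[OF F U(1) W(1)]]) (auto simp: N_def)
    show "open (\<phi> ` (U \<inter> N))" by (rule open_chart_image[OF A U(1) N])
    show "\<phi> (\<alpha> z\<^sub>0) \<in> \<phi> ` (U \<inter> N)" using U W \<open>\<alpha> z\<^sub>0 \<in> points A\<close> by (auto simp: N_def)
  qed (use c in simp)
  have "\<forall>\<^sub>F z in at z\<^sub>0. (\<psi> \<circ> F \<circ> inv_into U \<phi>) (\<phi> (\<gamma> z)) = \<psi> (F (\<gamma> z))"
    if "holomorphic_curve A R \<gamma>" "\<gamma> z\<^sub>0 = \<alpha> z\<^sub>0" for \<gamma>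
  proof -
    have "\<forall>\<^sub>F z in nhds z\<^sub>0. z \<in> R \<and> \<gamma> z \<in> U"
      by (rule curve_eventually_in[OF that(1) R openin_chart[OF U(1)]]) (simp add: that U)
    then have "\<forall>\<^sub>F z in at z\<^sub>0. z \<in> R \<and> \<gamma> z \<in> U" by (simp add: eventually_at_filter eventually_mono)
    then show ?thesis by eventually_elim (simp add: chart_inv[OF A U(1)])
  qed
  from this[OF \<alpha> refl] this[OF \<beta> c(1)[symmetric]] show ?thesis
    by (rule vec_contact_cong[OF contact])
qed

lemma curves_contact_map:
  assumes "holomorphic_atlas A" "holomorphic_map A B F"
    and "holomorphic_curve A R \<alpha>" "holomorphic_curve A R \<beta>" "open R" "z\<^sub>0 \<in> R"
    and "curves_contact A z\<^sub>0 k \<alpha> \<beta>"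
  shows "curves_contact B z\<^sub>0 k (\<lambda>z. F (\<alpha> z)) (\<lambda>z. F (\<beta> z))"
proof -
  have "F (\<alpha> z\<^sub>0) \<in> points B"
    using holomorphic_map_points[OF assms(2) curve_points[OF assms(3,6)]] .
  then obtain W \<psi> where "(W, \<psi>) \<in> B" "F (\<alpha> z\<^sub>0) \<in> W" using points_chart by meson
  then show ?thesis
    using vec_contact_map[OF assms] assms(7) unfolding curves_contact_def by fastforce
qed

lemma curves_contact_cong:
  assumes "curves_contact A z\<^sub>0 k a b" "\<forall>\<^sub>F z in nhds z\<^sub>0. a z = a' z" "\<forall>\<^sub>F z in nhds z\<^sub>0. b z = b' z"
  shows "curves_contact A z\<^sub>0 k a' b'"
proof -
  have 0: "a z\<^sub>0 = a' z\<^sub>0" "b z\<^sub>0 = b' z\<^sub>0" using assms(2,3) by (auto dest: eventually_nhds_x_imp_x)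
  have "\<forall>\<^sub>F z in at z\<^sub>0. a z = a' z" "\<forall>\<^sub>F z in at z\<^sub>0. b z = b' z"
    using assms(2,3) by (auto simp: eventually_at_filter elim: eventually_mono)
  then have "\<forall>\<^sub>F z in at z\<^sub>0. \<phi> (a z) = \<phi> (a' z)" "\<forall>\<^sub>F z in at z\<^sub>0. \<phi> (b z) = \<phi> (b' z)" for \<phi> :: "'a \<Rightarrow> complex^'b"
    by (auto elim: eventually_mono)
  then show ?thesis
    using assms(1) 0 vec_contact_cong unfolding curves_contact_def by fastforce
qed

lemma curves_contact_plane:
  "curves_contact complex_plane z\<^sub>0 k a b \<longleftrightarrow> a z\<^sub>0 = b z\<^sub>0 \<and> vec_contact z\<^sub>0 k a b"
  by (simp add: curves_contact_def complex_plane_def)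

lemma curves_contact_open_submanifold:
  assumes "\<alpha> z\<^sub>0 \<in> T"
  shows "curves_contact (open_submanifold A T) z\<^sub>0 k \<alpha> \<beta> \<longleftrightarrow> curves_contact A z\<^sub>0 k \<alpha> \<beta>"
  using assms unfolding curves_contact_def open_submanifold_def by (force simp: case_prod_beta)

text \<open>The order \<open>k\<close> demanded below does not depend on \<open>\<beta>\<close>. The
  order \<open>j\<close> obtained above is recorded so that liftings through successive blow-ups can
  be chained.\<close>

definition contact_lift :: "('b, 'n::finite) atlas \<Rightarrow> ('b \<Rightarrow> 'a) \<Rightarrow> ('a, 'm::finite) atlas \<Rightarrow>
    (complex \<Rightarrow> 'b) \<Rightarrow> complex \<Rightarrow> nat \<Rightarrow> nat \<Rightarrow> bool"
  where "contact_lift B \<pi> A \<alpha> z\<^sub>0 j k \<longleftrightarrow> (\<forall>\<beta> R'. open R' \<longrightarrow> z\<^sub>0 \<in> R' \<longrightarrow> holomorphic_curve A R' \<beta> \<longrightarrow>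
    curves_contact A z\<^sub>0 k (\<lambda>z. \<pi> (\<alpha> z)) \<beta> \<longrightarrow>
    (\<exists>e>0. \<exists>\<gamma>. ball z\<^sub>0 e \<subseteq> R' \<and> holomorphic_curve B (ball z\<^sub>0 e) \<gamma> \<and>
       (\<forall>z\<in>ball z\<^sub>0 e. \<pi> (\<gamma> z) = \<beta> z) \<and> curves_contact B z\<^sub>0 j \<alpha> \<gamma>))"

section \<open>The blow-up of the plane\<close>

text \<open>Equal lines share the points \<open>(1, y)\<close> or \<open>(y, 1)\<close>, which
  determine the slope. The third equivalence is the coordinate change of the projective line from
  slope to inverse slope.\<close>

lemma complex_line_eq_iff:
  "complex_line (vector [1, x]) = complex_line (vector [1, y]) \<longleftrightarrow> x = y" (is ?A)
  "complex_line (vector [x, 1]) = complex_line (vector [y, 1]) \<longleftrightarrow> x = y" (is ?B)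
  "complex_line (vector [1, x]) = complex_line (vector [y, 1]) \<longleftrightarrow> x * y = 1" (is ?C)
proof -
  have mem: "v \<in> complex_line w \<longleftrightarrow> (\<exists>c. v$1 = c * w$1 \<and> v$2 = c * w$2)" for v w :: "complex^2"
    by (auto simp: complex_line_def vec_eq_iff forall_2 image_iff)
  have self: "w \<in> complex_line w" for w by (auto simp: mem intro: exI[of _ 1])
  have "x = y" if "vector [1, y] \<in> complex_line (vector [1, x])" using that by (simp add: mem)
  then show ?A using self[of "vector [1, y]"] by auto
  have "x = y" if "vector [y, 1] \<in> complex_line (vector [x, 1])" using that by (simp add: mem)
  then show ?B using self[of "vector [y, 1]"] by auto
  show ?C
  proof
    assume "complex_line (vector [1, x]) = complex_line (vector [y, 1])"
    with self[of "vector [y, 1]"] have "vector [y, 1] \<in> complex_line (vector [1, x])" by simp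
    then show "x * y = 1" by (simp add: mem mult.commute)
  next
    assume xy: "x * y = 1"
    have "v \<in> complex_line (vector [1, x]) \<longleftrightarrow> v \<in> complex_line (vector [y, 1])" for v
    proof
      assume "v \<in> complex_line (vector [1, x])"
      then obtain c where "v$1 = c" "v$2 = c * x" by (auto simp: mem)
      then show "v \<in> complex_line (vector [y, 1])"
        using xy by (auto simp: mem intro!: exI[of _ "c * x"])
    next
      assume "v \<in> complex_line (vector [y, 1])"
      then obtain c where "v$1 = c * y" "v$2 = c" by (auto simp: mem)
      then show "v \<in> complex_line (vector [1, x])"
        using xy by (auto simp: mem mult.commute mult.left_commute intro!: exI[of _ "c * y"])
    qed
    then show "complex_line (vector [1, x]) = complex_line (vector [y, 1])" by blast
  qed
qed

lemma fst_blowup_param: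
  "fst (blowup_param1 p) = vector [p $ 1, p $ 1 * p $ 2]"
  "fst (blowup_param2 p) = vector [p $ 1 * p $ 2, p $ 2]"
  by (simp_all add: blowup_param1_def blowup_param2_def)

lemma inj_blowup_param: "inj blowup_param1" "inj blowup_param2"
  by (auto simp: inj_def blowup_param1_def blowup_param2_def complex_line_eq_iff vec2_eq_iff)

lemma blowup_param_eq_iff:
  "blowup_param1 p = blowup_param2 q \<longleftrightarrow> p $ 1 = q $ 1 * q $ 2 \<and> p $ 1 * p $ 2 = q $ 2 \<and> p $ 2 * q $ 1 = 1"
  by (auto simp: blowup_param1_def blowup_param2_def complex_line_eq_iff vec2_eq_iff)

lemma blowup_param1_eq: "p $ 2 \<noteq> 0 \<Longrightarrow> blowup_param1 p = blowup_param2 (vector [1 / p $ 2, p $ 1 * p $ 2])"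
  and blowup_param2_eq: "p $ 1 \<noteq> 0 \<Longrightarrow> blowup_param2 p = blowup_param1 (vector [p $ 1 * p $ 2, 1 / p $ 1])"
  by (simp add: blowup_param_eq_iff, rule sym, simp add: blowup_param_eq_iff)

lemma blowup_param_range:
  "blowup_param1 p \<in> range blowup_param2 \<longleftrightarrow> p $ 2 \<noteq> 0"
  "blowup_param2 p \<in> range blowup_param1 \<longleftrightarrow> p $ 1 \<noteq> 0"
proof -
  have "p $ 2 \<noteq> 0" if "blowup_param1 p = blowup_param2 q" for q
    using that by (auto simp: blowup_param_eq_iff)
  then show "blowup_param1 p \<in> range blowup_param2 \<longleftrightarrow> p $ 2 \<noteq> 0"
    using blowup_param1_eq[of p] by (auto simp: image_iff)
  have "p $ 1 \<noteq> 0" if "blowup_param1 q = blowup_param2 p" for q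
    using that by (auto simp: blowup_param_eq_iff)
  then show "blowup_param2 p \<in> range blowup_param1 \<longleftrightarrow> p $ 1 \<noteq> 0"
    using blowup_param2_eq[of p] by (auto simp: image_iff dest: sym)
qed

lemma points_blowup: "points blowup_plane = range blowup_param1 \<union> range blowup_param2"
  by (simp add: points_def blowup_plane_def)

lemma inv_into_blowup_param:
  "inv_into (range blowup_param1) (inv blowup_param1) p = blowup_param1 p"
  "inv_into (range blowup_param2) (inv blowup_param2) p = blowup_param2 p"
  using inj_blowup_param by (simp_all add: inv_into_f_eq inj_on_inv_into)

lemma blowup_chart_image:
  "inv blowup_param1 ` (range blowup_param1 \<inter> N) = {p. blowup_param1 p \<in> N}"
  "inv blowup_param2 ` (range blowup_param2 \<inter> N) = {p. blowup_param2 p \<in> N}"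
  using inj_blowup_param by (force simp: image_iff)+

lemma blowup_transition:
  "holomorphic_vec_on (\<lambda>p::complex^2. vector [1 / p $ 2, p $ 1 * p $ 2] :: complex^2) {p. p $ 2 \<noteq> 0}"
  "holomorphic_vec_on (\<lambda>p::complex^2. vector [p $ 1 * p $ 2, 1 / p $ 1] :: complex^2) {p. p $ 1 \<noteq> 0}"
  by (auto intro!: holomorphic_vec2I holomorphic_scalar_intros)

lemma blowup_projection:
  "holomorphic_vec_on (\<lambda>p. fst (blowup_param1 p)) S"
  "holomorphic_vec_on (\<lambda>p. fst (blowup_param2 p)) S"
  unfolding fst_blowup_param by (auto intro!: holomorphic_vec2I holomorphic_scalar_intros)

lemma holomorphic_atlas_blowup: "holomorphic_atlas blowup_plane"
proof -
  have id: "holomorphic_vec_on (\<lambda>x::complex^2. x) UNIV"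
    unfolding holomorphic_vec_on_def by (auto intro!: exI[of _ "\<lambda>x. x"])
  have "holomorphic_vec_on (\<lambda>p. inv blowup_param2 (blowup_param1 p)) {p. p $ 2 \<noteq> 0}"
    by (rule holomorphic_vec_on_cong[OF open_nth_nonzero blowup_transition(1)])
      (simp add: blowup_param1_eq inj_blowup_param)
  moreover have "holomorphic_vec_on (\<lambda>p. inv blowup_param1 (blowup_param2 p)) {p. p $ 1 \<noteq> 0}"
    by (rule holomorphic_vec_on_cong[OF open_nth_nonzero blowup_transition(2)])
      (simp add: blowup_param2_eq inj_blowup_param)
  moreover have "inv blowup_param1 ` range blowup_param1 = UNIV" "inv blowup_param2 ` range blowup_param2 = UNIV"
    using blowup_chart_image[of UNIV] by auto
  ultimately show ?thesis
    using id inj_on_inv_into[of _ blowup_param1 UNIV] inj_on_inv_into[of _ blowup_param2 UNIV]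
    by (simp add: holomorphic_atlas_def blowup_plane_def o_def inv_into_blowup_param blowup_chart_image
        blowup_param_range open_nth_nonzero inj_blowup_param)
qed

lemma holomorphic_map_fst_blowup: "holomorphic_map blowup_plane complex_plane fst"
proof -
  have hol: "holomorphic_vec_on (\<lambda>x. fst (inv_into U \<phi> x)) (\<phi> ` U)" if "(U, \<phi>) \<in> blowup_plane" for U \<phi>
    using that by (auto simp: blowup_plane_def inv_into_blowup_param blowup_projection)
  have "openin (manifold_topology blowup_plane) {x \<in> points blowup_plane. fst x \<in> W}" if "open W" for W
  proof -
    have op: "openin (manifold_topology blowup_plane) (U \<inter> \<phi> -` {p. fst (inv_into U \<phi> p) \<in> W})"
      if "(U, \<phi>) \<in> blowup_plane" for U \<phi>
    proof (rule openin_chart_vimage[OF that])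
      have "continuous_on UNIV (\<lambda>p. fst (inv_into U \<phi> p))"
        using that blowup_projection[of UNIV] holomorphic_vec_on_continuous
        by (auto simp: blowup_plane_def inv_into_blowup_param)
      then show "open {p. fst (inv_into U \<phi> p) \<in> W}"
        using \<open>open W\<close> open_vimage[of W "\<lambda>p. fst (inv_into U \<phi> p)"] by (simp add: vimage_def)
    qed
    have "openin (manifold_topology blowup_plane)
        ((range blowup_param1 \<inter> inv blowup_param1 -` {p. fst (blowup_param1 p) \<in> W}) \<union>
         (range blowup_param2 \<inter> inv blowup_param2 -` {p. fst (blowup_param2 p) \<in> W}))"
      using op[of "range blowup_param1" "inv blowup_param1"] op[of "range blowup_param2" "inv blowup_param2"]
      by (intro openin_Un) (simp_all add: blowup_plane_def inv_into_blowup_param)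
    moreover have "\<dots> = {x \<in> points blowup_plane. fst x \<in> W}"
      by (auto simp: points_blowup inj_blowup_param)
    ultimately show ?thesis by simp
  qed
  then show ?thesis
    using hol by (auto simp: holomorphic_map_def continuous_map_manifold topspace_manifold complex_plane_def points_def o_def)
qed

lemma blowup_plane_chart1: "(range blowup_param1, inv blowup_param1) \<in> blowup_plane"
  and blowup_plane_chart2: "(range blowup_param2, inv blowup_param2) \<in> blowup_plane"
  by (simp_all add: blowup_plane_def)

lemma curve_blowup_param:
  assumes "open S" "f holomorphic_on S" "g holomorphic_on S"
  shows "holomorphic_curve blowup_plane S (\<lambda>z. blowup_param1 (vector [f z, g z]))"
    and "holomorphic_curve blowup_plane S (\<lambda>z. blowup_param2 (vector [f z, g z]))"
proof -
  have hol: "(\<lambda>z. (vector [f z, g z] :: complex^2) $ i) holomorphic_on S" for i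
    using exhaust_2[of i] assms(2,3) by auto
  show "holomorphic_curve blowup_plane S (\<lambda>z. blowup_param1 (vector [f z, g z]))"
    using curve_of_chart[OF holomorphic_atlas_blowup blowup_plane_chart1 assms(1) hol]
      blowup_chart_image(1)[of UNIV] by (simp add: inv_into_blowup_param)
  show "holomorphic_curve blowup_plane S (\<lambda>z. blowup_param2 (vector [f z, g z]))"
    using curve_of_chart[OF holomorphic_atlas_blowup blowup_plane_chart2 assms(1) hol]
      blowup_chart_image(2)[of UNIV] by (simp add: inv_into_blowup_param)
qed

section \<open>Lifting curves to the blow-up of the plane\<close>

text \<open>The lifting problem in one chart of the blow-up of the plane: \<open>a\<^sub>1\<close>
  and \<open>a\<^sub>2\<close> are the chart coordinates of the given curve, so its projection is
  \<open>(a\<^sub>1, a\<^sub>1 * a\<^sub>2)\<close>. The curve to be lifted is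
  \<open>(b\<^sub>1, b\<^sub>2)\<close>, and \<open>q\<close> is the slope coordinate of its
  lift.\<close>

definition quotient_contact :: "complex \<Rightarrow> (complex \<Rightarrow> complex) \<Rightarrow> (complex \<Rightarrow> complex) \<Rightarrow> nat \<Rightarrow> nat \<Rightarrow> bool"
  where "quotient_contact z\<^sub>0 a\<^sub>1 a\<^sub>2 j k \<longleftrightarrow> (\<forall>b\<^sub>1 b\<^sub>2 R'. open R' \<longrightarrow> z\<^sub>0 \<in> R' \<longrightarrow> b\<^sub>1 holomorphic_on R' \<longrightarrow> b\<^sub>2 holomorphic_on R' \<longrightarrow>
    b\<^sub>1 z\<^sub>0 = 0 \<longrightarrow> b\<^sub>2 z\<^sub>0 = 0 \<longrightarrow>
    (\<lambda>z. b\<^sub>1 z - a\<^sub>1 z) \<in> O[at z\<^sub>0](\<lambda>z. (z - z\<^sub>0) ^ k) \<longrightarrow>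
    (\<lambda>z. b\<^sub>2 z - a\<^sub>1 z * a\<^sub>2 z) \<in> O[at z\<^sub>0](\<lambda>z. (z - z\<^sub>0) ^ k) \<longrightarrow>
    (\<exists>e>0. \<exists>q. ball z\<^sub>0 e \<subseteq> R' \<and> q holomorphic_on ball z\<^sub>0 e \<and> q z\<^sub>0 = a\<^sub>2 z\<^sub>0 \<and>
       (\<forall>z\<in>ball z\<^sub>0 e. b\<^sub>1 z * q z = b\<^sub>2 z) \<and> (\<lambda>z. q z - a\<^sub>2 z) \<in> O[at z\<^sub>0](\<lambda>z. (z - z\<^sub>0) ^ j)))"

text \<open>Contact of order greater than the vanishing order \<open>\<mu>\<close> of
  \<open>a\<^sub>1\<close> gives \<open>b\<^sub>1\<close> the same vanishing order. Then
  \<open>q - a\<^sub>2\<close> is \<open>((b\<^sub>2 - a\<^sub>1 * a\<^sub>2) - (b\<^sub>1 -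
  a\<^sub>1) * a\<^sub>2) / b\<^sub>1\<close>, a quotient whose numerator vanishes to order
  \<open>k\<close>.\<close>

lemma holomorphic_quotient_contact:
  fixes a\<^sub>1 a\<^sub>2 :: "complex \<Rightarrow> complex"
  assumes hol: "a\<^sub>1 holomorphic_on R" "a\<^sub>2 holomorphic_on R" "open R" "z\<^sub>0 \<in> R"
    and "a\<^sub>1 z\<^sub>0 = 0" and nz: "\<forall>\<^sub>F z in at z\<^sub>0. a\<^sub>1 z \<noteq> 0"
  shows "\<exists>k\<ge>j. quotient_contact z\<^sub>0 a\<^sub>1 a\<^sub>2 j k"
proof -
  obtain r where r: "r > 0" "ball z\<^sub>0 r \<subseteq> R" using hol(3,4) open_contains_ball by blast
  have nc: "\<not> a\<^sub>1 constant_on ball z\<^sub>0 r"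
  proof
    assume "a\<^sub>1 constant_on ball z\<^sub>0 r"
    then have "a\<^sub>1 z = 0" if "z \<in> ball z\<^sub>0 r" for z
      using that r(1) assms(5) by (auto simp: constant_on_def)
    then have "\<forall>\<^sub>F z in at z\<^sub>0. a\<^sub>1 z = 0"
      using r(1) by (auto simp: eventually_at dist_commute intro!: exI[of _ r])
    with nz have "\<forall>\<^sub>F z in at z\<^sub>0. False" by eventually_elim simp
    then show False by simp
  qed
  obtain g s \<mu> where g: "0 < \<mu>" "0 < s" "ball z\<^sub>0 s \<subseteq> ball z\<^sub>0 r" "g holomorphic_on ball z\<^sub>0 s"
      "\<And>w. w \<in> ball z\<^sub>0 s \<Longrightarrow> a\<^sub>1 w = (w - z\<^sub>0) ^ \<mu> * g w" "\<And>w. w \<in> ball z\<^sub>0 s \<Longrightarrow> g w \<noteq> 0"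
    using holomorphic_factor_zero_nonconstant[OF holomorphic_on_subset[OF hol(1) r(2)] open_ball connected_ball _ assms(5) nc]
      r(1) by (metis centre_in_ball)
  have near: "\<forall>\<^sub>F z in at z\<^sub>0. z \<in> ball z\<^sub>0 s"
    using g(2) by (intro eventually_at_in_open') auto
  have gt: "(g \<longlongrightarrow> g z\<^sub>0) (at z\<^sub>0)"
    using g(2) holomorphic_on_imp_continuous_on[OF g(4)] continuous_on_eq_continuous_at[of "ball z\<^sub>0 s" g]
    by (auto simp: isCont_def)
  have "(\<lambda>z. (z - z\<^sub>0) ^ \<mu>) \<in> O[at z\<^sub>0](\<lambda>z. (z - z\<^sub>0) ^ \<mu> * g z)"
  proof -
    have "(\<lambda>_. 1) \<in> O[at z\<^sub>0](g)"
      using gt g(2) g(6)[of z\<^sub>0] by (intro bigoI_tendsto[OF tendsto_divide[OF tendsto_const gt]]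
        eventually_mono[OF near] g(6)) auto
    from landau_o.big.mult_left[OF this, of "\<lambda>z. (z - z\<^sub>0) ^ \<mu>"] show ?thesis by simp
  qed
  also have "(\<lambda>z. (z - z\<^sub>0) ^ \<mu> * g z) \<in> \<Theta>[at z\<^sub>0](a\<^sub>1)"
    by (rule bigthetaI_cong, rule eventually_mono[OF near]) (simp add: g(5))
  finally have mu: "(\<lambda>z. (z - z\<^sub>0) ^ \<mu>) \<in> O[at z\<^sub>0](a\<^sub>1)" .
  have cont: "(f \<longlongrightarrow> f z\<^sub>0) (at z\<^sub>0)" if "f holomorphic_on T" "open T" "z\<^sub>0 \<in> T" for f :: "complex \<Rightarrow> complex" and T
    using holomorphic_on_imp_continuous_on[OF that(1)] that(2,3) continuous_on_eq_continuous_at[of T f]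
    by (auto simp: isCont_def)
  have pow0: "((\<lambda>z. (z - z\<^sub>0) ^ Suc n) \<longlongrightarrow> 0) (at z\<^sub>0)" for n
    by (auto intro!: tendsto_eq_intros)
  \<comment> \<open>Division by \<open>b\<^sub>1\<close> loses \<open>\<mu>\<close> orders; the
    additional one makes \<open>q\<close> tend to \<open>a\<^sub>2 z\<^sub>0\<close> even when
    \<open>j = 0\<close>.\<close>
  define k where "k = Suc j + \<mu>"
  show ?thesis
    unfolding quotient_contact_def
  proof (intro exI[of _ k] conjI allI impI)
    show "k \<ge> j" by (simp add: k_def)
    fix b\<^sub>1 b\<^sub>2 :: "complex \<Rightarrow> complex" and R'
    assume R': "open R'" "z\<^sub>0 \<in> R'" and b: "b\<^sub>1 holomorphic_on R'" "b\<^sub>2 holomorphic_on R'" "b\<^sub>1 z\<^sub>0 = 0" "b\<^sub>2 z\<^sub>0 = 0"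
      and c1: "(\<lambda>z. b\<^sub>1 z - a\<^sub>1 z) \<in> O[at z\<^sub>0](\<lambda>z. (z - z\<^sub>0) ^ k)"
      and c2: "(\<lambda>z. b\<^sub>2 z - a\<^sub>1 z * a\<^sub>2 z) \<in> O[at z\<^sub>0](\<lambda>z. (z - z\<^sub>0) ^ k)"
    have id_bigo: "(\<lambda>z. z - z\<^sub>0) \<in> O[at z\<^sub>0](\<lambda>_. 1)"
      by (rule bigoI_tendsto[of _ _ 0]) (auto intro!: tendsto_eq_intros)
    have smallj: "(\<lambda>z. (z - z\<^sub>0) ^ Suc j) \<in> o[at z\<^sub>0](\<lambda>_. 1)" by (intro smalloI_tendsto) (use pow0 in auto)
    then have "(\<lambda>z. (z - z\<^sub>0) ^ Suc j * (z - z\<^sub>0) ^ \<mu>) \<in> o[at z\<^sub>0](\<lambda>z. 1 * a\<^sub>1 z)"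
      by (rule landau_o.small_big_mult[OF _ mu])
    then have "(\<lambda>z. (z - z\<^sub>0) ^ k) \<in> o[at z\<^sub>0](a\<^sub>1)" by (simp add: k_def power_add mult_ac)
    then have small: "(\<lambda>z. b\<^sub>1 z - a\<^sub>1 z) \<in> o[at z\<^sub>0](a\<^sub>1)" by (rule landau_o.big_small_trans[OF c1])
    have "\<Theta>[at z\<^sub>0](b\<^sub>1) = \<Theta>[at z\<^sub>0](a\<^sub>1)"
      using landau_theta.plus_absorb2[OF small] by simp
    then have th: "b\<^sub>1 \<in> \<Theta>[at z\<^sub>0](a\<^sub>1)" using bigtheta_refl[of b\<^sub>1 "at z\<^sub>0"] by simp
    then have b1nz: "\<forall>\<^sub>F z in at z\<^sub>0. b\<^sub>1 z \<noteq> 0" using nz eventually_nonzero_bigtheta by blast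
    have mub: "(\<lambda>z. (z - z\<^sub>0) ^ \<mu>) \<in> O[at z\<^sub>0](b\<^sub>1)"
      using landau_o.big.cong_bigtheta[OF th] mu by simp
    obtain e' where e': "e' > 0" "\<And>z. z \<noteq> z\<^sub>0 \<Longrightarrow> dist z z\<^sub>0 < e' \<Longrightarrow> b\<^sub>1 z \<noteq> 0"
      using b1nz by (auto simp: eventually_at)
    obtain e'' where e'': "e'' > 0" "ball z\<^sub>0 e'' \<subseteq> R'" using R' open_contains_ball by blast
    define e where "e = min e' e''"
    have e: "e > 0" "ball z\<^sub>0 e \<subseteq> R'" "\<And>z. z \<in> ball z\<^sub>0 e \<Longrightarrow> z \<noteq> z\<^sub>0 \<Longrightarrow> b\<^sub>1 z \<noteq> 0"
      using e' e'' by (auto simp: e_def dist_commute)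
    \<comment> \<open>The value at \<open>z\<^sub>0\<close> is the limit of the quotient, as shown
      below, so that the singularity there is removable.\<close>
    define q where "q z = (if z = z\<^sub>0 then a\<^sub>2 z\<^sub>0 else b\<^sub>2 z / b\<^sub>1 z)" for z
    have "a\<^sub>2 \<in> O[at z\<^sub>0](\<lambda>_. 1)"
      by (rule bigoI_tendsto[of _ _ "a\<^sub>2 z\<^sub>0"]) (use cont[OF hol(2-4)] in auto)
    from landau_o.big.mult[OF c1 this]
    have "(\<lambda>z. (b\<^sub>2 z - a\<^sub>1 z * a\<^sub>2 z) - (b\<^sub>1 z - a\<^sub>1 z) * a\<^sub>2 z) \<in> O[at z\<^sub>0](\<lambda>z. (z - z\<^sub>0) ^ k)"
      by (intro sum_in_bigo(2) c2) simp
    also have "(\<lambda>z. (z - z\<^sub>0) ^ k) \<in> O[at z\<^sub>0](\<lambda>z. (z - z\<^sub>0) ^ Suc j * b\<^sub>1 z)"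
      using landau_o.big.mult_left[OF mub, of "\<lambda>z. (z - z\<^sub>0) ^ Suc j"] by (simp add: k_def power_add mult_ac)
    finally have "(\<lambda>z. ((b\<^sub>2 z - a\<^sub>1 z * a\<^sub>2 z) - (b\<^sub>1 z - a\<^sub>1 z) * a\<^sub>2 z) / b\<^sub>1 z) \<in>
        O[at z\<^sub>0](\<lambda>z. (z - z\<^sub>0) ^ Suc j * b\<^sub>1 z / b\<^sub>1 z)"
      by (intro landau_o.big.divide_right b1nz)
    also have "(\<lambda>z. (z - z\<^sub>0) ^ Suc j * b\<^sub>1 z / b\<^sub>1 z) \<in> \<Theta>[at z\<^sub>0](\<lambda>z. (z - z\<^sub>0) ^ Suc j)"
      by (rule bigthetaI_cong, rule eventually_mono[OF b1nz]) simp
    finally have "(\<lambda>z. ((b\<^sub>2 z - a\<^sub>1 z * a\<^sub>2 z) - (b\<^sub>1 z - a\<^sub>1 z) * a\<^sub>2 z) / b\<^sub>1 z) \<in> O[at z\<^sub>0](\<lambda>z. (z - z\<^sub>0) ^ Suc j)" .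
    moreover have "\<forall>\<^sub>F z in at z\<^sub>0. ((b\<^sub>2 z - a\<^sub>1 z * a\<^sub>2 z) - (b\<^sub>1 z - a\<^sub>1 z) * a\<^sub>2 z) / b\<^sub>1 z = q z - a\<^sub>2 z"
      using b1nz eventually_neq_at_within[of z\<^sub>0 z\<^sub>0 UNIV]
      by eventually_elim (simp add: q_def field_simps)
    ultimately have qO: "(\<lambda>z. q z - a\<^sub>2 z) \<in> O[at z\<^sub>0](\<lambda>z. (z - z\<^sub>0) ^ Suc j)"
      using landau_o.big.in_cong by force
    have "(\<lambda>z. q z - a\<^sub>2 z) \<in> o[at z\<^sub>0](\<lambda>_. 1)"
      by (rule landau_o.big_small_trans[OF qO smallj])
    from tendsto_add[OF smalloD_tendsto[OF this] cont[OF hol(2-4)]]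
    have qt: "(q \<longlongrightarrow> q z\<^sub>0) (at z\<^sub>0)" by (simp add: q_def[of z\<^sub>0])
    have "(\<lambda>z. b\<^sub>2 z / b\<^sub>1 z) holomorphic_on ball z\<^sub>0 e - {z\<^sub>0}"
      using e b by (intro holomorphic_intros) (auto intro: holomorphic_on_subset)
    then have "q holomorphic_on ball z\<^sub>0 e - {z\<^sub>0}"
      by (rule holomorphic_transform) (simp add: q_def)
    then have "q holomorphic_on ball z\<^sub>0 e"
    proof (rule no_isolated_singularity'[of "{z\<^sub>0}" q "ball z\<^sub>0 e", rotated])
      show "(q \<longlongrightarrow> q z) (at z within ball z\<^sub>0 e)" if "z \<in> {z\<^sub>0}" for z
        using that tendsto_within_subset[OF qt] by simp
    qed simp_all
    moreover have "\<forall>z\<in>ball z\<^sub>0 e. b\<^sub>1 z * q z = b\<^sub>2 z"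
      using e(3) b(3,4) by (auto simp: q_def)
    moreover have "(\<lambda>z. (z - z\<^sub>0) ^ Suc j) \<in> O[at z\<^sub>0](\<lambda>z. (z - z\<^sub>0) ^ j)"
      using landau_o.big.mult_right[OF id_bigo, of "\<lambda>z. (z - z\<^sub>0) ^ j"] by simp
    then have "(\<lambda>z. q z - a\<^sub>2 z) \<in> O[at z\<^sub>0](\<lambda>z. (z - z\<^sub>0) ^ j)"
      by (rule landau_o.big_trans[OF qO])
    ultimately    show "\<exists>e>0. \<exists>q. ball z\<^sub>0 e \<subseteq> R' \<and> q holomorphic_on ball z\<^sub>0 e \<and> q z\<^sub>0 = a\<^sub>2 z\<^sub>0 \<and>
       (\<forall>z\<in>ball z\<^sub>0 e. b\<^sub>1 z * q z = b\<^sub>2 z) \<and> (\<lambda>z. q z - a\<^sub>2 z) \<in> O[at z\<^sub>0](\<lambda>z. (z - z\<^sub>0) ^ j)"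
      using e(1,2) by (intro exI[of _ e] exI[of _ q] conjI) (simp_all add: q_def[of z\<^sub>0])
  qed
qed

text \<open>Treats both charts at once: \<open>i\<close> is the index of the coordinate that
  vanishes on the exceptional curve, \<open>i'\<close> that of the slope.\<close>

lemma blowup_chart_lift:
  fixes P :: "complex ^ 2 \<Rightarrow> (complex ^ 2) \<times> (complex ^ 2) set" and i i' :: 2
  assumes P: "(range P, inv P) \<in> blowup_plane" "inj P" "\<And>c. inv_into (range P) (inv P) c = P c"
    and i: "i \<noteq> i'" "\<And>m. m = i \<or> m = i'" "\<And>v. fst (P v) $ i = v $ i" "\<And>v. fst (P v) $ i' = v $ i * v $ i'"
    and \<alpha>: "holomorphic_curve blowup_plane R \<alpha>" "open R" "z\<^sub>0 \<in> R" "fst (\<alpha> z\<^sub>0) = 0"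
    and nz: "\<forall>\<^sub>F z in at z\<^sub>0. fst (\<alpha> z) \<noteq> 0" and z0: "\<alpha> z\<^sub>0 \<in> range P"
  shows "\<exists>k. contact_lift blowup_plane fst complex_plane \<alpha> z\<^sub>0 j k"
proof -
  have all: "(\<forall>m. Q m) \<longleftrightarrow> Q i \<and> Q i'" for Q using i(2) by metis
  define R1 where "R1 = {z \<in> R. \<alpha> z \<in> range P}"
  have R1: "open R1" "z\<^sub>0 \<in> R1"
    unfolding R1_def using curve_open[OF \<alpha>(1,2) openin_chart[OF P(1)]] \<alpha>(3) z0 by auto
  have near: "\<forall>\<^sub>F z in at z\<^sub>0. z \<in> R1" using R1 by (rule eventually_at_in_open')
  define a where "a z = inv P (\<alpha> z)" for z
  have a: "\<alpha> z = P (a z)" if "z \<in> R1" for z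
    using that by (auto simp: R1_def a_def f_inv_into_f)
  have hol: "(\<lambda>z. a z $ m) holomorphic_on R1" for m
    unfolding a_def R1_def by (rule curve_chart[OF \<alpha>(1) P(1)])
  have fst: "fst (\<alpha> z) $ i = a z $ i" "fst (\<alpha> z) $ i' = a z $ i * a z $ i'" if "z \<in> R1" for z
    using a[OF that] i(3,4) by auto
  have a0: "a z\<^sub>0 $ i = 0" using fst(1)[OF R1(2)] \<alpha>(4) by simp
  have anz: "\<forall>\<^sub>F z in at z\<^sub>0. a z $ i \<noteq> 0"
    using nz near by eventually_elim (auto simp: fst vec_eq_iff all)
  obtain k where k: "k \<ge> j" "quotient_contact z\<^sub>0 (\<lambda>z. a z $ i) (\<lambda>z. a z $ i') j k"
    using holomorphic_quotient_contact[OF hol hol R1 a0 anz, of j] by blast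
  define F where "F z = (\<chi> m. if m = i then a z $ i else a z $ i * a z $ i')" for z
  have F: "\<forall>\<^sub>F z in at z\<^sub>0. fst (\<alpha> z) = F z"
    by (rule eventually_mono[OF near]) (use i(1) in \<open>simp add: F_def vec_eq_iff all fst\<close>)
  show ?thesis
    unfolding contact_lift_def
  proof (intro exI[of _ k] allI impI)
    fix \<beta> R' assume R': "open R'" "z\<^sub>0 \<in> R'" and \<beta>: "holomorphic_curve complex_plane R' \<beta>"
      and "curves_contact complex_plane z\<^sub>0 k (\<lambda>z. fst (\<alpha> z)) \<beta>"
    then have \<beta>0: "\<beta> z\<^sub>0 = 0" and c0: "vec_contact z\<^sub>0 k (\<lambda>z. fst (\<alpha> z)) \<beta>"
      using \<alpha>(4) by (auto simp: curves_contact_plane)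
    have c: "vec_contact z\<^sub>0 k F \<beta>" by (rule vec_contact_cong[OF c0 F]) simp
    have ci: "(\<lambda>z. \<beta> z $ i - a z $ i) \<in> O[at z\<^sub>0](\<lambda>z. (z - z\<^sub>0) ^ k)"
        "(\<lambda>z. \<beta> z $ i' - a z $ i * a z $ i') \<in> O[at z\<^sub>0](\<lambda>z. (z - z\<^sub>0) ^ k)"
      using c i(1) by (simp_all add: vec_contact_iff all F_def)
    have bh: "(\<lambda>z. \<beta> z $ m) holomorphic_on R'" for m using \<beta> curve_plane[OF R'(1)] by auto
    have b0: "\<beta> z\<^sub>0 $ m = 0" for m using \<beta>0 by simp
    obtain e q where e: "e > 0" "ball z\<^sub>0 e \<subseteq> R'" "q holomorphic_on ball z\<^sub>0 e" "q z\<^sub>0 = a z\<^sub>0 $ i'"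
        "\<And>z. z \<in> ball z\<^sub>0 e \<Longrightarrow> \<beta> z $ i * q z = \<beta> z $ i'"
        "(\<lambda>z. q z - a z $ i') \<in> O[at z\<^sub>0](\<lambda>z. (z - z\<^sub>0) ^ j)"
      using k(2)[unfolded quotient_contact_def, rule_format, OF R' bh bh b0 b0 ci] by blast
    define c where "c z = (\<chi> m. if m = i then \<beta> z $ i else q z)" for z
    have ci: "c z $ i = \<beta> z $ i" "c z $ i' = q z" for z using i(1) by (auto simp: c_def)
    have "\<forall>m. (\<lambda>z. c z $ m) holomorphic_on ball z\<^sub>0 e"
      unfolding all ci using e(2,3) bh by (auto intro: holomorphic_on_subset)
    then have "holomorphic_curve blowup_plane (ball z\<^sub>0 e) (\<lambda>z. P (c z))"
      using curve_of_chart[OF holomorphic_atlas_blowup P(1) open_ball, of c z\<^sub>0 e] P(2)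
      by (simp add: P(3) image_comp o_def)
    moreover have "fst (P (c z)) = \<beta> z" if "z \<in> ball z\<^sub>0 e" for z
      using e(5)[OF that] by (simp add: vec_eq_iff all i(3,4) ci)
    moreover have "\<alpha> z\<^sub>0 = P (c z\<^sub>0)"
    proof -
      have "a z\<^sub>0 = c z\<^sub>0" by (simp add: vec_eq_iff all ci a0 \<beta>0 e(4))
      then show ?thesis using a[OF R1(2)] by simp
    qed
    \<comment> \<open>The slope \<open>q\<close> has contact of order \<open>j\<close> by
      construction. The other coordinate is that of \<open>\<beta>\<close> itself, with contact of
      order \<open>k\<close>, which is why \<open>k \<ge> j\<close> was recorded.\<close>
    moreover have "vec_contact z\<^sub>0 j a c"
      using vec_contact_mono[OF \<open>vec_contact z\<^sub>0 k F \<beta>\<close> k(1)] e(6) i(1) by (simp add: vec_contact_iff all ci F_def)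
    then have "vec_contact z\<^sub>0 j (\<lambda>z. inv P (\<alpha> z)) (\<lambda>z. inv P (P (c z)))"
      by (simp add: a_def[abs_def] P(2))
    ultimately show "\<exists>e>0. \<exists>\<gamma>. ball z\<^sub>0 e \<subseteq> R' \<and> holomorphic_curve blowup_plane (ball z\<^sub>0 e) \<gamma> \<and>
       (\<forall>z\<in>ball z\<^sub>0 e. fst (\<gamma> z) = \<beta> z) \<and> curves_contact blowup_plane z\<^sub>0 j \<alpha> \<gamma>"
      using e(1,2) P(1) z0 unfolding curves_contact_def
      by (intro exI[of _ e] exI[of _ "\<lambda>z. P (c z)"] conjI bexI[of _ "(range P, inv P)"]) auto
  qed
qed

lemma blowup_plane_lift:
  assumes \<alpha>: "holomorphic_curve blowup_plane R \<alpha>" "open R" "z\<^sub>0 \<in> R" "fst (\<alpha> z\<^sub>0) = 0"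
    and nz: "\<forall>\<^sub>F z in at z\<^sub>0. fst (\<alpha> z) \<noteq> 0"
  shows "\<exists>k. contact_lift blowup_plane fst complex_plane \<alpha> z\<^sub>0 j k"
proof -
  consider "\<alpha> z\<^sub>0 \<in> range blowup_param1" | "\<alpha> z\<^sub>0 \<in> range blowup_param2"
    using curve_points[OF \<alpha>(1,3)] by (auto simp: points_blowup)
  then show ?thesis
  proof cases
    case 1
    then show ?thesis
      using exhaust_2
      by (intro blowup_chart_lift[OF blowup_plane_chart1 inj_blowup_param(1) _ _ _ _ _ \<alpha> nz, where i = 1 and i' = 2])
        (auto simp: inv_into_blowup_param fst_blowup_param)
  next
    case 2
    then show ?thesis
      using exhaust_2
      by (intro blowup_chart_lift[OF blowup_plane_chart2 inj_blowup_param(2) _ _ _ _ _ \<alpha> nz, where i = 2 and i' = 1])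
        (auto simp: inv_into_blowup_param fst_blowup_param mult.commute)
  qed
qed

section \<open>Blow-ups of surfaces\<close>

text \<open>The data of \<open>is_blowup\<close> with its witnesses named and each biholomorphic map
  split into two mutually inverse holomorphic maps: \<open>\<rho>\<close> inverts
  \<open>\<pi>\<close> off \<open>p\<close>, while \<open>\<zeta>'\<close> and
  \<open>\<Psi>'\<close> invert the coordinates below and above. The inverse laws hold on the
  respective domains only.\<close>

locale surface_blowup =
  fixes X' :: "('b, 2) atlas" and \<pi> :: "'b \<Rightarrow> 'a" and X :: "('a, 2) atlas" and p :: 'a
    and \<rho> :: "'a \<Rightarrow> 'b" and U :: "'a set" and D :: "(complex ^ 2) set"
    and \<zeta> :: "'a \<Rightarrow> complex ^ 2" and \<zeta>' :: "complex ^ 2 \<Rightarrow> 'a"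
    and \<Psi> :: "'b \<Rightarrow> (complex ^ 2) \<times> (complex ^ 2) set" and \<Psi>' :: "(complex ^ 2) \<times> (complex ^ 2) set \<Rightarrow> 'b"
  assumes atlas: "holomorphic_atlas X" "holomorphic_atlas X'" and Hausdorff: "Hausdorff_space (manifold_topology X)"
    and p: "p \<in> points X"
    and \<pi>: "holomorphic_map X' X \<pi>"
    and \<rho>: "holomorphic_map (open_submanifold X (- {p})) X' \<rho>"
      "\<And>x. x \<in> points X \<Longrightarrow> x \<noteq> p \<Longrightarrow> \<pi> (\<rho> x) = x"
      "\<And>y. y \<in> points X' \<Longrightarrow> \<pi> y \<noteq> p \<Longrightarrow> \<rho> (\<pi> y) = y"
    and U: "openin (manifold_topology X) U" "p \<in> U" and D: "open D"
    and \<zeta>: "holomorphic_map (open_submanifold X U) complex_plane \<zeta>" "\<zeta> p = 0"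
      "\<And>x. x \<in> U \<Longrightarrow> \<zeta> x \<in> D" "\<And>x. x \<in> U \<Longrightarrow> \<zeta>' (\<zeta> x) = x"
    and \<zeta>': "holomorphic_map (open_submanifold complex_plane D) X \<zeta>'"
      "\<And>v. v \<in> D \<Longrightarrow> \<zeta>' v \<in> U" "\<And>v. v \<in> D \<Longrightarrow> \<zeta> (\<zeta>' v) = v"
    and \<Psi>: "holomorphic_map (open_submanifold X' {y. \<pi> y \<in> U}) blowup_plane \<Psi>"
      "\<And>y. y \<in> points X' \<Longrightarrow> \<pi> y \<in> U \<Longrightarrow> fst (\<Psi> y) = \<zeta> (\<pi> y)"
      "\<And>y. y \<in> points X' \<Longrightarrow> \<pi> y \<in> U \<Longrightarrow> \<Psi>' (\<Psi> y) = y"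
    and \<Psi>': "holomorphic_map (open_submanifold blowup_plane {(x, l). x \<in> D}) X' \<Psi>'"
      "\<And>w. w \<in> points blowup_plane \<Longrightarrow> fst w \<in> D \<Longrightarrow> \<pi> (\<Psi>' w) \<in> U"
      "\<And>w. w \<in> points blowup_plane \<Longrightarrow> fst w \<in> D \<Longrightarrow> \<Psi> (\<Psi>' w) = w"

lemma biholomorphic_map_inverse:
  assumes "biholomorphic_map (open_submanifold A S) (open_submanifold B T) f"
    and "g = inv_into (points A \<inter> S) f"
  shows "holomorphic_map (open_submanifold A S) B f" "holomorphic_map (open_submanifold B T) A g"
    "\<And>x. x \<in> points A \<Longrightarrow> x \<in> S \<Longrightarrow> f x \<in> points B \<and> f x \<in> T \<and> g (f x) = x"
    "\<And>y. y \<in> points B \<Longrightarrow> y \<in> T \<Longrightarrow> g y \<in> points A \<and> g y \<in> S \<and> f (g y) = y"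
proof -
  have bij: "bij_betw f (points A \<inter> S) (points B \<inter> T)"
    and hol: "holomorphic_map (open_submanifold A S) (open_submanifold B T) f"
      "holomorphic_map (open_submanifold B T) (open_submanifold A S) g"
    using assms by (auto simp: biholomorphic_map_def)
  show "holomorphic_map (open_submanifold A S) B f" "holomorphic_map (open_submanifold B T) A g"
    using hol by (auto simp: holomorphic_map_open_submanifold)
  show "f x \<in> points B \<and> f x \<in> T \<and> g (f x) = x" if "x \<in> points A" "x \<in> S" for x
    using bij that by (auto simp: assms(2) bij_betw_def)
  show "g y \<in> points A \<and> g y \<in> S \<and> f (g y) = y" if "y \<in> points B" "y \<in> T" for y
  proof -
    have "y \<in> f ` (points A \<inter> S)" using bij that by (auto simp: bij_betw_def)
    from inv_into_into[OF this] f_inv_into_f[OF this] show ?thesis by (simp add: assms(2))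
  qed
qed

lemma is_blowup_surface_blowup:
  assumes "is_blowup X' \<pi> X p"
  shows "\<exists>\<rho> U D \<zeta> \<zeta>' \<Psi> \<Psi>'. surface_blowup X' \<pi> X p \<rho> U D \<zeta> \<zeta>' \<Psi> \<Psi>'"
proof -
  obtain U D \<zeta> \<Psi> where man: "complex_manifold X" "complex_manifold X'" "p \<in> points X" "holomorphic_map X' X \<pi>"
    and b1: "biholomorphic_map (open_submanifold X' {y. \<pi> y \<noteq> p}) (open_submanifold X (- {p})) \<pi>"
    and U: "openin (manifold_topology X) U" "p \<in> U" "open D"
    and b2: "biholomorphic_map (open_submanifold X U) (open_submanifold complex_plane D) \<zeta>" "\<zeta> p = 0"
    and b3: "biholomorphic_map (open_submanifold X' {y. \<pi> y \<in> U})
         (open_submanifold blowup_plane {(x, l). x \<in> D}) \<Psi>"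
       "\<forall>y\<in>points X'. \<pi> y \<in> U \<longrightarrow> fst (\<Psi> y) = \<zeta> (\<pi> y)"
    using assms unfolding is_blowup_def by blast
  have UX: "x \<in> points X" if "x \<in> U" for x
    using openin_subset[OF U(1)] that by (auto simp: topspace_manifold)
  note c1 = biholomorphic_map_inverse[OF b1 refl]
  note c2 = biholomorphic_map_inverse[OF b2(1) refl]
  note c3 = biholomorphic_map_inverse[OF b3(1) refl]
  show ?thesis
  proof (intro exI)
    show "surface_blowup X' \<pi> X p (inv_into (points X' \<inter> {y. \<pi> y \<noteq> p}) \<pi>) U D
      \<zeta> (inv_into (points X \<inter> U) \<zeta>) \<Psi> (inv_into (points X' \<inter> {y. \<pi> y \<in> U}) \<Psi>)"
    proof unfold_locales
      show "holomorphic_atlas X" "holomorphic_atlas X'" using man by (simp_all add: complex_manifold_atlas)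
      show "Hausdorff_space (manifold_topology X)" using man by (simp add: complex_manifold_def)
    qed (use man U b2(2) b3(2) c1 c2 c3 UX in \<open>auto simp: split_beta\<close>)
  qed
qed

section \<open>Zeros of a holomorphic function on the lines through a point\<close>

lemma scalar_derivative_bound:
  fixes t :: "complex ^ 'n \<Rightarrow> complex"
  assumes "(t has_derivative l) (at 0)" "t 0 = 0" "\<epsilon> > 0"
  shows "\<exists>d>0. \<forall>v. norm v < d \<longrightarrow> norm (t v - l v) \<le> \<epsilon> * norm v"
  using assms(1) assms(2,3) unfolding has_derivative_at_alt by auto

text \<open>Directions not tangent to the zero set carry no zeros near the point: for
  \<open>v\<close> near \<open>e\<close> the linear part \<open>x * l v\<close> has norm at least
  \<open>norm x * norm (l e) / 2\<close>, while the constant \<open>4 * K\<close> keeps the error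
  below half of that.\<close>

lemma no_zeros_near_line:
  fixes t :: "complex ^ 'n \<Rightarrow> complex"
  assumes t: "(t has_derivative l) (at 0)" "t 0 = 0" and l: "\<And>c v. l (c *s v) = c * l v" "l e \<noteq> 0"
  shows "\<exists>\<delta>>0. \<forall>x v. x \<noteq> 0 \<longrightarrow> norm x < \<delta> \<longrightarrow> norm (v - e) < \<delta> \<longrightarrow> t (x *s v) \<noteq> 0"
proof -
  have bl: "bounded_linear l" using t(1) by (rule has_derivative_bounded_linear)
  have "isCont l e" using bounded_linear.isCont[OF bl continuous_ident] .
  then obtain \<delta>1 where \<delta>1: "\<delta>1 > 0" "\<And>v. dist v e < \<delta>1 \<Longrightarrow> dist (l v) (l e) < norm (l e) / 2"
    using l(2) unfolding continuous_at_eps_delta by (metis half_gt_zero zero_less_norm_iff)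
  define K where "K = norm e + 1"
  have K: "K > 0" by (simp add: K_def add_nonneg_pos)
  obtain d where d: "d > 0" "\<And>v. norm v < d \<Longrightarrow> norm (t v - l v) \<le> norm (l e) / (4 * K) * norm v"
    using scalar_derivative_bound[OF t, of "norm (l e) / (4 * K)"] K l(2) by auto
  define \<delta> where "\<delta> = min (min \<delta>1 1) (d / K)"
  have "t (x *s v) \<noteq> 0" if x: "x \<noteq> 0" "norm x < \<delta>" and v: "norm (v - e) < \<delta>" for x v
  proof
    assume 0: "t (x *s v) = 0"
    have nv: "norm v \<le> K"
      using norm_triangle_ineq[of "v - e" e] v by (simp add: K_def \<delta>_def)
    have "norm (x *s v) < d"
    proof -
      have "norm (x *s v) \<le> norm x * K" unfolding norm_smult_vec by (intro mult_left_mono nv) auto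
      also have "\<dots> < d" using x K by (simp add: \<delta>_def field_simps)
      finally show ?thesis .
    qed
    from d(2)[OF this] have "norm x * norm (l v) \<le> norm (l e) / (4 * K) * (norm x * norm v)"
      by (simp add: 0 l(1) norm_mult norm_smult_vec)
    then have "norm (l v) \<le> norm (l e) / (4 * K) * norm v" 
    proof -
      have "norm x * norm (l v) \<le> norm x * (norm (l e) / (4 * K) * norm v)" using \<open>norm x * norm (l v) \<le> _\<close> by (simp add: mult_ac)
      then show ?thesis by (rule mult_left_le_imp_le) (use x(1) in simp)
    qed
    also have "\<dots> \<le> norm (l e) / (4 * K) * K" using nv K by (intro mult_left_mono) auto
    also have "\<dots> = norm (l e) / 4" using K by simp
    finally have "norm (l v) \<le> norm (l e) / 4" .
    moreover have "norm (l e) - norm (l v) \<le> norm (l v - l e)"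
      using norm_triangle_ineq2[of "l e" "l v"] by (simp add: norm_minus_commute)
    moreover have "norm (l v - l e) < norm (l e) / 2"
      using \<delta>1(2)[of v] v by (simp add: \<delta>_def dist_norm)
    moreover have "norm (l e) > 0" using l(2) by simp
    ultimately show False by linarith
  qed
  moreover have "\<delta> > 0" using \<delta>1 d K by (simp add: \<delta>_def)
  ultimately show ?thesis by blast
qed

text \<open>If there were no zero, the maximum modulus principle applied to the reciprocal on small discs of
  lines would be violated: the function is nearly \<open>w \<mapsto> x * w * l f\<close> there.\<close>

lemma zeros_near_tangent_line:
  fixes t :: "complex ^ 'n \<Rightarrow> complex"
  assumes t: "(t has_derivative l) (at 0)" "t 0 = 0" and l: "\<And>c v. l (c *s v) = c * l v" "l e = 0" "l f \<noteq> 0"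
    and D: "open D" "0 \<in> D" "holomorphic_scalar_on t D" and \<delta>: "\<delta> > 0"
  shows "\<exists>x w. x \<noteq> 0 \<and> norm x < \<delta> \<and> norm w < \<delta> \<and> x *s (e + w *s f) \<in> D \<and> t (x *s (e + w *s f)) = 0"
proof -
  define r where "r = min (\<delta> / 2) 1"
  have r: "r > 0" "r < \<delta>" "r \<le> 1" using \<delta> by (auto simp: r_def)
  define K where "K = norm e + norm f + 1"
  have K: "K > 0" by (simp add: K_def add_nonneg_pos)
  define c where "c = norm (l f)"
  have c: "c > 0" using l(3) by (simp add: c_def)
  \<comment> \<open>The accuracy is chosen such that \<open>F w\<close> below differs from
    \<open>x * w * l f\<close> by at most a quarter of \<open>norm x * c * r\<close>. Hence
    \<open>F\<close> has norm at least three quarters of this amount on the circle of radius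
    \<open>r\<close> and at most one quarter at the centre.\<close>
  obtain d where d: "d > 0" "\<And>v. norm v < d \<Longrightarrow> norm (t v - l v) \<le> c * r / (4 * K) * norm v"
    using scalar_derivative_bound[OF t, of "c * r / (4 * K)"] K c r by auto
  obtain d' where d': "d' > 0" "ball 0 d' \<subseteq> D" using D open_contains_ball by blast
  define x where "x = complex_of_real (min (min d d' / K) \<delta> / 2)"
  have pos: "min (min d d' / K) \<delta> > 0" using d(1) d'(1) K \<delta> by simp
  then have "norm x = min (min d d' / K) \<delta> / 2" unfolding x_def norm_of_real by simp
  then have x: "norm x > 0" "norm x < min d d' / K" "norm x < \<delta>" using pos by auto
  have vn: "norm (e + w *s f) \<le> K" if "norm w \<le> 1" for w
  proof -
    have "norm (e + w *s f) \<le> norm e + norm w * norm f"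
      using norm_triangle_ineq[of e "w *s f"] by (simp add: norm_smult_vec)
    also have "norm w * norm f \<le> 1 * norm f" using that by (intro mult_right_mono) auto
    finally show ?thesis by (simp add: K_def)
  qed
  have xv: "norm (x *s (e + w *s f)) < min d d'" if "norm w \<le> 1" for w
  proof -
    have "norm (x *s (e + w *s f)) \<le> norm x * K" unfolding norm_smult_vec
      by (intro mult_left_mono vn that) auto
    also have "\<dots> < min d d'" using x(2) K by (simp add: field_simps)
    finally show ?thesis .
  qed
  define F where "F w = t (x *s (e + w *s f))" for w
  have ladd: "l (e + w *s f) = w * l f" for w
    using linear_add[OF has_derivative_linear[OF t(1)]] l by simp
  have approx: "norm (F w - x * w * l f) \<le> norm x * (c * r / 4)" if "norm w \<le> 1" for w
  proof -
    have "norm (F w - x * w * l f) \<le> c * r / (4 * K) * norm (x *s (e + w *s f))"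
    proof -
      have "l (x *s (e + w *s f)) = x * w * l f" by (simp only: l(1) ladd mult.assoc)
      with d(2)[of "x *s (e + w *s f)"] xv[OF that] show ?thesis by (simp add: F_def)
    qed
    also have "\<dots> \<le> c * r / (4 * K) * (norm x * K)"
      unfolding norm_smult_vec using c r K by (intro mult_left_mono vn that) auto
    also have "\<dots> = norm x * (c * r / 4)" using K by simp
    finally show ?thesis .
  qed
  have inD: "x *s (e + w *s f) \<in> D" if "norm w \<le> 1" for w using xv[OF that] d'(2) by auto
  have "\<exists>w. norm w \<le> r \<and> F w = 0"
  proof (rule ccontr)
    assume "\<not> ?thesis"
    then have nz: "F w \<noteq> 0" if "w \<in> cball 0 r" for w using that by auto
    define T where "T = {w. x *s (e + w *s f) \<in> D}"
    have "open T"
    proof -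
      have "continuous_on UNIV (\<lambda>w. x *s (e + w *s f))"
        unfolding continuous_on_vec_iff by (auto intro!: continuous_intros)
      from open_vimage[OF D(1) this] show ?thesis by (simp add: T_def vimage_def)
    qed
    have "F holomorphic_on T"
    proof (rule holomorphic_onI)
      fix w assume w: "w \<in> T"
      obtain L where L: "(t has_derivative L) (at (x *s (e + w *s f)))" "\<forall>c v. L (c *s v) = c * L v"
        using D(3) w unfolding holomorphic_scalar_on_def T_def by blast
      have "((\<lambda>w. x *s (e + w *s f)) has_derivative (\<lambda>h. h *s (x *s f))) (at w)"
        unfolding has_derivative_vec_curve by (auto intro!: derivative_eq_intros)
      from diff_chain_at[OF this L(1)] have "(F has_derivative (\<lambda>h. L (x *s f) * h)) (at w)"
        using L(2) by (simp add: o_def F_def[abs_def] mult_ac)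
      then have "(F has_field_derivative L (x *s f)) (at w)" by (simp add: has_field_derivative_def)
      then show "F field_differentiable at w within T"
        using field_differentiable_at_within field_differentiable_def by blast
    qed
    moreover have "cball 0 r \<subseteq> T" using inD r(3) by (auto simp: T_def)
    ultimately have hF: "F holomorphic_on cball 0 r" by (rule holomorphic_on_subset)
    have bd: "norm (1 / F w) \<le> 1 / (norm x * (c * r * (3 / 4)))" if "w \<in> frontier (cball 0 r)" for w
    proof -
      have w: "norm w = r" using that r(1) by (simp add: frontier_cball)
      have "norm (x * w * l f) = norm x * (c * r)" using w by (simp add: norm_mult c_def)
      moreover have "norm (x * w * l f) - norm (F w) \<le> norm (F w - x * w * l f)"
        using norm_triangle_ineq2[of "x * w * l f" "F w"] by (simp only: norm_minus_commute)
      moreover have "norm x * (c * r / 4) = norm x * (c * r) / 4" "norm x * (c * r * (3 / 4)) = norm x * (c * r) * (3 / 4)"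
        by simp_all
      ultimately have ge: "norm (F w) \<ge> norm x * (c * r * (3 / 4))" using approx[of w] w r(3) by linarith
      moreover have "norm x * (c * r * (3 / 4)) > 0" using x(1) c r(1) by simp
      ultimately show ?thesis unfolding norm_divide norm_one by (intro frac_le) auto
    qed
    have "norm (1 / F 0) \<le> 1 / (norm x * (c * r * (3 / 4)))"
    proof (rule maximum_modulus_frontier[of "\<lambda>w. 1 / F w" "cball 0 r"])
      show "(\<lambda>w. 1 / F w) holomorphic_on interior (cball 0 r)"
        using hF nz interior_subset by (intro holomorphic_intros) (auto intro: holomorphic_on_subset)
      show "continuous_on (closure (cball 0 r)) (\<lambda>w. 1 / F w)"
        using hF nz by (auto intro!: holomorphic_on_imp_continuous_on holomorphic_intros)
    qed (use bd r in auto)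
    moreover have "norm (F 0) \<le> norm x * (c * r / 4)" using approx[of 0] by simp
    then have "1 / (norm x * (c * r / 4)) \<le> norm (1 / F 0)"
      using nz[of 0] r(1) unfolding norm_divide norm_one by (intro frac_le) auto
    ultimately have "1 / (norm x * (c * r / 4)) \<le> 1 / (norm x * (c * r * (3 / 4)))" by linarith
    then show False using x(1) c r(1) by (simp add: field_simps)
  qed
  then obtain w where w: "norm w \<le> r" "F w = 0" by blast
  then show ?thesis using x r inD[of w] by (intro exI[of _ x] exI[of _ w]) (auto simp: F_def)
qed

section \<open>Lifting curves to the blow-up of a surface\<close>

context surface_blowup
begin

lemma U_points: "x \<in> U \<Longrightarrow> x \<in> points X"
  using openin_subset[OF U(1)] by (auto simp: topspace_manifold)

lemma openin_U: "openin (manifold_topology X) (points X \<inter> U)"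
  using U(1) U_points by (metis Int_absorb1 subsetI)

lemma openin_over_U: "openin (manifold_topology X') (points X' \<inter> {y. \<pi> y \<in> U})"
  using openin_holomorphic_map_preimage[OF \<pi> U(1)] by (simp add: Int_def)

lemma openin_over_D: "openin (manifold_topology blowup_plane) (points blowup_plane \<inter> {(x, l). x \<in> D})"
  using openin_holomorphic_map_preimage[OF holomorphic_map_fst_blowup, of D] D by (simp add: Int_def case_prod_beta)

lemma over_D_eq: "{(x, l). x \<in> D} = {w. fst w \<in> D}"
  by auto

lemma zero_D: "0 \<in> D" using \<zeta>(2,3) U(2) by metis

lemma \<zeta>'_zero: "\<zeta>' 0 = p" using \<zeta>(2,4) U(2) by metis

lemma \<zeta>_nonzero: "x \<in> U \<Longrightarrow> x \<noteq> p \<Longrightarrow> \<zeta> x \<noteq> 0"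
  using \<zeta>(4) \<zeta>'_zero by metis

lemma \<Psi>'_points: "w \<in> points blowup_plane \<Longrightarrow> fst w \<in> D \<Longrightarrow> \<Psi>' w \<in> points X'"
  using holomorphic_map_points[OF \<Psi>'(1)] by (simp add: over_D_eq)

lemma \<Psi>_points: "y \<in> points X' \<Longrightarrow> \<pi> y \<in> U \<Longrightarrow> \<Psi> y \<in> points blowup_plane"
  using holomorphic_map_points[OF \<Psi>(1)] by simp

lemma \<pi>_\<Psi>':
  assumes "w \<in> points blowup_plane" "fst w \<in> D"
  shows "\<pi> (\<Psi>' w) = \<zeta>' (fst w)"
  using \<Psi>'(2,3)[OF assms] \<Psi>(2)[OF \<Psi>'_points[OF assms] \<Psi>'(2)[OF assms]] \<zeta>(4) by metis

lemma curve_\<Psi>':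
  assumes "holomorphic_curve blowup_plane S c" "open S" "\<And>z. z \<in> S \<Longrightarrow> fst (c z) \<in> D"
  shows "holomorphic_curve X' S (\<lambda>z. \<Psi>' (c z))"
proof (rule curve_holomorphic_map[OF _ assms(2) _ \<Psi>'(1)])
  show "holomorphic_curve (open_submanifold blowup_plane {(x, l). x \<in> D}) S c"
    using assms(1,3) by (simp add: curve_open_submanifold over_D_eq image_subset_iff)
  show "holomorphic_atlas (open_submanifold blowup_plane {(x, l). x \<in> D})"
    by (rule holomorphic_atlas_open_submanifold[OF holomorphic_atlas_blowup openin_over_D])
qed

text \<open>The coordinates \<open>\<zeta>\<close> below and \<open>\<Psi>\<close> above reduce the
  claim to \<open>blowup_plane_lift\<close>. Holomorphic maps do not lower orders of contact, so
  \<open>j\<close> and \<open>k\<close> carry over unchanged.\<close>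

lemma lift_curve:
  assumes \<alpha>: "holomorphic_curve X' R \<alpha>" "open R" "z\<^sub>0 \<in> R" "\<pi> (\<alpha> z\<^sub>0) = p"
    and nz: "\<forall>\<^sub>F z in at z\<^sub>0. \<pi> (\<alpha> z) \<noteq> p"
  shows "\<exists>k. contact_lift X' \<pi> X \<alpha> z\<^sub>0 j k"
proof -
  define R1 where "R1 = {z \<in> R. \<alpha> z \<in> points X' \<inter> {y. \<pi> y \<in> U}}"
  have R1: "open R1" "z\<^sub>0 \<in> R1"
    unfolding R1_def using curve_open[OF \<alpha>(1,2) openin_over_U] \<alpha>(3,4) U(2) curve_points[OF \<alpha>(1,3)] by auto
  have near: "\<forall>\<^sub>F z in nhds z\<^sub>0. z \<in> R1" using R1 by (rule eventually_nhds_in_open)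
  have near': "\<forall>\<^sub>F z in at z\<^sub>0. z \<in> R1" using R1 by (rule eventually_at_in_open')
  have \<alpha>1: "holomorphic_curve X' R1 \<alpha>" unfolding R1_def by (rule curve_subset[OF \<alpha>(1)]) auto
  have sub': "holomorphic_atlas (open_submanifold X' {y. \<pi> y \<in> U})"
    by (rule holomorphic_atlas_open_submanifold[OF atlas(2) openin_over_U])
  have sub: "holomorphic_atlas (open_submanifold X U)"
    by (rule holomorphic_atlas_open_submanifold[OF atlas(1) openin_U])
  have subD: "holomorphic_atlas (open_submanifold blowup_plane {(x, l). x \<in> D})"
    by (rule holomorphic_atlas_open_submanifold[OF holomorphic_atlas_blowup openin_over_D])
  have c\<Psi>: "holomorphic_curve blowup_plane R1 (\<lambda>z. \<Psi> (\<alpha> z))"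
    by (rule curve_holomorphic_map[OF _ R1(1) sub' \<Psi>(1)]) (simp add: curve_open_submanifold \<alpha>1, auto simp: R1_def)
  have fst\<Psi>: "fst (\<Psi> (\<alpha> z)) = \<zeta> (\<pi> (\<alpha> z))" if "z \<in> R1" for z
    using that \<Psi>(2) by (auto simp: R1_def)
  have f0: "fst (\<Psi> (\<alpha> z\<^sub>0)) = 0" using fst\<Psi>[OF R1(2)] \<alpha>(4) \<zeta>(2) by simp
  have fnz: "\<forall>\<^sub>F z in at z\<^sub>0. fst (\<Psi> (\<alpha> z)) \<noteq> 0"
    using nz near' by eventually_elim (use fst\<Psi> \<zeta>_nonzero in \<open>auto simp: R1_def\<close>)
  obtain k where k: "contact_lift blowup_plane fst complex_plane (\<lambda>z. \<Psi> (\<alpha> z)) z\<^sub>0 j k"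
    using blowup_plane_lift[OF c\<Psi> R1 f0 fnz, of j] by blast
  show ?thesis
    unfolding contact_lift_def
  proof (intro exI[of _ k] allI impI)
    fix \<beta> R' assume R': "open R'" "z\<^sub>0 \<in> R'" and \<beta>: "holomorphic_curve X R' \<beta>"
      and c: "curves_contact X z\<^sub>0 k (\<lambda>z. \<pi> (\<alpha> z)) \<beta>"
    have \<beta>0: "\<beta> z\<^sub>0 = p" using c \<alpha>(4) by (simp add: curves_contact_def)
    \<comment> \<open>On \<open>R3\<close> both the projection of \<open>\<alpha>\<close> and the
      curve \<open>\<beta>\<close> run in the coordinate neighbourhood, so that
      \<open>\<zeta>\<close> can be applied to both.\<close>
    define R3 where "R3 = R1 \<inter> {z \<in> R'. \<beta> z \<in> U}"
    have R3: "open R3" "z\<^sub>0 \<in> R3" "R3 \<subseteq> R1" "R3 \<subseteq> R'"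
      unfolding R3_def using curve_open[OF \<beta> R'(1) U(1)] R1 R' \<beta>0 U(2) by auto
    have 1: "holomorphic_curve (open_submanifold X U) R3 (\<lambda>z. \<pi> (\<alpha> z))"
      using curve_holomorphic_map[OF curve_subset[OF \<alpha>1 R3(3)] R3(1) atlas(2) \<pi>]
      by (auto simp: curve_open_submanifold R3_def R1_def)
    have 2: "holomorphic_curve (open_submanifold X U) R3 \<beta>"
      using curve_subset[OF \<beta> R3(4)] by (auto simp: curve_open_submanifold R3_def)
    have "curves_contact (open_submanifold X U) z\<^sub>0 k (\<lambda>z. \<pi> (\<alpha> z)) \<beta>"
      using c \<alpha>(4) U(2) by (subst curves_contact_open_submanifold) auto
    from curves_contact_map[OF sub \<zeta>(1) 1 2 R3(1,2) this]
    have "curves_contact complex_plane z\<^sub>0 k (\<lambda>z. \<zeta> (\<pi> (\<alpha> z))) (\<lambda>z. \<zeta> (\<beta> z))" .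
    then have contact: "curves_contact complex_plane z\<^sub>0 k (\<lambda>z. fst (\<Psi> (\<alpha> z))) (\<lambda>z. \<zeta> (\<beta> z))"
      by (rule curves_contact_cong) (auto intro: eventually_mono[OF near] simp: fst\<Psi>)
    have \<zeta>\<beta>: "holomorphic_curve complex_plane R3 (\<lambda>z. \<zeta> (\<beta> z))"
      by (rule curve_holomorphic_map[OF 2 R3(1) sub \<zeta>(1)])
    obtain e \<gamma> where e: "e > 0" "ball z\<^sub>0 e \<subseteq> R3" "holomorphic_curve blowup_plane (ball z\<^sub>0 e) \<gamma>"
        "\<forall>z\<in>ball z\<^sub>0 e. fst (\<gamma> z) = \<zeta> (\<beta> z)" "curves_contact blowup_plane z\<^sub>0 j (\<lambda>z. \<Psi> (\<alpha> z)) \<gamma>"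
      using k[unfolded contact_lift_def, rule_format, OF R3(1,2) \<zeta>\<beta> contact] by blast
    have \<beta>U: "\<beta> z \<in> U" if "z \<in> ball z\<^sub>0 e" for z using that e(2) by (auto simp: R3_def)
    have D': "fst (\<gamma> z) \<in> D" if "z \<in> ball z\<^sub>0 e" for z using e(4) that \<beta>U \<zeta>(3) by simp
    have "holomorphic_curve X' (ball z\<^sub>0 e) (\<lambda>z. \<Psi>' (\<gamma> z))"
      by (rule curve_\<Psi>'[OF e(3) open_ball D'])
    moreover have "\<pi> (\<Psi>' (\<gamma> z)) = \<beta> z" if "z \<in> ball z\<^sub>0 e" for z
      using \<pi>_\<Psi>'[OF curve_points[OF e(3) that] D'[OF that]] e(4) that \<zeta>(4)[OF \<beta>U[OF that]] by simp
    moreover have "curves_contact X' z\<^sub>0 j \<alpha> (\<lambda>z. \<Psi>' (\<gamma> z))"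
    proof -
      have ball_R1: "ball z\<^sub>0 e \<subseteq> R1" using e(2) R3(3) by auto
      have D1: "fst (\<Psi> (\<alpha> z)) \<in> D" if "z \<in> R1" for z
        using fst\<Psi>[OF that] that \<zeta>(3) by (simp add: R1_def)
      have "curves_contact X' z\<^sub>0 j (\<lambda>z. \<Psi>' (\<Psi> (\<alpha> z))) (\<lambda>z. \<Psi>' (\<gamma> z))"
      proof (rule curves_contact_map[OF subD \<Psi>'(1) _ _ open_ball])
        show "holomorphic_curve (open_submanifold blowup_plane {(x, l). x \<in> D}) (ball z\<^sub>0 e) (\<lambda>z. \<Psi> (\<alpha> z))"
          using curve_subset[OF c\<Psi> ball_R1] D1[OF subsetD[OF ball_R1]]
          by (simp add: curve_open_submanifold over_D_eq image_subset_iff)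
        show "holomorphic_curve (open_submanifold blowup_plane {(x, l). x \<in> D}) (ball z\<^sub>0 e) \<gamma>"
          using e(3) D' by (simp add: curve_open_submanifold over_D_eq image_subset_iff)
        show "curves_contact (open_submanifold blowup_plane {(x, l). x \<in> D}) z\<^sub>0 j (\<lambda>z. \<Psi> (\<alpha> z)) \<gamma>"
          using e(5) D1[OF R1(2)] by (subst curves_contact_open_submanifold) (auto simp: over_D_eq)
      qed (use e(1) in simp)
      then show ?thesis
        by (rule curves_contact_cong) (auto intro: eventually_mono[OF near] simp: \<Psi>(3) R1_def)
    qed
    ultimately show "\<exists>e>0. \<exists>\<gamma>. ball z\<^sub>0 e \<subseteq> R' \<and> holomorphic_curve X' (ball z\<^sub>0 e) \<gamma> \<and>
       (\<forall>z\<in>ball z\<^sub>0 e. \<pi> (\<gamma> z) = \<beta> z) \<and> curves_contact X' z\<^sub>0 j \<alpha> \<gamma>"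
      using e(1,2) R3(4) by blast
  qed
qed

end

section \<open>Proper transforms\<close>

context surface_blowup
begin

text \<open>A proper transform is a closure, so its complement is an open neighbourhood of
  \<open>y\<close> that also avoids the set whose closure was taken.\<close>

lemma not_in_proper_transform:
  assumes "y \<in> points X'" "y \<notin> proper_transform X' \<pi> p C"
  shows "\<exists>N. openin (manifold_topology X') N \<and> y \<in> N \<and> (\<forall>y'\<in>N. \<pi> y' \<notin> C - {p} \<and> y' \<notin> proper_transform X' \<pi> p C)"
proof (intro exI conjI)
  let ?Z = "{y \<in> points X'. \<pi> y \<in> C - {p}}"
  show "openin (manifold_topology X') (points X' - proper_transform X' \<pi> p C)"
    unfolding proper_transform_def using openin_topspace[of "manifold_topology X'"]
    by (intro openin_diff) (auto simp: topspace_manifold)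
  have "?Z \<subseteq> proper_transform X' \<pi> p C"
    unfolding proper_transform_def by (rule closure_of_subset) (auto simp: topspace_manifold)
  then show "\<forall>y'\<in>points X' - proper_transform X' \<pi> p C. \<pi> y' \<notin> C - {p} \<and> y' \<notin> proper_transform X' \<pi> p C"
    by blast
qed (use assms in auto)

text \<open>If the direction \<open>e + w\<^sub>0 *s f\<close> represented by \<open>y\<close> is
  tangent to the curve \<open>s = 0\<close>, then lines of nearby directions meet this curve
  arbitrarily close to \<open>p\<close> but off \<open>p\<close>, and the points above these zeros
  accumulate at \<open>y\<close>. The map \<open>\<kappa>\<close> gives the chart coordinates of the
  point over \<open>x *s (e + w *s f)\<close>, which keeps the argument uniform in the two
  charts.\<close>

lemma tangent_in_proper_transform:
  assumes chart: "(range P, inv P) \<in> blowup_plane" "inj P"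
    and \<kappa>: "\<And>x w. dist (\<kappa> x w) (\<kappa> 0 w\<^sub>0) \<le> norm x + norm (w - w\<^sub>0)"
      "\<And>x w. fst (P (\<kappa> x w)) = x *s (e + w *s f)" "\<And>w. e + w *s f \<noteq> 0"
    and t: "((\<lambda>v. s (\<zeta>' v)) has_derivative l) (at 0)" "\<And>c v. l (c *s v) = c * l v"
      "holomorphic_scalar_on (\<lambda>v. s (\<zeta>' v)) D" "s p = 0"
    and y: "y \<in> points X'" "\<Psi> y = P (\<kappa> 0 w\<^sub>0)" "\<pi> y = p"
    and l: "l (e + w\<^sub>0 *s f) = 0" "l f \<noteq> 0"
  shows "y \<in> proper_transform X' \<pi> p {x \<in> points X. s x = 0}"
proof (rule ccontr)
  assume not: "\<not> ?thesis"
  obtain N where N: "openin (manifold_topology X') N" "y \<in> N"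
      "\<And>y'. y' \<in> N \<Longrightarrow> \<pi> y' \<notin> {x \<in> points X. s x = 0} - {p}"
    using not_in_proper_transform[OF y(1) not] by blast
  let ?B = "open_submanifold blowup_plane {(x, l). x \<in> D}"
  define M where "M = {w \<in> points ?B. \<Psi>' w \<in> N}"
  have "openin (manifold_topology blowup_plane) M"
    unfolding M_def
    by (rule openin_open_submanifold_imp[OF openin_holomorphic_map_preimage[OF \<Psi>'(1) N(1)] openin_over_D])
  from open_chart_image[OF holomorphic_atlas_blowup chart(1) this]
  have "open (inv P ` (range P \<inter> M))" .
  moreover have "inv P ` (range P \<inter> M) = {v. P v \<in> M}" 
  proof safe
    fix v assume "P v \<in> M"
    then show "v \<in> inv P ` (range P \<inter> M)"
      by (intro image_eqI[of _ _ "P v"]) (simp_all add: chart(2))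
  qed (simp add: chart(2))
  ultimately have V: "open {v. P v \<in> M}" by simp
  have "P (\<kappa> 0 w\<^sub>0) \<in> M"
    using \<Psi>_points[OF y(1)] \<Psi>(3)[OF y(1)] y N(2) U(2) zero_D \<Psi>(2)[OF y(1)] \<zeta>(2)
    by (simp add: M_def over_D_eq)
  with V obtain \<delta> where \<delta>: "\<delta> > 0" "\<And>v. dist v (\<kappa> 0 w\<^sub>0) < \<delta> \<Longrightarrow> P v \<in> M"
    unfolding open_dist by auto
  have "\<exists>x w. x \<noteq> 0 \<and> norm x < \<delta> / 2 \<and> norm w < \<delta> / 2 \<and> x *s ((e + w\<^sub>0 *s f) + w *s f) \<in> D
      \<and> s (\<zeta>' (x *s ((e + w\<^sub>0 *s f) + w *s f))) = 0"
    by (rule zeros_near_tangent_line[OF t(1) _ t(2) l D zero_D t(3)])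
      (use \<delta>(1) t(4) \<zeta>'_zero in auto)
  then obtain x w where xw: "x \<noteq> 0" "norm x < \<delta> / 2" "norm w < \<delta> / 2"
    "x *s (e + (w\<^sub>0 + w) *s f) \<in> D" "s (\<zeta>' (x *s (e + (w\<^sub>0 + w) *s f))) = 0"
    by (auto simp: vector_sadd_rdistrib add.assoc)
  let ?v = "P (\<kappa> x (w\<^sub>0 + w))"
  have M: "?v \<in> M"
    using \<kappa>(1)[of x "w\<^sub>0 + w"] xw(2,3) by (intro \<delta>(2)) simp
  then have v: "?v \<in> points blowup_plane" "fst ?v \<in> D" "\<Psi>' ?v \<in> N"
    by (auto simp: M_def)
  have "\<pi> (\<Psi>' ?v) = \<zeta>' (x *s (e + (w\<^sub>0 + w) *s f))" using \<pi>_\<Psi>'[OF v(1,2)] \<kappa>(2) by simp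
  with xw(5) have "s (\<pi> (\<Psi>' ?v)) = 0" by simp
  \<comment> \<open>\<open>N\<close> admits zeros of \<open>s\<close> over \<open>p\<close> only,
    whereas this zero lies at the parameter \<open>x \<noteq> 0\<close> of a line through the
    origin, hence not over \<open>p\<close>.\<close>
  then have "\<pi> (\<Psi>' ?v) = p"
    using N(3)[OF v(3)] U_points[OF \<Psi>'(2)[OF v(1,2)]] by auto
  then have "\<zeta>' (fst ?v) = p" using \<pi>_\<Psi>'[OF v(1,2)] by simp
  then have "fst ?v = 0" using \<zeta>'(3)[OF v(2)] \<zeta>(2) by simp
  then have "x *s (e + (w\<^sub>0 + w) *s f) = 0" using \<kappa>(2) by metis
  then show False using \<kappa>(3) xw(1) vector_mul_eq_0 by metis
qed

text \<open>As \<open>y\<close> is off the proper transform, its direction is not tangent, so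
  \<open>l\<close> does not vanish on it. The straight line in this direction lifts to a curve
  through \<open>y\<close>, and along it the derivative of \<open>s\<close> is the value of
  \<open>l\<close> on that direction.\<close>

lemma transversal_curve_chart:
  assumes chart: "(range P, inv P) \<in> blowup_plane" "inj P"
    and \<kappa>: "\<And>x w. dist (\<kappa> x w) (\<kappa> 0 w\<^sub>0) \<le> norm x + norm (w - w\<^sub>0)"
      "\<And>x w. fst (P (\<kappa> x w)) = x *s (e + w *s f)" "\<And>w. e + w *s f \<noteq> 0"
      "holomorphic_curve blowup_plane UNIV (\<lambda>z. P (\<kappa> z w\<^sub>0))"
    and t: "((\<lambda>v. s (\<zeta>' v)) has_derivative l) (at 0)" "\<And>c v. l (c *s v) = c * l v"
      "holomorphic_scalar_on (\<lambda>v. s (\<zeta>' v)) D" "s p = 0"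
    and y: "y \<in> points X'" "\<Psi> y = P (\<kappa> 0 w\<^sub>0)" "\<pi> y = p"
      "y \<notin> proper_transform X' \<pi> p {x \<in> points X. s x = 0}"
    and l: "l (e + w\<^sub>0 *s f) = 0 \<Longrightarrow> l f \<noteq> 0"
  shows "\<exists>r>0. \<exists>\<alpha> d. holomorphic_curve X' (ball 0 r) \<alpha> \<and> \<alpha> 0 = y \<and>
    (\<forall>z\<in>ball 0 r. \<alpha> z \<notin> proper_transform X' \<pi> p {x \<in> points X. s x = 0}) \<and>
    d \<noteq> 0 \<and> ((\<lambda>z. s (\<pi> (\<alpha> z))) has_field_derivative d) (at 0)"
proof -
  let ?PT = "proper_transform X' \<pi> p {x \<in> points X. s x = 0}"
  define e' where "e' = e + w\<^sub>0 *s f"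
  have le: "l e' \<noteq> 0"
    using tangent_in_proper_transform[OF chart \<kappa>(1-3) t y(1-3) _ l] y(4) by (auto simp: e'_def)
  obtain N where N: "openin (manifold_topology X') N" "y \<in> N" "\<And>y'. y' \<in> N \<Longrightarrow> y' \<notin> ?PT"
    using not_in_proper_transform[OF y(1,4)] by blast
  have fst: "fst (P (\<kappa> z w\<^sub>0)) = z *s e'" for z by (simp add: \<kappa>(2) e'_def)
  define R where "R = {z. z *s e' \<in> D}"
  have "continuous_on UNIV (\<lambda>z. z *s e')" unfolding continuous_on_vec_iff by (auto intro!: continuous_intros)
  from open_vimage[OF D this] have R: "open R" by (simp add: R_def vimage_def)
  have "0 \<in> R" using zero_D by (simp add: R_def)
  define \<alpha> where "\<alpha> z = \<Psi>' (P (\<kappa> z w\<^sub>0))" for z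
  have \<alpha>: "holomorphic_curve X' R \<alpha>"
    unfolding \<alpha>_def by (rule curve_\<Psi>'[OF curve_subset[OF \<kappa>(4)] R]) (auto simp: fst R_def)
  have "\<alpha> 0 = y" unfolding \<alpha>_def using \<Psi>(3)[OF y(1)] y(2,3) U(2) by simp
  define R' where "R' = {z \<in> R. \<alpha> z \<in> N}"
  have R': "open R'" "0 \<in> R'"
    unfolding R'_def using curve_open[OF \<alpha> R N(1)] \<open>0 \<in> R\<close> \<open>\<alpha> 0 = y\<close> N(2) by auto
  then obtain r where r: "r > 0" "ball 0 r \<subseteq> R'" using open_contains_ball by blast
  have "((\<lambda>z. z *s e') has_derivative (\<lambda>h. h *s e')) (at 0)"
    unfolding has_derivative_vec_curve by (auto intro!: derivative_eq_intros)
  from diff_chain_at[OF this, of "\<lambda>v. s (\<zeta>' v)" l] t(1,2)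
  have "((\<lambda>z. s (\<zeta>' (z *s e'))) has_field_derivative l e') (at 0)"
    by (simp add: o_def has_field_derivative_def mult_commute_abs)
  moreover have "s (\<zeta>' (z *s e')) = s (\<pi> (\<alpha> z))" if "z \<in> R'" for z
    using \<pi>_\<Psi>'[OF curve_points[OF \<kappa>(4)]] that unfolding \<alpha>_def fst by (auto simp: R'_def R_def fst)
  ultimately have "((\<lambda>z. s (\<pi> (\<alpha> z))) has_field_derivative l e') (at 0)"
    by (rule has_field_derivative_transform_within_open[OF _ R'])
  moreover have "holomorphic_curve X' (ball 0 r) \<alpha>"
    by (rule curve_subset[OF \<alpha>]) (use r in \<open>auto simp: R'_def\<close>)
  ultimately show ?thesis
    using r le \<open>\<alpha> 0 = y\<close> N(3) by (intro exI[of _ r] conjI exI[of _ \<alpha>] exI[of _ "l e'"]) (auto simp: R'_def)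
qed

text \<open>Supplies a curve that crosses the new exceptional curve transversally at
  \<open>y\<close>. The two cases are the charts of the blow-up, in which the slope and the
  vanishing coordinate exchange their places.\<close>

lemma transversal_curve:
  assumes t: "((\<lambda>v. s (\<zeta>' v)) has_derivative l) (at 0)" "\<And>c v. l (c *s v) = c * l v"
      "holomorphic_scalar_on (\<lambda>v. s (\<zeta>' v)) D" "s p = 0"
    and l: "l v \<noteq> 0"
    and y: "y \<in> points X'" "\<pi> y = p"
      "y \<notin> proper_transform X' \<pi> p {x \<in> points X. s x = 0}"
  shows "\<exists>r>0. \<exists>\<alpha> d. holomorphic_curve X' (ball 0 r) \<alpha> \<and> \<alpha> 0 = y \<and>
    (\<forall>z\<in>ball 0 r. \<alpha> z \<notin> proper_transform X' \<pi> p {x \<in> points X. s x = 0}) \<and>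
    d \<noteq> 0 \<and> ((\<lambda>z. s (\<pi> (\<alpha> z))) has_field_derivative d) (at 0)"
proof -
  have lin: "l (a *s u + b *s w) = a * l u + b * l w" for a b u w
    using linear_add[OF has_derivative_linear[OF t(1)]] t(2) by simp
  have "l v = v $ 1 * l (vector [1, 0]) + v $ 2 * l (vector [0, 1])"
    using lin vec2_decompose[of v] by metis
  then have indep: "l (vector [1, 0]) \<noteq> 0 \<or> l (vector [0, 1]) \<noteq> 0" using l by auto
  have lin': "l (u + b *s w) = l u + b * l w" for b u w using lin[of 1 u b w] by simp
  have 0: "fst (\<Psi> y) = 0" using \<Psi>(2)[OF y(1)] y(2) U(2) \<zeta>(2) by simp
  from \<Psi>_points[OF y(1)] y(2) U(2) consider a where "\<Psi> y = blowup_param1 a" | a where "\<Psi> y = blowup_param2 a"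
    by (auto simp: points_blowup)
  then show ?thesis
  proof cases
    case 1
    have "a = vector [0, a $ 2]" using 0 1 by (simp add: fst_blowup_param vec2_eq_iff)
    then have \<Psi>y: "\<Psi> y = blowup_param1 (vector [0, a $ 2])" using 1 by simp
    show ?thesis
    proof (rule transversal_curve_chart[OF blowup_plane_chart1 inj_blowup_param(1), where \<kappa> = "\<lambda>x w. vector [x, w]"
          and e = "vector [1, 0]" and f = "vector [0, 1]"])
      show "dist (vector [x, w] :: complex ^ 2) (vector [0, a $ 2]) \<le> norm x + norm (w - a $ 2)" for x w :: complex
        using norm_vec2_le[of "vector [x, w] - vector [0, a $ 2]"] by (simp add: dist_norm)
      show "holomorphic_curve blowup_plane UNIV (\<lambda>z. blowup_param1 (vector [z, a $ 2]))"
        by (intro curve_blowup_param) auto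
    qed (use t y \<Psi>y indep in \<open>auto simp: lin' fst_blowup_param vec2_eq_iff\<close>)
  next
    case 2
    have "a = vector [a $ 1, 0]" using 0 2 by (simp add: fst_blowup_param vec2_eq_iff)
    then have \<Psi>y: "\<Psi> y = blowup_param2 (vector [a $ 1, 0])" using 2 by simp
    show ?thesis
    proof (rule transversal_curve_chart[OF blowup_plane_chart2 inj_blowup_param(2), where \<kappa> = "\<lambda>x w. vector [w, x]"
          and e = "vector [0, 1]" and f = "vector [1, 0]"])
      show "dist (vector [w, x] :: complex ^ 2) (vector [a $ 1, 0]) \<le> norm x + norm (w - a $ 1)" for x w :: complex
        using norm_vec2_le[of "vector [w, x] - vector [a $ 1, 0]"] by (simp add: dist_norm)
      show "holomorphic_curve blowup_plane UNIV (\<lambda>z. blowup_param2 (vector [a $ 1, z]))"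
        by (intro curve_blowup_param) auto
    qed (use t y \<Psi>y indep in \<open>auto simp: lin' fst_blowup_param vec2_eq_iff\<close>)
  qed
qed

text \<open>Some direction is not tangent to \<open>s = 0\<close>; the corresponding exceptional
  point has a neighbourhood without zeros of \<open>s\<close> off the exceptional curve. This keeps
  the exceptional curves of the tower nonempty.\<close>

lemma exceptional_not_in_proper_transform:
  assumes t: "((\<lambda>v. s (\<zeta>' v)) has_derivative l) (at 0)" "\<And>c v. l (c *s v) = c * l v" "s p = 0"
    and l: "l v \<noteq> 0"
  shows "\<exists>y\<in>points X'. \<pi> y = p \<and> y \<notin> proper_transform X' \<pi> p {x \<in> points X. s x = 0}"
proof -
  have lin: "l (a *s u + b *s w) = a * l u + b * l w" for a b u w
    using linear_add[OF has_derivative_linear[OF t(1)]] t(2) by simp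
  have lv: "l v = v $ 1 * l (vector [1, 0]) + v $ 2 * l (vector [0, 1])" for v
    using lin vec2_decompose[of v] by metis
  \<comment> \<open>At most one direction is tangent since \<open>l\<close> is not zero: if the
    first axis is tangent, then the diagonal is not.\<close>
  have "\<exists>w\<^sub>0. l (vector [1, w\<^sub>0]) \<noteq> 0"
  proof (cases "l (vector [1, 0]) = 0")
    case True
    then have "l (vector [1, 1]) \<noteq> 0" using l lv[of v] lv[of "vector [1, 1]"] by auto
    then show ?thesis by blast
  qed blast
  then obtain w\<^sub>0 where w0: "l (vector [1, w\<^sub>0]) \<noteq> 0" by blast
  obtain \<delta> where \<delta>: "\<delta> > 0" "\<And>x v. x \<noteq> 0 \<Longrightarrow> norm x < \<delta> \<Longrightarrow> norm (v - vector [1, w\<^sub>0]) < \<delta> \<Longrightarrow> s (\<zeta>' (x *s v)) \<noteq> 0"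
    using no_zeros_near_line[OF t(1) _ t(2) w0] t(3) \<zeta>'_zero by auto
  define q where "q = blowup_param1 (vector [0, w\<^sub>0])"
  have q: "q \<in> points blowup_plane" "fst q = 0"
    by (auto simp: q_def points_blowup fst_blowup_param vec2_eq_iff)
  define y where "y = \<Psi>' q"
  have qD: "fst q \<in> D" using q zero_D by simp
  have y: "y \<in> points X'" "\<pi> y = p" "\<Psi> y = q"
    unfolding y_def using \<Psi>'_points[OF q(1) qD] \<pi>_\<Psi>'[OF q(1) qD] \<Psi>'(3)[OF q(1) qD] q(2) \<zeta>'_zero by simp_all
  let ?Y = "open_submanifold X' {y. \<pi> y \<in> U}"
  \<comment> \<open>In the first chart the coordinates are the parameter \<open>x\<close> on a line
    and the slope of that line, so nearness to \<open>(0, w\<^sub>0)\<close> bounds both quantities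
    that \<open>no_zeros_near_line\<close> speaks of.\<close>
  define N where "N = {y \<in> points ?Y. \<Psi> y \<in> range blowup_param1 \<inter> inv blowup_param1 -` ball (vector [0, w\<^sub>0]) \<delta>}"
  have N: "openin (manifold_topology X') N"
    unfolding N_def
    by (rule openin_open_submanifold_imp[OF openin_holomorphic_map_preimage[OF \<Psi>(1)] openin_over_U])
      (rule openin_chart_vimage[OF blowup_plane_chart1 open_ball])
  have yN: "y \<in> N" using y U(2) \<delta>(1) by (auto simp: N_def q_def inj_blowup_param)
  have disj: "\<pi> y' \<notin> {x \<in> points X. s x = 0} - {p}" if "y' \<in> N" for y'
  proof
    assume y': "\<pi> y' \<in> {x \<in> points X. s x = 0} - {p}"
    have y'U: "y' \<in> points X'" "\<pi> y' \<in> U" and r: "\<Psi> y' \<in> range blowup_param1"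
      and b: "inv blowup_param1 (\<Psi> y') \<in> ball (vector [0, w\<^sub>0]) \<delta>"
      using that by (auto simp: N_def)
    from r obtain v where v1: "\<Psi> y' = blowup_param1 v" by blast
    with b have "dist (vector [0, w\<^sub>0]) v < \<delta>" by (simp add: inj_blowup_param)
    note v = v1 this
    have "norm (v $ 1) < \<delta>"
      using Finite_Cartesian_Product.norm_nth_le[of "v - vector [0, w\<^sub>0]" 1] v(2) by (simp add: dist_norm norm_minus_commute)
    moreover have "norm (vector [1, v $ 2] - vector [1, w\<^sub>0] :: complex ^ 2) < \<delta>"
      using norm_vec2_le[of "vector [1, v $ 2] - vector [1, w\<^sub>0]"]
        Finite_Cartesian_Product.norm_nth_le[of "v - vector [0, w\<^sub>0]" 2] v(2) by (simp add: dist_norm norm_minus_commute)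
    moreover have \<zeta>y: "\<zeta> (\<pi> y') = v $ 1 *s vector [1, v $ 2]"
      using \<Psi>(2)[OF y'U] v(1) by (auto simp: fst_blowup_param vec2_eq_iff)
    moreover have "v $ 1 \<noteq> 0" using \<zeta>_nonzero[OF y'U(2)] y' \<zeta>y by auto
    moreover have "s (\<zeta>' (\<zeta> (\<pi> y'))) = 0" using \<zeta>(4)[OF y'U(2)] y' by simp
    ultimately show False using \<delta>(2)[of "v $ 1" "vector [1, v $ 2]"] by simp
  qed
  have "y \<notin> proper_transform X' \<pi> p {x \<in> points X. s x = 0}"
    using N yN disj unfolding proper_transform_def in_closure_of by blast
  with y show ?thesis by blast
qed

end

section \<open>The tower of blow-ups\<close>

definition cusp :: "complex ^ 2 \<Rightarrow> complex"
  where "cusp v = (v $ 1) ^ 3 - (v $ 2) ^ 2"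

lemma cusp_curve_iff: "v \<in> cusp_curve \<longleftrightarrow> cusp v = 0"
  by (simp add: cusp_curve_def cusp_def)

lemma holomorphic_scalar_cusp [holomorphic_scalar_intros]:
  "holomorphic_vec_on F S \<Longrightarrow> holomorphic_scalar_on (\<lambda>x. cusp (F x)) S"
  unfolding cusp_def by (intro holomorphic_scalar_intros)

lemma open_cusp_complement: "open (- cusp_curve)"
proof -
  have "continuous_on UNIV (\<lambda>v :: complex ^ 2. (v $ 1) ^ 3 - (v $ 2) ^ 2)"
    by (intro continuous_intros)
  from open_vimage[OF open_Compl[OF closed_singleton[of 0]] this] show ?thesis
    by (simp add: vimage_def cusp_curve_def Compl_eq)
qed

text \<open>A curve in the plane lifts to \<open>V\<close> once it has sufficiently high contact with the projection of a
  curve in \<open>V\<close>; this is a coordinate-free form of the congruences that describe \<open>V\<close> as an iterated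
  affine modification.\<close>

definition curve_lifting :: "('a, 2) atlas \<Rightarrow> ('a \<Rightarrow> complex ^ 2) \<Rightarrow> bool"
  where "curve_lifting V \<sigma> \<longleftrightarrow> (\<forall>R \<alpha> z\<^sub>0 j. holomorphic_curve V R \<alpha> \<longrightarrow> open R \<longrightarrow> z\<^sub>0 \<in> R \<longrightarrow>
    cusp (\<sigma> (\<alpha> z\<^sub>0)) = 0 \<longrightarrow> (\<forall>\<^sub>F z in at z\<^sub>0. cusp (\<sigma> (\<alpha> z)) \<noteq> 0) \<longrightarrow>
    (\<exists>k. contact_lift V \<sigma> complex_plane \<alpha> z\<^sub>0 j k))"

text \<open>The inductive invariant: \<open>\<sigma>\<close> is the composite of the blow-downs and
  \<open>J\<close> its inverse over the complement of the cusp. The values of \<open>J\<close> on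
  the cusp are left open.\<close>

definition cusp_model :: "('a, 2) atlas \<Rightarrow> 'a set \<Rightarrow> ('a \<Rightarrow> complex ^ 2) \<Rightarrow> (complex ^ 2 \<Rightarrow> 'a) \<Rightarrow> bool"
  where "cusp_model V E \<sigma> J \<longleftrightarrow> holomorphic_atlas V \<and> holomorphic_map V complex_plane \<sigma> \<and>
    E = {x \<in> points V. cusp (\<sigma> x) = 0} \<and>
    holomorphic_map (open_submanifold complex_plane (- cusp_curve)) V J \<and>
    (\<forall>v. v \<notin> cusp_curve \<longrightarrow> \<sigma> (J v) = v) \<and>
    (\<forall>x\<in>points V. \<sigma> x \<notin> cusp_curve \<longrightarrow> J (\<sigma> x) = x) \<and> curve_lifting V \<sigma>"

text \<open>States that the pull-back of \<open>cusp\<close> has nonzero differential at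
  \<open>x\<close>; testing it along a curve avoids the choice of a chart. The first condition
  records that every exceptional curve of the tower lies over (1,1), where both coordinates are
  nonzero.\<close>

definition transversal_at :: "('a, 2) atlas \<Rightarrow> ('a \<Rightarrow> complex ^ 2) \<Rightarrow> 'a \<Rightarrow> bool"
  where "transversal_at V \<sigma> x \<longleftrightarrow> \<sigma> x = vector [1, 1] \<and>
    (\<exists>r>0. \<exists>\<alpha> d. holomorphic_curve V (ball 0 r) \<alpha> \<and> \<alpha> 0 = x \<and> d \<noteq> 0 \<and>
      ((\<lambda>z. cusp (\<sigma> (\<alpha> z))) has_field_derivative d) (at 0))"

text \<open>The case of no blow-ups, with the cusp in the role of the exceptional curve. Nothing has
  to be lifted, so the order of contact stays \<open>j\<close>.\<close>

lemma cusp_model_plane: "cusp_model complex_plane cusp_curve (\<lambda>x. x) (\<lambda>x. x)"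
proof -
  have "curve_lifting complex_plane (\<lambda>x. x)"
    unfolding curve_lifting_def
  proof (intro allI impI)
    fix \<alpha> :: "complex \<Rightarrow> complex ^ 2" and z\<^sub>0 j
    show "\<exists>k. contact_lift complex_plane (\<lambda>x. x) complex_plane \<alpha> z\<^sub>0 j k"
    unfolding contact_lift_def
    proof (intro exI[of _ j] allI impI)
      fix \<beta> R' assume b: "open R'" "z\<^sub>0 \<in> R'" "holomorphic_curve complex_plane R' \<beta>"
        "curves_contact complex_plane z\<^sub>0 j \<alpha> \<beta>"
      obtain e where "e > 0" "ball z\<^sub>0 e \<subseteq> R'" using b(1,2) open_contains_ball by blast
      then show "\<exists>e>0. \<exists>\<gamma>. ball z\<^sub>0 e \<subseteq> R' \<and> holomorphic_curve complex_plane (ball z\<^sub>0 e) \<gamma> \<and>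
         (\<forall>z\<in>ball z\<^sub>0 e. \<gamma> z = \<beta> z) \<and> curves_contact complex_plane z\<^sub>0 j \<alpha> \<gamma>"
        using b curve_subset by (intro exI[of _ e] conjI exI[of _ \<beta>]) auto
    qed
  qed
  then show ?thesis
    using holomorphic_map_id[OF holomorphic_atlas_plane] holomorphic_atlas_plane open_cusp_complement
    by (auto simp: cusp_model_def cusp_curve_iff intro!: holomorphic_map_restrict)
qed

text \<open>The cusp is smooth at (1,1) and the horizontal line crosses it transversally; the 3 is
  the derivative of \<open>u ^ 3\<close> at 1.\<close>

lemma transversal_at_plane: "transversal_at complex_plane (\<lambda>x. x) (vector [1, 1])"
proof -
  have "holomorphic_curve complex_plane (ball 0 1) (\<lambda>z. vector [1 + z, 1])"
    unfolding curve_plane[OF open_ball] forall_2 by (auto intro!: holomorphic_intros)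
  moreover have "((\<lambda>z. cusp (vector [1 + z, 1])) has_field_derivative 3) (at 0)"
    unfolding cusp_def by (auto intro!: derivative_eq_intros)
  ultimately show ?thesis
    unfolding transversal_at_def
    by (intro conjI exI[of _ 1] exI[of _ "\<lambda>z. vector [1 + z, 1]"] exI[of _ 3]) auto
qed

section \<open>One blow-up step of the tower\<close>

context surface_blowup
begin

context
  fixes E :: "'a set" and \<sigma> :: "'a \<Rightarrow> complex ^ 2" and J :: "complex ^ 2 \<Rightarrow> 'a"
  assumes model: "cusp_model X E \<sigma> J" and pE: "p \<in> E" and trans: "transversal_at X \<sigma> p"
begin

lemma
  shows \<sigma>_map: "holomorphic_map X complex_plane \<sigma>"
    and E_eq: "E = {x \<in> points X. cusp (\<sigma> x) = 0}"
    and J_map: "holomorphic_map (open_submanifold complex_plane (- cusp_curve)) X J"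
    and \<sigma>_J: "\<And>v. v \<notin> cusp_curve \<Longrightarrow> \<sigma> (J v) = v"
    and J_\<sigma>: "\<And>x. x \<in> points X \<Longrightarrow> \<sigma> x \<notin> cusp_curve \<Longrightarrow> J (\<sigma> x) = x"
    and lifting: "curve_lifting X \<sigma>"
  using model by (auto simp: cusp_model_def)

lemma cusp_scalar: "holomorphic_scalar_on (\<lambda>v. cusp (\<sigma> (\<zeta>' v))) D"
proof (rule holomorphic_scalar_cusp, rule holomorphic_map_plane_vec[OF _ D])
  have "holomorphic_atlas (open_submanifold complex_plane D)"
    using D by (intro holomorphic_atlas_open_submanifold[OF holomorphic_atlas_plane]) simp
  then show "holomorphic_map (open_submanifold complex_plane D) complex_plane (\<lambda>v. \<sigma> (\<zeta>' v))"
    by (rule holomorphic_map_compose[OF _ atlas(1) \<zeta>'(1) \<sigma>_map])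
qed

text \<open>By the chain rule along the transversal curve, \<open>l\<close> takes the nonzero value
  \<open>d\<close> on the velocity of this curve in the coordinates \<open>\<zeta>\<close>.\<close>

lemma cusp_derivative:
  shows "\<exists>l v. ((\<lambda>v. cusp (\<sigma> (\<zeta>' v))) has_derivative l) (at 0) \<and> (\<forall>c v. l (c *s v) = c * l v) \<and> l v \<noteq> 0"
proof -
  obtain l where l: "((\<lambda>v. cusp (\<sigma> (\<zeta>' v))) has_derivative l) (at 0)" "\<And>c v. l (c *s v) = c * l v"
    using cusp_scalar zero_D unfolding holomorphic_scalar_on_def by blast
  obtain r \<alpha> d where \<alpha>: "r > 0" "holomorphic_curve X (ball 0 r) \<alpha>" "\<alpha> 0 = p" "d \<noteq> 0"
      "((\<lambda>z. cusp (\<sigma> (\<alpha> z))) has_field_derivative d) (at 0)"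
    using trans unfolding transversal_at_def by blast
  define R where "R = {z \<in> ball 0 r. \<alpha> z \<in> U}"
  have R: "open R" "0 \<in> R"
    unfolding R_def using curve_open[OF \<alpha>(2) open_ball U(1)] \<alpha>(1,3) U(2) by auto
  have "holomorphic_curve (open_submanifold X U) R \<alpha>"
    unfolding curve_open_submanifold R_def using curve_subset[OF \<alpha>(2), of "{z \<in> ball 0 r. \<alpha> z \<in> U}"] by blast
  from curve_holomorphic_map[OF this R(1) holomorphic_atlas_open_submanifold[OF atlas(1) openin_U] \<zeta>(1)]
  have hol: "(\<lambda>z. \<zeta> (\<alpha> z) $ i) holomorphic_on R" for i
    unfolding curve_plane[OF R(1)] by (rule spec)
  define c where "c = (\<chi> i. deriv (\<lambda>z. \<zeta> (\<alpha> z) $ i) 0)"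
  have "((\<lambda>z. \<zeta> (\<alpha> z)) has_derivative (\<lambda>h. h *s c)) (at 0)"
    unfolding has_derivative_vec_curve c_def using holomorphic_derivI[OF hol R] by simp
  from diff_chain_at[OF this, of "\<lambda>v. cusp (\<sigma> (\<zeta>' v))" l] l \<alpha>(3) \<zeta>(2)
  have "((\<lambda>z. cusp (\<sigma> (\<zeta>' (\<zeta> (\<alpha> z))))) has_field_derivative l c) (at 0)"
    by (simp add: o_def has_field_derivative_def mult_commute_abs)
  then have "((\<lambda>z. cusp (\<sigma> (\<alpha> z))) has_field_derivative l c) (at 0)"
    by (rule has_field_derivative_transform_within_open[OF _ R]) (simp add: R_def \<zeta>(4))
  then have "l c = d" using \<alpha>(5) DERIV_unique by blast
  with l \<alpha>(4) show ?thesis by blast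
qed

abbreviation "PT \<equiv> proper_transform X' \<pi> p E"

lemma cusp_p: "cusp (\<sigma> p) = 0"
  using pE E_eq by auto

lemma openin_PT_complement: "openin (manifold_topology X') (points X' \<inter> - PT)"
proof -
  have "openin (manifold_topology X') (points X' - PT)"
    unfolding proper_transform_def using openin_topspace[of "manifold_topology X'"]
    by (intro openin_diff) (auto simp: topspace_manifold)
  then show ?thesis by (simp add: Diff_eq)
qed

lemma \<sigma>\<pi>_map: "holomorphic_map X' complex_plane (\<lambda>y. \<sigma> (\<pi> y))"
  by (rule holomorphic_map_compose[OF atlas(2,1) \<pi> \<sigma>_map])

text \<open>The set where the pulled-back equation does not vanish is open and misses the set whose
  closure is the proper transform.\<close>

lemma PT_cusp:
  assumes "y \<in> PT" shows "cusp (\<sigma> (\<pi> y)) = 0"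
proof (rule ccontr)
  assume nz: "cusp (\<sigma> (\<pi> y)) \<noteq> 0"
  let ?N = "{y \<in> points X'. \<sigma> (\<pi> y) \<in> - cusp_curve}"
  have opN: "openin (manifold_topology X') ?N"
    by (rule openin_holomorphic_map_preimage[OF \<sigma>\<pi>_map]) (simp add: open_cusp_complement)
  have yN: "y \<in> ?N"
    using nz assms unfolding proper_transform_def in_closure_of by (simp add: topspace_manifold cusp_curve_iff)
  have "\<forall>T. y \<in> T \<and> openin (manifold_topology X') T \<longrightarrow> (\<exists>y'. y' \<in> {y \<in> points X'. \<pi> y \<in> E - {p}} \<and> y' \<in> T)"
    using assms unfolding proper_transform_def in_closure_of by (rule conjunct2)
  from this[rule_format, OF conjI[OF yN opN]]
  have "\<exists>y'. y' \<in> {y \<in> points X'. \<pi> y \<in> E - {p}} \<and> y' \<in> ?N" .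
  then obtain y' where "y' \<in> ?N" "\<pi> y' \<in> E" by auto
  then show False using E_eq by (auto simp: cusp_curve_iff)
qed

text \<open>Points over the rest of E belong to the proper transform, so what remains of the zero
  set after its removal lies over the centre.\<close>

lemma cusp_iff:
  assumes "y \<in> points X'" "y \<notin> PT"
  shows "cusp (\<sigma> (\<pi> y)) = 0 \<longleftrightarrow> \<pi> y = p"
proof
  assume "cusp (\<sigma> (\<pi> y)) = 0"
  then have "\<pi> y \<in> E" using holomorphic_map_points[OF \<pi> assms(1)] E_eq by simp
  moreover have "\<pi> y \<notin> E - {p}" using not_in_proper_transform[OF assms] by blast
  ultimately show "\<pi> y = p" by blast
qed (simp add: cusp_p)

text \<open>A curve is lifted from the plane to \<open>X\<close> and from there to
  \<open>X'\<close>. The orders are fixed from the top down: \<open>j\<close> upstairs determines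
  the order \<open>k1\<close> on \<open>X\<close>, and \<open>k1\<close> determines \<open>k\<close>
  in the plane.\<close>

lemma lifting_blowup: "curve_lifting (open_submanifold X' (- PT)) (\<lambda>y. \<sigma> (\<pi> y))"
  unfolding curve_lifting_def
proof (intro allI impI)
  fix R \<alpha> z\<^sub>0 j
  assume \<alpha>: "holomorphic_curve (open_submanifold X' (- PT)) R \<alpha>" and R: "open R" "z\<^sub>0 \<in> R"
    and c0: "cusp (\<sigma> (\<pi> (\<alpha> z\<^sub>0))) = 0" and nz: "\<forall>\<^sub>F z in at z\<^sub>0. cusp (\<sigma> (\<pi> (\<alpha> z))) \<noteq> 0"
  have \<alpha>': "holomorphic_curve X' R \<alpha>" "\<And>z. z \<in> R \<Longrightarrow> \<alpha> z \<notin> PT"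
    using \<alpha> by (auto simp: curve_open_submanifold)
  have p0: "\<pi> (\<alpha> z\<^sub>0) = p" using cusp_iff[OF curve_points[OF \<alpha>'(1) R(2)] \<alpha>'(2)[OF R(2)]] c0 by simp
  have pn: "\<forall>\<^sub>F z in at z\<^sub>0. \<pi> (\<alpha> z) \<noteq> p" using nz by eventually_elim (use cusp_p in auto)
  obtain k1 where k1: "contact_lift X' \<pi> X \<alpha> z\<^sub>0 j k1"
    using lift_curve[OF \<alpha>'(1) R p0 pn, of j] by blast
  have \<pi>\<alpha>: "holomorphic_curve X R (\<lambda>z. \<pi> (\<alpha> z))"
    by (rule curve_holomorphic_map[OF \<alpha>'(1) R(1) atlas(2) \<pi>])
  obtain k where k: "contact_lift X \<sigma> complex_plane (\<lambda>z. \<pi> (\<alpha> z)) z\<^sub>0 k1 k"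
    using lifting[unfolded curve_lifting_def, rule_format, OF \<pi>\<alpha> R c0 nz, of k1] by blast
  show "\<exists>k. contact_lift (open_submanifold X' (- PT)) (\<lambda>y. \<sigma> (\<pi> y)) complex_plane \<alpha> z\<^sub>0 j k"
    unfolding contact_lift_def
  proof (intro exI[of _ k] allI impI)
    fix \<beta> R' assume R': "open R'" "z\<^sub>0 \<in> R'" and \<beta>: "holomorphic_curve complex_plane R' \<beta>"
      and c: "curves_contact complex_plane z\<^sub>0 k (\<lambda>z. \<sigma> (\<pi> (\<alpha> z))) \<beta>"
    obtain e1 \<gamma>1 where 1: "e1 > 0" "ball z\<^sub>0 e1 \<subseteq> R'" "holomorphic_curve X (ball z\<^sub>0 e1) \<gamma>1"
        "\<forall>z\<in>ball z\<^sub>0 e1. \<sigma> (\<gamma>1 z) = \<beta> z" "curves_contact X z\<^sub>0 k1 (\<lambda>z. \<pi> (\<alpha> z)) \<gamma>1"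
      using k[unfolded contact_lift_def, rule_format, OF R' \<beta> c] by blast
    have z0: "z\<^sub>0 \<in> ball z\<^sub>0 e1" using 1(1) by simp
    obtain e2 \<gamma>2 where 2: "e2 > 0" "ball z\<^sub>0 e2 \<subseteq> ball z\<^sub>0 e1" "holomorphic_curve X' (ball z\<^sub>0 e2) \<gamma>2"
        "\<forall>z\<in>ball z\<^sub>0 e2. \<pi> (\<gamma>2 z) = \<gamma>1 z" "curves_contact X' z\<^sub>0 j \<alpha> \<gamma>2"
      using k1[unfolded contact_lift_def, rule_format, OF open_ball z0 1(3,5)] by blast
    have "\<gamma>2 z\<^sub>0 = \<alpha> z\<^sub>0" using 2(5) by (simp add: curves_contact_def)
    \<comment> \<open>The lift to \<open>X'\<close> could run into the proper transform. It starts
      at \<open>\<alpha> z\<^sub>0\<close>, which lies in the open complement, so it stays off for a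
      while.\<close>
    define R3 where "R3 = {z \<in> ball z\<^sub>0 e2. \<gamma>2 z \<in> points X' \<inter> - PT}"
    have "open R3" "z\<^sub>0 \<in> R3"
      unfolding R3_def using curve_open[OF 2(3) open_ball openin_PT_complement] 2(1) \<open>\<gamma>2 z\<^sub>0 = \<alpha> z\<^sub>0\<close>
        \<alpha>'(2)[OF R(2)] curve_points[OF \<alpha>'(1) R(2)] by auto
    then obtain e where e: "e > 0" "ball z\<^sub>0 e \<subseteq> R3" using open_contains_ball by blast
    have sub: "ball z\<^sub>0 e \<subseteq> ball z\<^sub>0 e2" using e(2) by (auto simp: R3_def)
    have "holomorphic_curve (open_submanifold X' (- PT)) (ball z\<^sub>0 e) \<gamma>2"
      using curve_subset[OF 2(3) sub] e(2) by (auto simp: curve_open_submanifold R3_def)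
    moreover have "curves_contact (open_submanifold X' (- PT)) z\<^sub>0 j \<alpha> \<gamma>2"
      using 2(5) \<alpha>'(2)[OF R(2)] by (subst curves_contact_open_submanifold) auto
    moreover have "\<forall>z\<in>ball z\<^sub>0 e. \<sigma> (\<pi> (\<gamma>2 z)) = \<beta> z"
      using 1(4) 2(2,4) sub by (metis subsetD)
    ultimately show "\<exists>e>0. \<exists>\<gamma>. ball z\<^sub>0 e \<subseteq> R' \<and> holomorphic_curve (open_submanifold X' (- PT)) (ball z\<^sub>0 e) \<gamma> \<and>
         (\<forall>z\<in>ball z\<^sub>0 e. \<sigma> (\<pi> (\<gamma> z)) = \<beta> z) \<and> curves_contact (open_submanifold X' (- PT)) z\<^sub>0 j \<alpha> \<gamma>"
      using e(1) sub 2(2) 1(2) by (intro exI[of _ e] conjI exI[of _ \<gamma>2]) auto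
  qed
qed

lemma cusp_model_blowup:
  "cusp_model (open_submanifold X' (- PT)) (exceptional_divisor X' \<pi> p - PT) (\<lambda>y. \<sigma> (\<pi> y)) (\<lambda>v. \<rho> (J v))"
  unfolding cusp_model_def
proof (intro conjI allI impI ballI)
  show "holomorphic_atlas (open_submanifold X' (- PT))"
    by (rule holomorphic_atlas_open_submanifold[OF atlas(2) openin_PT_complement])
  show "holomorphic_map (open_submanifold X' (- PT)) complex_plane (\<lambda>y. \<sigma> (\<pi> y))"
    by (rule holomorphic_map_restrict[OF atlas(2) openin_PT_complement \<sigma>\<pi>_map])
  show "exceptional_divisor X' \<pi> p - PT = {x \<in> points (open_submanifold X' (- PT)). cusp (\<sigma> (\<pi> x)) = 0}"
    using cusp_iff by (auto simp: exceptional_divisor_def)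
  show "curve_lifting (open_submanifold X' (- PT)) (\<lambda>y. \<sigma> (\<pi> y))" by (rule lifting_blowup)
  have Jp: "J v \<in> points X" "J v \<noteq> p" if "v \<notin> cusp_curve" for v
    using holomorphic_map_points[OF J_map, of v] that \<sigma>_J[OF that] cusp_p by (auto simp: cusp_curve_iff)
  show "\<sigma> (\<pi> (\<rho> (J v))) = v" if "v \<notin> cusp_curve" for v
    using \<rho>(2)[OF Jp[OF that]] \<sigma>_J[OF that] by simp
  show "\<rho> (J (\<sigma> (\<pi> y))) = y" if "y \<in> points (open_submanifold X' (- PT))" "\<sigma> (\<pi> y) \<notin> cusp_curve" for y
    using that J_\<sigma>[OF holomorphic_map_points[OF \<pi>]] \<rho>(3)[of y] cusp_p by (auto simp: cusp_curve_iff)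
  \<comment> \<open>The inverse \<open>\<rho>\<close> of the blow-down is holomorphic off
    \<open>p\<close> only. To compose it with \<open>J\<close>, the complement of \<open>p\<close>
    must be open, which the Hausdorff property provides.\<close>
  have op: "openin (manifold_topology X) (points X \<inter> - {p})"
    using closedin_Hausdorff_singleton[OF Hausdorff, of p] p by (simp add: closedin_def topspace_manifold Diff_eq)
  have "holomorphic_map (open_submanifold complex_plane (- cusp_curve)) (open_submanifold X (- {p})) J"
    using J_map Jp by (auto simp: holomorphic_map_open_submanifold)
  from holomorphic_map_compose[OF _ holomorphic_atlas_open_submanifold[OF atlas(1) op] this \<rho>(1)]
  have "holomorphic_map (open_submanifold complex_plane (- cusp_curve)) X' (\<lambda>v. \<rho> (J v))"
    by (simp add: holomorphic_atlas_open_submanifold[OF holomorphic_atlas_plane] open_cusp_complement)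
  moreover have "\<rho> (J v) \<notin> PT" if "v \<notin> cusp_curve" for v
    using PT_cusp[of "\<rho> (J v)"] \<rho>(2)[OF Jp[OF that]] \<sigma>_J[OF that] that by (auto simp: cusp_curve_iff)
  ultimately show "holomorphic_map (open_submanifold complex_plane (- cusp_curve)) (open_submanifold X' (- PT)) (\<lambda>v. \<rho> (J v))"
    by (auto simp: holomorphic_map_open_submanifold)
qed

lemma transversal_at_blowup:
  assumes "y \<in> exceptional_divisor X' \<pi> p - PT"
  shows "transversal_at (open_submanifold X' (- PT)) (\<lambda>y. \<sigma> (\<pi> y)) y"
proof -
  have y: "y \<in> points X'" "\<pi> y = p" "y \<notin> PT" using assms by (auto simp: exceptional_divisor_def)
  obtain l v where l: "((\<lambda>v. cusp (\<sigma> (\<zeta>' v))) has_derivative l) (at 0)" "\<And>c v. l (c *s v) = c * l v" "l v \<noteq> 0"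
    using cusp_derivative by blast
  have "\<sigma> p = vector [1, 1]" using trans by (simp add: transversal_at_def)
  then show ?thesis
    using transversal_curve[OF l(1,2) cusp_scalar cusp_p l(3) y(1,2)] y unfolding E_eq[symmetric]
    unfolding transversal_at_def curve_open_submanifold by fastforce
qed

lemma exceptional_blowup_nonempty: "exceptional_divisor X' \<pi> p - PT \<noteq> {}"
proof -
  obtain l v where l: "((\<lambda>v. cusp (\<sigma> (\<zeta>' v))) has_derivative l) (at 0)" "\<And>c v. l (c *s v) = c * l v" "l v \<noteq> 0"
    using cusp_derivative by blast
  show ?thesis
    using exceptional_not_in_proper_transform[OF l(1,2) cusp_p l(3)] unfolding E_eq[symmetric]
    by (auto simp: exceptional_divisor_def)
qed

end

end

text \<open>Both rules of the tower are instances of the same step, the first one starting from the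
  plane with the cusp as its curve. Nonemptiness of E is carried along because the entire curves
  must cross E at some point.\<close>

lemma tower_surface_model:
  assumes "tower_surface m V E"
  shows "\<exists>\<sigma> J. cusp_model V E \<sigma> J \<and> E \<noteq> {} \<and> (\<forall>x\<in>E. transversal_at V \<sigma> x)"
  using assms
proof induction
  case (first V' \<pi> p)
  obtain \<rho> U D \<zeta> \<zeta>' \<Psi> \<Psi>' where b: "surface_blowup V' \<pi> complex_plane p \<rho> U D \<zeta> \<zeta>' \<Psi> \<Psi>'"
    using is_blowup_surface_blowup[OF first(1)] by blast
  have "p \<in> cusp_curve" by (simp add: first(2) cusp_curve_def)
  moreover have "transversal_at complex_plane (\<lambda>x. x) p" using transversal_at_plane first(2) by simp
  ultimately show ?case
    using surface_blowup.cusp_model_blowup[OF b cusp_model_plane]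
      surface_blowup.transversal_at_blowup[OF b cusp_model_plane]
      surface_blowup.exceptional_blowup_nonempty[OF b cusp_model_plane] by blast
next
  case (step V' \<pi> m V E p)
  obtain \<sigma> J where m: "cusp_model V E \<sigma> J" "\<forall>x\<in>E. transversal_at V \<sigma> x" using step by blast
  obtain \<rho> U D \<zeta> \<zeta>' \<Psi> \<Psi>' where b: "surface_blowup V' \<pi> V p \<rho> U D \<zeta> \<zeta>' \<Psi> \<Psi>'"
    using is_blowup_surface_blowup[OF step(3)] by blast
  show ?case
    using surface_blowup.cusp_model_blowup[OF b m(1)]
      surface_blowup.transversal_at_blowup[OF b m(1)]
      surface_blowup.exceptional_blowup_nonempty[OF b m(1)] m(2) step(2) by blast
qed

section \<open>Interpolation by entire functions\<close>

lemma power_tendsto_zero: "n \<ge> 1 \<Longrightarrow> ((\<lambda>z. (z - z\<^sub>0) ^ n) \<longlongrightarrow> 0) (at (z\<^sub>0 :: complex))"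
  by (auto intro!: tendsto_eq_intros)

lemma bigo_power_tendsto_zero:
  assumes "f \<in> O[at z\<^sub>0](\<lambda>z. (z - z\<^sub>0) ^ n)" "n \<ge> 1"
  shows "(f \<longlongrightarrow> (0::complex)) (at z\<^sub>0)"
proof -
  have "(\<lambda>z. (z - z\<^sub>0) ^ n) \<in> o[at z\<^sub>0](\<lambda>_. 1)"
    by (rule smalloI_tendsto) (use power_tendsto_zero[OF assms(2)] in auto)
  from smalloD_tendsto[OF landau_o.big_small_trans[OF assms(1) this]] show ?thesis by simp
qed

lemma bigo_power_value:
  assumes "f \<in> O[at z\<^sub>0](\<lambda>z. (z - z\<^sub>0) ^ n)" "n \<ge> 1" "isCont f z\<^sub>0"
  shows "f z\<^sub>0 = (0::complex)"
  using LIM_unique[OF _ bigo_power_tendsto_zero[OF assms(1,2)]] assms(3) by (auto simp: isCont_def)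

lemma isCont_bigo_1: "isCont f z\<^sub>0 \<Longrightarrow> f \<in> O[at z\<^sub>0](\<lambda>_. 1 :: complex)"
  by (rule bigoI_tendsto[of _ _ "f z\<^sub>0"]) (auto simp: isCont_def)

lemma holomorphic_isCont: "f holomorphic_on S \<Longrightarrow> open S \<Longrightarrow> z \<in> S \<Longrightarrow> isCont f z"
  using holomorphic_on_imp_continuous_on continuous_on_eq_continuous_at by blast

text \<open>Each step splits off the value at \<open>z\<^sub>0\<close> and a factor
  \<open>z - z\<^sub>0\<close>; the difference quotient extends holomorphically by the derivative,
  so the induction hypothesis applies to it.\<close>

lemma taylor_polynomial:
  assumes "F holomorphic_on S" "open S" "z\<^sub>0 \<in> S"
  shows "\<exists>r. r holomorphic_on UNIV \<and> (\<lambda>z. F z - r z) \<in> O[at z\<^sub>0](\<lambda>z. (z - z\<^sub>0) ^ n)"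
  using assms
proof (induction n arbitrary: F)
  case 0
  then show ?case
    using isCont_bigo_1[OF holomorphic_isCont[OF 0]] by (intro exI[of _ "\<lambda>_. 0"]) auto
next
  case (Suc n)
  define F1 where "F1 z = (if z = z\<^sub>0 then deriv F z\<^sub>0 else (F z - F z\<^sub>0) / (z - z\<^sub>0))" for z
  have "F1 holomorphic_on S" unfolding F1_def using pole_lemma_open[OF Suc.prems(1,2)] by simp
  from Suc.IH[OF this Suc.prems(2,3)] obtain r where r: "r holomorphic_on UNIV"
    "(\<lambda>z. F1 z - r z) \<in> O[at z\<^sub>0](\<lambda>z. (z - z\<^sub>0) ^ n)" by blast
  have eq: "F z - (F z\<^sub>0 + (z - z\<^sub>0) * r z) = (z - z\<^sub>0) * (F1 z - r z)" for z
    by (simp add: F1_def field_simps)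
  show ?case
  proof (intro exI conjI)
    show "(\<lambda>z. F z\<^sub>0 + (z - z\<^sub>0) * r z) holomorphic_on UNIV" using r(1) by (intro holomorphic_intros)
    show "(\<lambda>z. F z - (F z\<^sub>0 + (z - z\<^sub>0) * r z)) \<in> O[at z\<^sub>0](\<lambda>z. (z - z\<^sub>0) ^ Suc n)"
      unfolding eq power_Suc by (intro landau_o.big.mult r(2)) simp
  qed
qed

text \<open>Newton's scheme: a new node is served by a correction \<open>M w * r w\<close> with
  \<open>M\<close> vanishing to order \<open>n\<close> at the old nodes, where it therefore spoils
  nothing. Since \<open>M\<close> is invertible near the new node, \<open>r\<close> can be taken as
  a Taylor polynomial of \<open>(F - P) / M\<close> there.\<close>

lemma entire_interpolation:
  assumes "finite Z" "\<And>z. z \<in> Z \<Longrightarrow> open (S z) \<and> z \<in> S z \<and> F z holomorphic_on S z"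
  shows "\<exists>P. P holomorphic_on UNIV \<and> (\<forall>z\<in>Z. (\<lambda>w. F z w - P w) \<in> O[at z](\<lambda>w. (w - z) ^ n))"
  using assms
proof (induction rule: finite_induct)
  case empty
  then show ?case by (intro exI[of _ "\<lambda>_. 0"]) auto
next
  case (insert z\<^sub>1 Z)
  then obtain P where P: "P holomorphic_on UNIV" "\<And>z. z \<in> Z \<Longrightarrow> (\<lambda>w. F z w - P w) \<in> O[at z](\<lambda>w. (w - z) ^ n)"
    by auto
  define M where "M w = (\<Prod>z\<in>Z. (w - z) ^ n)" for w
  have M: "M holomorphic_on UNIV" unfolding M_def by (intro holomorphic_intros)
  have M1: "M z\<^sub>1 \<noteq> 0" using insert(1,2) by (auto simp: M_def)
  define S' where "S' = S z\<^sub>1 \<inter> {w. M w \<noteq> 0}"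
  have "open {w. M w \<noteq> 0}"
    using open_vimage[OF open_Compl[OF closed_singleton[of 0]] holomorphic_on_imp_continuous_on[OF M]] by (simp add: vimage_def)
  then have S': "open S'" "z\<^sub>1 \<in> S'" using insert.prems[of z\<^sub>1] M1 by (auto simp: S'_def)
  have "(\<lambda>w. (F z\<^sub>1 w - P w) / M w) holomorphic_on S'"
    using insert.prems[of z\<^sub>1] P(1) M by (intro holomorphic_intros) (auto simp: S'_def intro: holomorphic_on_subset)
  from taylor_polynomial[OF this S', of n] obtain r where r: "r holomorphic_on UNIV"
    "(\<lambda>w. (F z\<^sub>1 w - P w) / M w - r w) \<in> O[at z\<^sub>1](\<lambda>w. (w - z\<^sub>1) ^ n)" by blast
  let ?P = "\<lambda>w. P w + M w * r w"
  have "(\<lambda>w. F z w - ?P w) \<in> O[at z](\<lambda>w. (w - z) ^ n)" if "z \<in> insert z\<^sub>1 Z" for z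
  proof (cases "z = z\<^sub>1")
    case True
    have "(\<lambda>w. M w * ((F z\<^sub>1 w - P w) / M w - r w)) \<in> O[at z\<^sub>1](\<lambda>w. 1 * (w - z\<^sub>1) ^ n)"
      by (intro landau_o.big.mult r(2) isCont_bigo_1 holomorphic_isCont[OF M]) auto
    moreover have "\<forall>\<^sub>F w in at z\<^sub>1. w \<in> S'" using S' by (rule eventually_at_in_open')
    then have "\<forall>\<^sub>F w in at z\<^sub>1. M w * ((F z\<^sub>1 w - P w) / M w - r w) = F z\<^sub>1 w - ?P w"
      by eventually_elim (simp add: S'_def field_simps)
    ultimately show ?thesis using True landau_o.big.in_cong by force
  next
    case False
    then have z: "z \<in> Z" using that by simp
    define M' where "M' w = (\<Prod>y\<in>Z - {z}. (w - y) ^ n)" for w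
    have M': "M' holomorphic_on UNIV" unfolding M'_def by (intro holomorphic_intros)
    have Meq: "M w = (w - z) ^ n * M' w" for w
      unfolding M_def M'_def using insert(1) z by (rule prod.remove)
    have "(\<lambda>w. (w - z) ^ n * (M' w * r w)) \<in> O[at z](\<lambda>w. (w - z) ^ n * 1)"
      by (intro landau_o.big.mult isCont_bigo_1 holomorphic_isCont[of _ UNIV] holomorphic_intros M' r(1)) auto
    then have "(\<lambda>w. M w * r w) \<in> O[at z](\<lambda>w. (w - z) ^ n)" by (simp add: Meq mult.assoc)
    from sum_in_bigo(2)[OF P(2)[OF z] this] show ?thesis by (simp add: algebra_simps)
  qed
  moreover have "?P holomorphic_on UNIV" using P(1) M r(1) by (intro holomorphic_intros)
  ultimately show ?case by blast
qed

text \<open>The difference equals \<open>exp (L z) * (exp (P z - L z) - 1)\<close>, and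
  \<open>exp w - 1\<close> is of the order of \<open>w\<close>. The condition
  \<open>n \<ge> 1\<close> makes \<open>P - L\<close> tend to 0.\<close>

lemma exp_minus_exp_bigo:
  assumes d: "(\<lambda>z. P z - L z) \<in> O[at z\<^sub>0](\<lambda>z. (z - z\<^sub>0) ^ n)" and n: "n \<ge> 1" and L: "isCont L z\<^sub>0"
  shows "(\<lambda>z. exp (P z) - exp (L z)) \<in> O[at z\<^sub>0](\<lambda>z. (z - z\<^sub>0) ^ n :: complex)"
proof -
  have "((\<lambda>w::complex. (exp w - 1) / w) \<longlongrightarrow> 1) (at 0)"
    using DERIV_exp[of "0::complex"] by (simp add: has_field_derivative_iff)
  then have "(\<lambda>w::complex. exp w - 1) \<in> O[at 0](\<lambda>w. w)"
    by (rule bigoI_tendsto) (auto simp: eventually_at_filter)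
  then obtain c where "\<forall>\<^sub>F w in at (0::complex). norm (exp w - 1) \<le> c * norm w"
    by (rule landau_o.bigE)
  then obtain e where e: "e > 0" "\<And>w::complex. w \<noteq> 0 \<Longrightarrow> dist w 0 < e \<Longrightarrow> norm (exp w - 1) \<le> c * norm w"
    unfolding eventually_at by blast
  have "\<forall>\<^sub>F z in at z\<^sub>0. dist (P z - L z) 0 < e"
    by (rule tendstoD[OF bigo_power_tendsto_zero[OF d n] e(1)])
  then have "\<forall>\<^sub>F z in at z\<^sub>0. norm (exp (P z - L z) - 1) \<le> c * norm (P z - L z)"
  proof eventually_elim
    case (elim z)
    \<comment> \<open>The limit of the difference quotient says nothing at \<open>w = 0\<close>,
      where both sides of the estimate are 0.\<close>
    then show ?case using e(2)[of "P z - L z"] by (cases "P z - L z = 0") auto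
  qed
  then have "(\<lambda>z. exp (P z - L z) - 1) \<in> O[at z\<^sub>0](\<lambda>z. P z - L z)" by (rule bigoI)
  also note d
  finally have "(\<lambda>z. exp (L z) * (exp (P z - L z) - 1)) \<in> O[at z\<^sub>0](\<lambda>z. 1 * (z - z\<^sub>0) ^ n)"
    using L by (intro landau_o.big.mult isCont_bigo_1) auto
  then show ?thesis by (simp add: right_diff_distrib flip: exp_add)
qed

section \<open>Curves in the plane\<close>

lemma linear_root_set_finite:
  assumes "n > 0" "x ^ n \<noteq> y"
  shows "finite {z :: complex. (x + c * z) ^ n = y}"
proof (cases "c = 0")
  case False
  have "finite ((\<lambda>z. x + c * z) -` {w. w ^ n = y})"
    using finite_nth_roots[OF assms(1)] False by (intro finite_vimageI) (auto simp: inj_def)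
  then show ?thesis by (simp add: vimage_def)
qed (use assms in simp)

text \<open>A nonzero component of \<open>v\<close> is kept constant and the other one made linear;
  this excludes common zeros and leaves finitely many solutions of \<open>a ^ 3 = b ^ 2\<close>. The
  number \<open>\<kappa>\<close> is the derivative at 0 of the logarithm of the later factor h,
  where h is 1 at 0. It is chosen such that h alone gives the constant component its prescribed
  derivative.\<close>

lemma coprime_pair:
  assumes "cusp v \<noteq> 0"
  shows "\<exists>a b \<kappa>. a holomorphic_on UNIV \<and> b holomorphic_on UNIV \<and> a 0 = v $ 1 \<and> b 0 = v $ 2 \<and>
    (a has_field_derivative w $ 1 - 2 * \<kappa> * v $ 1) (at 0) \<and>
    (b has_field_derivative w $ 2 - 3 * \<kappa> * v $ 2) (at 0) \<and>
    (\<forall>z. a z \<noteq> 0 \<or> b z \<noteq> 0) \<and> finite {z. a z ^ 3 = b z ^ 2}"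
proof (cases "v $ 1 = 0")
  case False
  define \<kappa> where "\<kappa> = w $ 1 / (2 * v $ 1)"
  define c where "c = w $ 2 - 3 * \<kappa> * v $ 2"
  have "finite {z. (v $ 2 + c * z) ^ 2 = (v $ 1) ^ 3}"
    using assms by (intro linear_root_set_finite) (auto simp: cusp_def)
  then have "finite {z. (v $ 1) ^ 3 = (v $ 2 + c * z) ^ 2}" by (simp add: eq_commute)
  moreover have "((\<lambda>z. v $ 2 + c * z) has_field_derivative c) (at 0)" by (auto intro!: derivative_eq_intros)
  ultimately show ?thesis
    using False by (intro exI[of _ "\<lambda>_. v $ 1"] exI[of _ "\<lambda>z. v $ 2 + c * z"] exI[of _ \<kappa>])
      (auto simp: c_def \<kappa>_def intro!: holomorphic_intros)
next
  case True
  then have v2: "v $ 2 \<noteq> 0" using assms by (auto simp: cusp_def)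
  define \<kappa> where "\<kappa> = w $ 2 / (3 * v $ 2)"
  define c where "c = w $ 1 - 2 * \<kappa> * v $ 1"
  have "finite {z. (v $ 1 + c * z) ^ 3 = (v $ 2) ^ 2}"
    using assms by (intro linear_root_set_finite) (auto simp: cusp_def)
  moreover have "((\<lambda>z. v $ 1 + c * z) has_field_derivative c) (at 0)" by (auto intro!: derivative_eq_intros)
  ultimately show ?thesis
    using v2 by (intro exI[of _ "\<lambda>z. v $ 1 + c * z"] exI[of _ "\<lambda>_. v $ 2"] exI[of _ \<kappa>])
      (auto simp: c_def \<kappa>_def intro!: holomorphic_intros)
qed

text \<open>The function \<open>u ^ 3 / v ^ 2 - 1\<close> is \<open>cusp\<close> divided by
  \<open>v ^ 2\<close>. As \<open>cusp\<close> vanishes and \<open>v\<close> is 1 at the point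
  (1,1), its derivative along the curve is still \<open>d\<close>, so it can be taken as the new
  parameter.\<close>

lemma normalized_transversal_curve:
  assumes V: "cusp_model V E \<sigma> J" and x: "transversal_at V \<sigma> x"
  shows "\<exists>T \<alpha>. open T \<and> 0 \<in> T \<and> holomorphic_curve V T \<alpha> \<and>
    (\<forall>w\<in>T. \<sigma> (\<alpha> w) $ 1 \<noteq> 0 \<and> \<sigma> (\<alpha> w) $ 2 \<noteq> 0 \<and> (\<sigma> (\<alpha> w) $ 1) ^ 3 = (\<sigma> (\<alpha> w) $ 2) ^ 2 * (1 + w))"
proof -
  obtain r \<alpha> d where x1: "\<sigma> x = vector [1, 1]" and \<alpha>: "r > 0" "holomorphic_curve V (ball 0 r) \<alpha>" "\<alpha> 0 = x" "d \<noteq> 0"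
      "((\<lambda>z. cusp (\<sigma> (\<alpha> z))) has_field_derivative d) (at 0)"
    using x unfolding transversal_at_def by blast
  have "holomorphic_curve complex_plane (ball 0 r) (\<lambda>z. \<sigma> (\<alpha> z))"
    using V by (intro curve_holomorphic_map[OF \<alpha>(2) open_ball]) (auto simp: cusp_model_def)
  then have hol: "(\<lambda>z. \<sigma> (\<alpha> z) $ i) holomorphic_on ball 0 r" for i unfolding curve_plane[OF open_ball] by (rule spec)
  define R where "R = {z \<in> ball 0 r. \<sigma> (\<alpha> z) $ 1 \<in> - {0}} \<inter> {z \<in> ball 0 r. \<sigma> (\<alpha> z) $ 2 \<in> - {0}}"
  have "open R"
    unfolding R_def using continuous_open_preimage[OF holomorphic_on_imp_continuous_on[OF hol] open_ball, of "- {0}"]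
    by (intro open_Int) (auto simp: vimage_def Int_def)
  have "0 \<in> R" using \<alpha>(1,3) x1 by (simp add: R_def)
  have holR: "(\<lambda>z. \<sigma> (\<alpha> z) $ i) holomorphic_on R" for i by (rule holomorphic_on_subset[OF hol]) (auto simp: R_def)
  define q where "q z = (\<sigma> (\<alpha> z) $ 1) ^ 3 / (\<sigma> (\<alpha> z) $ 2) ^ 2 - 1" for z
  have q: "q holomorphic_on R" unfolding q_def using holR by (intro holomorphic_intros) (auto simp: R_def)
  have q0: "q 0 = 0" using \<alpha>(3) x1 by (simp add: q_def)
  have "((\<lambda>z. \<sigma> (\<alpha> z) $ 2) has_field_derivative deriv (\<lambda>z. \<sigma> (\<alpha> z) $ 2) 0) (at 0)"
    by (rule holomorphic_derivI[OF holR \<open>open R\<close> \<open>0 \<in> R\<close>])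
  from DERIV_divide[OF \<alpha>(5) DERIV_power[OF this, of 2]]
  have "((\<lambda>z. cusp (\<sigma> (\<alpha> z)) / (\<sigma> (\<alpha> z) $ 2) ^ 2) has_field_derivative d) (at 0)"
    using \<alpha>(3) x1 by (simp add: cusp_def)
  then have "(q has_field_derivative d) (at 0)"
    by (rule has_field_derivative_transform_within_open[OF _ \<open>open R\<close> \<open>0 \<in> R\<close>])
      (auto simp: R_def q_def cusp_def field_simps)
  then have dq: "deriv q 0 \<noteq> 0" using \<alpha>(4) DERIV_imp_deriv by blast
  obtain s where s: "s > 0" "ball 0 s \<subseteq> R" "open (q ` ball 0 s)" "inj_on q (ball 0 s)"
    using has_complex_derivative_locally_invertible[OF q \<open>0 \<in> R\<close> \<open>open R\<close> dq] .
  have "\<exists>\<tau>. \<tau> holomorphic_on q ` ball 0 s \<and> (\<forall>z\<in>ball 0 s. \<tau> (q z) = z)"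
    by (rule holomorphic_has_inverse[OF holomorphic_on_subset[OF q s(2)] open_ball s(4)]) (rule exI, rule conjI, assumption, rule ballI)
  then obtain \<tau> where \<tau>: "\<tau> holomorphic_on q ` ball 0 s" "\<And>z. z \<in> ball 0 s \<Longrightarrow> \<tau> (q z) = z" by blast
  let ?T = "q ` ball 0 s"
  have "0 \<in> ?T" using s(1) q0 by (intro image_eqI[of _ _ 0]) auto
  moreover have "\<tau> ` ?T \<subseteq> ball 0 r" using \<tau>(2) s(2) by (force simp: R_def)
  then have "holomorphic_curve V ?T (\<lambda>w. \<alpha> (\<tau> w))" by (rule curve_compose[OF \<alpha>(2) \<tau>(1)])
  moreover have "\<sigma> (\<alpha> z) $ 1 \<noteq> 0 \<and> \<sigma> (\<alpha> z) $ 2 \<noteq> 0 \<and> (\<sigma> (\<alpha> z) $ 1) ^ 3 = (\<sigma> (\<alpha> z) $ 2) ^ 2 * (1 + q z)"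
    if "z \<in> ball 0 s" for z
    using s(2) that by (auto simp: R_def q_def)
  ultimately show ?thesis
    using s(3) \<tau>(2) by (intro exI[of _ ?T] exI[of _ "\<lambda>w. \<alpha> (\<tau> w)"]) auto
qed

text \<open>In the coordinates \<open>u ^ 3 / v ^ 2\<close> and \<open>v / u\<close>, the first is prescribed by \<open>a\<close> and \<open>b\<close>, and the
  second can then be adjusted to that of the transversal curve by means of a nowhere vanishing factor.\<close>

lemma local_target_curve:
  assumes V: "cusp_model V E \<sigma> J" and x: "transversal_at V \<sigma> x"
    and ab: "a holomorphic_on UNIV" "b holomorphic_on UNIV" "a z\<^sub>0 ^ 3 = b z\<^sub>0 ^ 2" "a z\<^sub>0 \<noteq> 0 \<or> b z\<^sub>0 \<noteq> 0"
  shows "\<exists>R \<alpha> L. open R \<and> z\<^sub>0 \<in> R \<and> holomorphic_curve V R \<alpha> \<and> L holomorphic_on R \<and>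
    (\<forall>z\<in>R. \<sigma> (\<alpha> z) = vector [a z * exp (2 * L z), b z * exp (3 * L z)])"
proof -
  obtain T \<alpha> where T: "open T" "0 \<in> T" "holomorphic_curve V T \<alpha>"
    and \<alpha>: "\<And>w. w \<in> T \<Longrightarrow> \<sigma> (\<alpha> w) $ 1 \<noteq> 0" "\<And>w. w \<in> T \<Longrightarrow> \<sigma> (\<alpha> w) $ 2 \<noteq> 0"
      "\<And>w. w \<in> T \<Longrightarrow> (\<sigma> (\<alpha> w) $ 1) ^ 3 = (\<sigma> (\<alpha> w) $ 2) ^ 2 * (1 + w)"
    using normalized_transversal_curve[OF V x] by blast
  have "holomorphic_curve complex_plane T (\<lambda>z. \<sigma> (\<alpha> z))"
    using V by (intro curve_holomorphic_map[OF T(3,1)]) (auto simp: cusp_model_def)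
  then have hol: "(\<lambda>z. \<sigma> (\<alpha> z) $ i) holomorphic_on T" for i unfolding curve_plane[OF T(1)] by (rule spec)
  have nz: "a z\<^sub>0 \<noteq> 0" "b z\<^sub>0 \<noteq> 0" using ab(3,4) by auto
  define N where "N = {z. a z \<noteq> 0} \<inter> {z. b z \<noteq> 0}"
  have op: "open {z. c z \<noteq> 0}" if "c holomorphic_on UNIV" for c :: "complex \<Rightarrow> complex"
    using open_vimage[OF open_Compl[OF closed_singleton[of 0]] holomorphic_on_imp_continuous_on[OF that]]
    by (simp add: vimage_def)
  have N: "open N" "z\<^sub>0 \<in> N" unfolding N_def using op[OF ab(1)] op[OF ab(2)] nz by auto
  \<comment> \<open>The normalised parameter that the desired curve must have at \<open>z\<close>.
    It may have a zero of any order at \<open>z\<^sub>0\<close>, so the composite with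
    \<open>\<alpha>\<close> is in general no longer transversal.\<close>
  define \<omega> where "\<omega> z = a z ^ 3 / b z ^ 2 - 1" for z
  have \<omega>: "\<omega> holomorphic_on N"
    unfolding \<omega>_def using ab(1,2) by (intro holomorphic_intros) (auto simp: N_def intro: holomorphic_on_subset)
  define R0 where "R0 = {z \<in> N. \<omega> z \<in> T}"
  have "open R0" "z\<^sub>0 \<in> R0"
    unfolding R0_def using continuous_open_preimage[OF holomorphic_on_imp_continuous_on[OF \<omega>] N(1) T(1)] N(2) T(2) ab(3) nz
    by (auto simp: vimage_def Int_def \<omega>_def)
  then obtain e where e: "e > 0" "ball z\<^sub>0 e \<subseteq> R0" using open_contains_ball by blast
  let ?R = "ball z\<^sub>0 e"
  have RN: "?R \<subseteq> N" "\<omega> ` ?R \<subseteq> T" using e(2) by (auto simp: R0_def)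
  \<comment> \<open>The factor h, solved from \<open>v / u = h * b / a\<close> along the
    reparametrised curve.\<close>
  define H where "H z = \<sigma> (\<alpha> (\<omega> z)) $ 2 / \<sigma> (\<alpha> (\<omega> z)) $ 1 * (a z / b z)" for z
  have comp: "(\<lambda>z. \<sigma> (\<alpha> (\<omega> z)) $ i) holomorphic_on ?R" for i
    using holomorphic_on_compose_gen[OF holomorphic_on_subset[OF \<omega> RN(1)] hol[of i] RN(2)] by (simp add: o_def)
  have H: "H holomorphic_on ?R" "\<And>z. z \<in> ?R \<Longrightarrow> H z \<noteq> 0"
  proof -
    show "H holomorphic_on ?R" unfolding H_def
      using comp ab(1,2) \<alpha>(1)[OF subsetD[OF RN(2) imageI]] RN(1)
      by (intro holomorphic_intros) (auto simp: N_def intro: holomorphic_on_subset)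
    show "H z \<noteq> 0" if "z \<in> ?R" for z
      using that RN(1) \<alpha>(1,2)[OF subsetD[OF RN(2) imageI[OF that]]] by (auto simp: H_def N_def)
  qed
  \<comment> \<open>The logarithm exists because the domain was shrunk to a ball. It is
    \<open>L\<close>, not \<open>H\<close>, that will be interpolated, since the exponential of an
    entire function has no zeros.\<close>
  obtain L where L: "L holomorphic_on ?R" "\<And>z. z \<in> ?R \<Longrightarrow> exp (L z) = H z"
    using holomorphic_logarithm_exists[OF convex_ball open_ball H, of z\<^sub>0] e(1) by auto
  have "\<sigma> (\<alpha> (\<omega> z)) = vector [a z * exp (2 * L z), b z * exp (3 * L z)]" if z: "z \<in> ?R" for z
  proof -
    let ?u = "\<sigma> (\<alpha> (\<omega> z)) $ 1" and ?v = "\<sigma> (\<alpha> (\<omega> z)) $ 2"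
    have w: "\<omega> z \<in> T" and ab': "a z \<noteq> 0" "b z \<noteq> 0" using RN z by (auto simp: N_def)
    have uv: "?u \<noteq> 0" "?v \<noteq> 0" "?u ^ 3 * b z ^ 2 = ?v ^ 2 * a z ^ 3"
      using \<alpha>[OF w] ab' by (auto simp: \<omega>_def field_simps)
    have "exp (2 * L z) = H z ^ 2" "exp (3 * L z) = H z ^ 3"
      using L(2)[OF z] exp_of_nat_mult[of 2 "L z"] exp_of_nat_mult[of 3 "L z"] by simp_all
    moreover have "a z * H z ^ 2 = ?u"
    proof -
      have "a z * H z ^ 2 = ?v ^ 2 * a z ^ 3 / (?u ^ 2 * b z ^ 2)"
        by (simp add: H_def power_mult_distrib power_divide power2_eq_square power3_eq_cube mult_ac)
      also have "\<dots> = ?u ^ 3 * b z ^ 2 / (?u ^ 2 * b z ^ 2)" by (simp add: uv(3))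
      also have "\<dots> = ?u" using uv(1) ab' by (simp add: power2_eq_square power3_eq_cube)
      finally show ?thesis .
    qed
    moreover have "b z * H z ^ 3 = ?v"
    proof -
      have "b z * H z ^ 3 = ?v * (?v ^ 2 * a z ^ 3) / (?u ^ 3 * b z ^ 2)"
        using ab' by (simp add: H_def power_mult_distrib power_divide power2_eq_square power3_eq_cube mult_ac)
      also have "\<dots> = ?v * (?u ^ 3 * b z ^ 2) / (?u ^ 3 * b z ^ 2)" by (simp add: uv(3))
      also have "\<dots> = ?v" using uv(1) ab' by simp
      finally show ?thesis .
    qed
    ultimately show ?thesis by (simp add: vec2_eq_iff)
  qed
  moreover have "holomorphic_curve V ?R (\<lambda>z. \<alpha> (\<omega> z))"
    by (rule curve_compose[OF T(3) holomorphic_on_subset[OF \<omega> RN(1)] RN(2)])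
  ultimately show ?thesis
    using e(1) L(1) by (intro exI[of _ ?R] exI[of _ "\<lambda>z. \<alpha> (\<omega> z)"] exI[of _ L]) auto
qed

section \<open>Entire curves with prescribed velocity\<close>

text \<open>The plane curve \<open>g\<close> and the identity \<open>f z = J (g z)\<close> near 0
  are exported along with \<open>f\<close>, because the velocity of \<open>f\<close> in any chart is
  computed from them.\<close>

lemma entire_curve:
  assumes V: "cusp_model V E \<sigma> J" and e: "e \<in> E" "transversal_at V \<sigma> e"
    and x: "x \<in> points V" "x \<notin> E"
  shows "\<exists>f g R. holomorphic_curve V UNIV f \<and> f 0 = x \<and> (g has_derivative (\<lambda>h. h *s w)) (at 0) \<and>
    g 0 = \<sigma> x \<and> open R \<and> 0 \<in> R \<and> (\<forall>z\<in>R. f z = J (g z))"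
proof -
  have V': "holomorphic_atlas V" "E = {x \<in> points V. cusp (\<sigma> x) = 0}"
      "holomorphic_map (open_submanifold complex_plane (- cusp_curve)) V J"
      "\<And>x. x \<in> points V \<Longrightarrow> \<sigma> x \<notin> cusp_curve \<Longrightarrow> J (\<sigma> x) = x"
    and lift: "curve_lifting V \<sigma>"
    using V by (auto simp: cusp_model_def)
  have x0: "cusp (\<sigma> x) \<noteq> 0" using x V'(2) by auto
  obtain a b \<kappa> where ab: "a holomorphic_on UNIV" "b holomorphic_on UNIV" "a 0 = \<sigma> x $ 1" "b 0 = \<sigma> x $ 2"
      "(a has_field_derivative w $ 1 - 2 * \<kappa> * \<sigma> x $ 1) (at 0)"
      "(b has_field_derivative w $ 2 - 3 * \<kappa> * \<sigma> x $ 2) (at 0)"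
      "\<And>z. a z \<noteq> 0 \<or> b z \<noteq> 0" and fin: "finite {z. a z ^ 3 = b z ^ 2}"
    using coprime_pair[OF x0, of w] by blast
  define Z where "Z = {z. a z ^ 3 = b z ^ 2}"
  have Z: "finite Z" "\<And>z. z \<in> Z \<longleftrightarrow> a z ^ 3 = b z ^ 2" using fin by (auto simp: Z_def)
  have "0 \<notin> Z" using x0 ab(3,4) by (simp add: Z(2) cusp_def)
  have "\<forall>z\<^sub>0\<in>Z. \<exists>R \<alpha> L. open R \<and> z\<^sub>0 \<in> R \<and> holomorphic_curve V R \<alpha> \<and> L holomorphic_on R \<and>
      (\<forall>z\<in>R. \<sigma> (\<alpha> z) = vector [a z * exp (2 * L z), b z * exp (3 * L z)])"
    using local_target_curve[OF V e(2) ab(1,2) _ ab(7)] Z(2) by blast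
  then obtain R \<alpha> L where RL: "\<And>z\<^sub>0. z\<^sub>0 \<in> Z \<Longrightarrow> open (R z\<^sub>0)" "\<And>z\<^sub>0. z\<^sub>0 \<in> Z \<Longrightarrow> z\<^sub>0 \<in> R z\<^sub>0"
      "\<And>z\<^sub>0. z\<^sub>0 \<in> Z \<Longrightarrow> holomorphic_curve V (R z\<^sub>0) (\<alpha> z\<^sub>0)" "\<And>z\<^sub>0. z\<^sub>0 \<in> Z \<Longrightarrow> L z\<^sub>0 holomorphic_on R z\<^sub>0"
      "\<And>z\<^sub>0 z. z\<^sub>0 \<in> Z \<Longrightarrow> z \<in> R z\<^sub>0 \<Longrightarrow> \<sigma> (\<alpha> z\<^sub>0 z) = vector [a z * exp (2 * L z\<^sub>0 z), b z * exp (3 * L z\<^sub>0 z)]"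
    by metis
  have cusp_exp: "cusp (vector [a z * exp (2 * l), b z * exp (3 * l)]) = exp (6 * l) * (a z ^ 3 - b z ^ 2)" for z l
  proof -
    have "exp (2 * l) ^ 3 = exp (6 * l)" "exp (3 * l) ^ 2 = exp (6 * l)" by (simp_all flip: exp_of_nat_mult)
    then show ?thesis by (simp add: cusp_def power_mult_distrib right_diff_distrib)
  qed
  have offZ: "\<forall>\<^sub>F z in at z\<^sub>0. z \<notin> Z" for z\<^sub>0
  proof -
    have "\<forall>\<^sub>F z in at z\<^sub>0. z \<in> - (Z - {z\<^sub>0})"
      by (intro eventually_at_in_open' open_Compl finite_imp_closed finite_Diff Z(1)) simp
    then show ?thesis using eventually_neq_at_within[of z\<^sub>0 z\<^sub>0 UNIV] by eventually_elim auto
  qed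
  \<comment> \<open>Only the existence of local lifts is used later, so order 0 is asked of
    them.\<close>
  have "\<exists>k. contact_lift V \<sigma> complex_plane (\<alpha> z\<^sub>0) z\<^sub>0 0 k" if z0: "z\<^sub>0 \<in> Z" for z\<^sub>0
  proof -
    have c0: "cusp (\<sigma> (\<alpha> z\<^sub>0 z\<^sub>0)) = 0"
      using RL(5)[OF z0 RL(2)[OF z0]] cusp_exp z0 Z(2) by simp
    have "\<forall>\<^sub>F z in at z\<^sub>0. z \<in> R z\<^sub>0" using RL(1,2)[OF z0] by (rule eventually_at_in_open')
    then have nz: "\<forall>\<^sub>F z in at z\<^sub>0. cusp (\<sigma> (\<alpha> z\<^sub>0 z)) \<noteq> 0"
      using offZ[of z\<^sub>0] by eventually_elim (simp add: RL(5)[OF z0] cusp_exp Z(2))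
    from lift[unfolded curve_lifting_def, rule_format, OF RL(3,1,2)[OF z0] c0 nz, of 0]
    show ?thesis .
  qed
  then obtain k where k: "\<And>z\<^sub>0. z\<^sub>0 \<in> Z \<Longrightarrow> contact_lift V \<sigma> complex_plane (\<alpha> z\<^sub>0) z\<^sub>0 0 (k z\<^sub>0)" by metis
  \<comment> \<open>The sum dominates every \<open>k z\<close>; the summand 2 makes the
    interpolation determine value and derivative of \<open>P\<close> at 0.\<close>
  define n where "n = 2 + (\<Sum>z\<in>Z. k z)"
  have n: "k z \<le> n" if "z \<in> Z" for z
    using member_le_sum[OF that, of k] Z(1) by (simp add: n_def)
  \<comment> \<open>The point 0 is an additional node, not in \<open>Z\<close>. The target
    \<open>\<kappa> * t\<close> there gives the factor \<open>exp (P t)\<close> the value 1 and the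
    derivative \<open>\<kappa>\<close>.\<close>
  define F where "F z = (if z = 0 then (\<lambda>t. \<kappa> * t) else L z)" for z
  define S where "S z = (if z = 0 then UNIV else R z)" for z
  have "\<exists>P. P holomorphic_on UNIV \<and> (\<forall>z\<in>insert 0 Z. (\<lambda>t. F z t - P t) \<in> O[at z](\<lambda>t. (t - z) ^ n))"
    using Z(1) RL(1,2,4) by (intro entire_interpolation[where S = S]) (auto simp: S_def F_def intro!: holomorphic_intros)
  then obtain P where P: "P holomorphic_on UNIV" "\<And>z. z \<in> insert 0 Z \<Longrightarrow> (\<lambda>t. F z t - P t) \<in> O[at z](\<lambda>t. (t - z) ^ n)"
    by blast
  have PL: "(\<lambda>t. P t - L z t) \<in> O[at z](\<lambda>t. (t - z) ^ n)" if "z \<in> Z" for z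
  proof -
    have "z \<noteq> 0" using that \<open>0 \<notin> Z\<close> by auto
    then show ?thesis using P(2)[of z] that landau_o.big.uminus_in_iff[of "\<lambda>t. P t - L z t"] by (simp add: F_def)
  qed
  have P0: "(\<lambda>t. P t - \<kappa> * t) \<in> O[at 0](\<lambda>t. t ^ n)"
    using P(2)[of 0] landau_o.big.uminus_in_iff[of "\<lambda>t. P t - \<kappa> * t"] by (simp add: F_def)
  have isCP: "isCont P z" for z by (rule holomorphic_isCont[OF P(1)]) auto
  have Pz0: "P 0 = 0"
    using bigo_power_value[of "\<lambda>t. P t - \<kappa> * t" 0 n] P0 isCP by (simp add: n_def)
  have dP: "(P has_field_derivative \<kappa>) (at 0)"
  proof -
    have "(\<lambda>t. t ^ n :: complex) \<in> o[at 0](\<lambda>t. t)"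
    proof (rule smalloI_tendsto)
      have "((\<lambda>t. t ^ (n - 1) :: complex) \<longlongrightarrow> 0) (at 0)"
        using power_tendsto_zero[of "n - 1" 0] by (simp add: n_def)
      then show "((\<lambda>t. t ^ n / t :: complex) \<longlongrightarrow> 0) (at 0)"
        by (rule Lim_transform_eventually) (auto simp: eventually_at_filter n_def)
    qed (auto simp: eventually_at_filter)
    from smalloD_tendsto[OF landau_o.big_small_trans[OF P0 this]]
    have "((\<lambda>t. (P t - \<kappa> * t) / t + \<kappa>) \<longlongrightarrow> 0 + \<kappa>) (at 0)" by (intro tendsto_intros)
    then have "((\<lambda>t. P t / t) \<longlongrightarrow> \<kappa>) (at 0)"
      unfolding add_0 by (rule Lim_transform_eventually) (auto simp: eventually_at_filter field_simps)
    then show ?thesis by (simp add: has_field_derivative_iff Pz0)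
  qed
  define g where "g z = (vector [a z * exp (2 * P z), b z * exp (3 * P z)] :: complex ^ 2)" for z
  have g: "holomorphic_curve complex_plane UNIV g"
    unfolding curve_plane[OF open_UNIV] g_def forall_2 using ab(1,2) P(1) by (auto intro!: holomorphic_intros)
  have g0: "g 0 = \<sigma> x" using ab(3,4) by (simp add: g_def Pz0 vec2_eq_iff)
  \<comment> \<open>By the product rule, the exponentials contribute \<open>2 * \<kappa>\<close> and
    \<open>3 * \<kappa>\<close> times the components of \<open>\<sigma> x\<close>, which are the
    terms subtracted in the derivatives of \<open>a\<close> and \<open>b\<close>.\<close>
  have dg: "(g has_derivative (\<lambda>h. h *s w)) (at 0)"
    unfolding has_derivative_vec_curve forall_2
    using ab(3-6) dP by (auto simp: g_def Pz0 intro!: derivative_eq_intros) 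
  have gZ: "g z \<in> cusp_curve \<longleftrightarrow> z \<in> Z" for z by (simp add: cusp_curve_iff g_def cusp_exp Z(2))
  have "\<exists>e>0. \<exists>\<gamma>. holomorphic_curve V (ball z\<^sub>0 e) \<gamma> \<and> (\<forall>z\<in>ball z\<^sub>0 e. \<sigma> (\<gamma> z) = g z)" if z0: "z\<^sub>0 \<in> Z" for z\<^sub>0
  proof -
    have isCL: "isCont (L z\<^sub>0) z\<^sub>0" by (rule holomorphic_isCont[OF RL(4,1,2)]) (rule z0)+
    have eqL: "P z\<^sub>0 = L z\<^sub>0 z\<^sub>0"
      using bigo_power_value[OF PL[OF z0]] isCP isCL by (simp add: n_def)
    have c: "(\<lambda>z. c z * exp (m * P z) - c z * exp (m * L z\<^sub>0 z)) \<in> O[at z\<^sub>0](\<lambda>z. (z - z\<^sub>0) ^ n)"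
      if c: "c holomorphic_on UNIV" for c and m :: complex
    proof -
      have "(\<lambda>z. m * (P z - L z\<^sub>0 z)) \<in> O[at z\<^sub>0](\<lambda>z. (z - z\<^sub>0) ^ n)"
        using PL[OF z0] by (cases "m = 0") auto
      then have "(\<lambda>z. exp (m * P z) - exp (m * L z\<^sub>0 z)) \<in> O[at z\<^sub>0](\<lambda>z. (z - z\<^sub>0) ^ n)"
        using isCL by (intro exp_minus_exp_bigo) (auto simp: algebra_simps n_def)
      then have "(\<lambda>z. c z * (exp (m * P z) - exp (m * L z\<^sub>0 z))) \<in> O[at z\<^sub>0](\<lambda>z. 1 * (z - z\<^sub>0) ^ n)"
        by (intro landau_o.big.mult isCont_bigo_1 holomorphic_isCont[OF c]) auto
      then show ?thesis by (simp add: right_diff_distrib)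
    qed
    have "vec_contact z\<^sub>0 n (\<lambda>z. vector [a z * exp (2 * L z\<^sub>0 z), b z * exp (3 * L z\<^sub>0 z)]) g"
      unfolding vec_contact_iff2 g_def using c[OF ab(1), of 2] c[OF ab(2), of 3] by simp
    then have "vec_contact z\<^sub>0 (k z\<^sub>0) (\<lambda>z. vector [a z * exp (2 * L z\<^sub>0 z), b z * exp (3 * L z\<^sub>0 z)]) g"
      by (rule vec_contact_mono[OF _ n[OF z0]])
    moreover have "\<forall>\<^sub>F z in at z\<^sub>0. z \<in> R z\<^sub>0" using RL(1,2)[OF z0] by (rule eventually_at_in_open')
    then have "\<forall>\<^sub>F z in at z\<^sub>0. vector [a z * exp (2 * L z\<^sub>0 z), b z * exp (3 * L z\<^sub>0 z)] = \<sigma> (\<alpha> z\<^sub>0 z)"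
      by eventually_elim (simp add: RL(5)[OF z0])
    ultimately have "vec_contact z\<^sub>0 (k z\<^sub>0) (\<lambda>z. \<sigma> (\<alpha> z\<^sub>0 z)) g"
      by (rule vec_contact_cong) simp
    moreover have "\<sigma> (\<alpha> z\<^sub>0 z\<^sub>0) = g z\<^sub>0" using RL(5)[OF z0 RL(2)[OF z0]] by (simp add: g_def eqL)
    ultimately have "curves_contact complex_plane z\<^sub>0 (k z\<^sub>0) (\<lambda>z. \<sigma> (\<alpha> z\<^sub>0 z)) g"
      by (simp add: curves_contact_plane)
    from k[OF z0, unfolded contact_lift_def, rule_format, OF open_UNIV UNIV_I g this] show ?thesis by blast
  qed
  then obtain \<epsilon> \<gamma> where \<gamma>: "\<And>z\<^sub>0. z\<^sub>0 \<in> Z \<Longrightarrow> \<epsilon> z\<^sub>0 > 0" "\<And>z\<^sub>0. z\<^sub>0 \<in> Z \<Longrightarrow> holomorphic_curve V (ball z\<^sub>0 (\<epsilon> z\<^sub>0)) (\<gamma> z\<^sub>0)"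
      "\<And>z\<^sub>0 z. z\<^sub>0 \<in> Z \<Longrightarrow> z \<in> ball z\<^sub>0 (\<epsilon> z\<^sub>0) \<Longrightarrow> \<sigma> (\<gamma> z\<^sub>0 z) = g z"
    by metis
  \<comment> \<open>On \<open>Z\<close> the curve \<open>g\<close> hits the cusp, where
    \<open>J\<close> carries no information, so the value is taken from the local lift. Off
    \<open>Z\<close> the lifts agree with \<open>J (g z)\<close> since \<open>J\<close> inverts
    \<open>\<sigma>\<close>.\<close>
  define f where "f z = (if z \<in> Z then \<gamma> z z else J (g z))" for z
  have opZ: "open (- (Z - Y))" for Y by (intro open_Compl finite_imp_closed finite_Diff Z(1))
  have opZ0: "open (- Z)" using opZ[of "{}"] by simp
  have "holomorphic_curve V UNIV f"
  proof (rule curve_local)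
    fix z\<^sub>0 :: complex
    show "\<exists>T. open T \<and> z\<^sub>0 \<in> T \<and> holomorphic_curve V T f"
    proof (cases "z\<^sub>0 \<in> Z")
      case True
      \<comment> \<open>The other points of \<open>Z\<close> are cut out because there
        \<open>f\<close> takes its value from a different lift.\<close>
      let ?T = "ball z\<^sub>0 (\<epsilon> z\<^sub>0) \<inter> - (Z - {z\<^sub>0})"
      have "\<gamma> z\<^sub>0 z = f z" if z: "z \<in> ?T" for z
      proof (cases "z = z\<^sub>0")
        case False
        then have "z \<notin> Z" using z by auto
        have "J (\<sigma> (\<gamma> z\<^sub>0 z)) = \<gamma> z\<^sub>0 z"
          using z \<gamma>(3)[OF True, of z] gZ[of z] \<open>z \<notin> Z\<close> curve_points[OF \<gamma>(2)[OF True], of z]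
          by (intro V'(4)) auto
        then show ?thesis using \<open>z \<notin> Z\<close> \<gamma>(3)[OF True, of z] z by (simp add: f_def)
      qed (simp add: f_def True)
      then have "holomorphic_curve V ?T f"
        by (intro curve_cong[OF curve_subset[OF \<gamma>(2)[OF True]]]) auto
      moreover have "open ?T" by (intro open_Int open_ball opZ)
      moreover have "z\<^sub>0 \<in> ?T" using \<gamma>(1)[OF True] by auto
      ultimately show ?thesis by blast
    next
      case False
      have "holomorphic_curve (open_submanifold complex_plane (- cusp_curve)) (- Z) g"
        using curve_subset[OF g] gZ by (auto simp: curve_open_submanifold)
      from curve_holomorphic_map[OF this opZ0 _ V'(3)]
      have "holomorphic_curve V (- Z) (\<lambda>z. J (g z))"
        by (simp add: holomorphic_atlas_open_submanifold[OF holomorphic_atlas_plane] open_cusp_complement)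
      then have "holomorphic_curve V (- Z) f" by (rule curve_cong) (simp add: f_def)
      then show ?thesis using opZ0 False by blast
    qed
  qed
  moreover have "f 0 = x" using \<open>0 \<notin> Z\<close> g0 V'(4)[OF x(1)] x0 by (simp add: f_def cusp_curve_iff)
  ultimately show ?thesis
    using dg g0 opZ0 \<open>0 \<notin> Z\<close> by (intro exI[of _ f] exI[of _ g] exI[of _ "- Z"]) (auto simp: f_def)
qed

text \<open>The tangent vector is pushed to the plane by the derivative of \<open>\<sigma>\<close>
  in one chart, which gives the velocity to be prescribed for \<open>g\<close>. Pulling it back by
  \<open>J\<close> recovers the coordinates of \<open>\<nu>\<close> in every chart, as these
  transform by the derivatives of the transition maps.\<close>

lemma entire_curve_velocity:
  assumes V: "cusp_model V E \<sigma> J" and e: "e \<in> E" "transversal_at V \<sigma> e"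
    and x: "x \<in> points V" "x \<notin> E" and \<nu>: "\<nu> \<in> tangent_space V x"
  shows "\<exists>f. holomorphic_curve V UNIV f \<and> f 0 = x \<and> disc_velocity V f \<nu>"
proof -
  have V': "holomorphic_atlas V" "E = {x \<in> points V. cusp (\<sigma> x) = 0}" "holomorphic_map V complex_plane \<sigma>"
      "holomorphic_map (open_submanifold complex_plane (- cusp_curve)) V J"
      "\<And>x. x \<in> points V \<Longrightarrow> \<sigma> x \<notin> cusp_curve \<Longrightarrow> J (\<sigma> x) = x"
    using V by (auto simp: cusp_model_def)
  have \<sigma>x: "\<sigma> x \<notin> cusp_curve" using x V'(2) by (auto simp: cusp_curve_iff)
  obtain U\<^sub>0 \<phi>\<^sub>0 where U0: "(U\<^sub>0, \<phi>\<^sub>0) \<in> V" "x \<in> U\<^sub>0" using points_chart[OF x(1)] by blast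
  let ?i = "inv_into U\<^sub>0 \<phi>\<^sub>0"
  obtain D\<^sub>0 where D0: "(\<sigma> \<circ> ?i has_derivative D\<^sub>0) (at (\<phi>\<^sub>0 x))"
    using holomorphic_map_plane_chart[OF V'(1) U0(1) V'(3)] U0(2) unfolding holomorphic_vec_on_def by blast
  have ix: "?i (\<phi>\<^sub>0 x) = x" by (rule chart_inv[OF V'(1) U0])
  obtain f g R where f: "holomorphic_curve V UNIV f" "f 0 = x" "(g has_derivative (\<lambda>h. h *s D\<^sub>0 (\<nu> (U\<^sub>0, \<phi>\<^sub>0)))) (at 0)"
      "g 0 = \<sigma> x" "open R" "0 \<in> R" "\<And>z. z \<in> R \<Longrightarrow> f z = J (g z)"
    using entire_curve[OF V e x, of "D\<^sub>0 (\<nu> (U\<^sub>0, \<phi>\<^sub>0))"] by blast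
  have "disc_velocity V f \<nu>"
    unfolding disc_velocity_def
  proof (clarify)
    fix U \<phi> i assume U: "(U, \<phi>) \<in> V" "f 0 \<in> U"
    have "holomorphic_vec_on (\<phi> \<circ> J \<circ> inv_into (- cusp_curve) (\<lambda>x. x)) ((\<lambda>x. x) ` {v \<in> - cusp_curve. J v \<in> U})"
      by (rule holomorphic_map_charts[OF V'(4) _ U(1)]) (auto simp: open_submanifold_def complex_plane_def)
    then have hv: "holomorphic_vec_on (\<phi> \<circ> J \<circ> inv_into (- cusp_curve) (\<lambda>x. x)) {v \<in> - cusp_curve. J v \<in> U}"
      by simp
    have op: "open {v \<in> - cusp_curve. J v \<in> U}"
      using openin_holomorphic_map_preimage[OF V'(4) openin_chart[OF U(1)]]
        openin_open_submanifold_imp[of complex_plane "- cusp_curve"] open_cusp_complement by simp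
    have "holomorphic_vec_on (\<lambda>v. \<phi> (J v)) {v \<in> - cusp_curve. J v \<in> U}"
      by (rule holomorphic_vec_on_cong[OF op hv]) (simp add: inv_into_f_f[of "\<lambda>x. x", unfolded inj_on_def])
    moreover have "\<sigma> x \<in> {v \<in> - cusp_curve. J v \<in> U}" using \<sigma>x V'(5)[OF x(1)] U(2) f(2) by simp
    ultimately obtain D\<^sub>1 where D1: "((\<lambda>v. \<phi> (J v)) has_derivative D\<^sub>1) (at (\<sigma> x))" "\<And>c v. D\<^sub>1 (c *s v) = c *s D\<^sub>1 v"
      unfolding holomorphic_vec_on_def by blast
    define N where "N = {y \<in> points V. \<sigma> y \<in> - cusp_curve}"
    have N: "openin (manifold_topology V) N"
      unfolding N_def by (rule openin_holomorphic_map_preimage[OF V'(3)]) (simp add: open_cusp_complement)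
    \<comment> \<open>Since \<open>J\<close> inverts \<open>\<sigma>\<close> off the cusp, the
      transition map factors near \<open>\<phi>\<^sub>0 x\<close> through the plane, and its
      derivative is the composite of \<open>D\<^sub>1\<close> and \<open>D\<^sub>0\<close>.\<close>
    have "(\<phi> \<circ> J \<circ> (\<sigma> \<circ> ?i) has_derivative D\<^sub>1 \<circ> D\<^sub>0) (at (\<phi>\<^sub>0 x))"
      using diff_chain_at[OF D0, of "\<phi> \<circ> J" D\<^sub>1] D1(1) ix by (simp add: o_def)
    then have "(\<phi> \<circ> ?i has_derivative D\<^sub>1 \<circ> D\<^sub>0) (at (\<phi>\<^sub>0 x))"
    proof (rule has_derivative_transform_within_open[OF _ open_chart_image[OF V'(1) U0(1) N]])
      show "\<phi>\<^sub>0 x \<in> \<phi>\<^sub>0 ` (U\<^sub>0 \<inter> N)" using U0(2) x(1) \<sigma>x by (auto simp: N_def)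
    qed (auto simp: chart_inv[OF V'(1) U0(1)] N_def V'(5))
    from frechet_derivative_at[OF this] have fr: "frechet_derivative (\<phi> \<circ> ?i) (at (\<phi>\<^sub>0 x)) = D\<^sub>1 \<circ> D\<^sub>0" by (rule sym)
    have "\<forall>(U, \<phi>)\<in>V. \<forall>(W, \<psi>)\<in>V. x \<in> U \<and> x \<in> W \<longrightarrow>
        \<nu> (W, \<psi>) = frechet_derivative (\<psi> \<circ> inv_into U \<phi>) (at (\<phi> x)) (\<nu> (U, \<phi>))"
      using \<nu> by (simp add: tangent_space_def)
    from bspec[OF bspec[OF this U0(1), unfolded case_prod_conv] U(1)]
    have "\<nu> (U, \<phi>) = D\<^sub>1 (D\<^sub>0 (\<nu> (U\<^sub>0, \<phi>\<^sub>0)))"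
      using U0(2) U(2) f(2) by (simp add: fr)
    moreover have "((\<lambda>z. \<phi> (J (g z))) has_derivative (\<lambda>h. h *s D\<^sub>1 (D\<^sub>0 (\<nu> (U\<^sub>0, \<phi>\<^sub>0))))) (at 0)"
      using diff_chain_at[OF f(3), of "\<lambda>v. \<phi> (J v)" D\<^sub>1] D1 f(4) by (simp add: o_def)
    then have "((\<lambda>z. \<phi> (f z)) has_derivative (\<lambda>h. h *s D\<^sub>1 (D\<^sub>0 (\<nu> (U\<^sub>0, \<phi>\<^sub>0))))) (at 0)"
      by (rule has_derivative_transform_within_open[OF _ f(5,6)]) (simp add: f(7))
    ultimately show "((\<lambda>z. \<phi> (f z) $ i) has_field_derivative \<nu> (U, \<phi>) $ i) (at 0)"
      by (simp add: has_derivative_vec_curve)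
  qed
  with f(1,2) show ?thesis by blast
qed

text \<open>An entire curve restricts to discs of every radius with the same velocity, so the set
  under the infimum consists of all positive reals.\<close>

lemma kobayashi_royden_entire_curve:
  assumes "holomorphic_curve A UNIV f" "f 0 = x" "disc_velocity A f \<nu>"
  shows "kobayashi_royden A x \<nu> = 0"
proof -
  let ?S = "{1 / r | r f. r > 0 \<and> holomorphic_disc A r f \<and> f 0 = x \<and> disc_velocity A f \<nu>}"
  have inv: "1 / r \<in> ?S" if "r > 0" for r
    using that assms curve_subset[OF assms(1)] by (auto simp: holomorphic_disc_curve)
  have mem: "r \<in> ?S" if "r > 0" for r using inv[of "1 / r"] that by simp
  have "?S = {0<..}" using mem by auto
  then show ?thesis by (simp add: kobayashi_royden_def)
qed

theorem corollary4p4: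
  fixes m :: nat and V :: "('a, 2) atlas" and E :: "'a set"
  assumes "m \<ge> 1"
    and "tower_surface m V E"
  shows "\<forall>x\<in>points V - E. \<forall>\<nu>\<in>tangent_space V x. kobayashi_royden V x \<nu> = 0"
proof (intro ballI)
  fix x \<nu> assume "x \<in> points V - E" "\<nu> \<in> tangent_space V x"
  then have x: "x \<in> points V" "x \<notin> E" "\<nu> \<in> tangent_space V x" by auto
  obtain \<sigma> J e where "cusp_model V E \<sigma> J" "e \<in> E" "transversal_at V \<sigma> e"
    using tower_surface_model[OF assms(2)] by blast
  from entire_curve_velocity[OF this x] obtain f where "holomorphic_curve V UNIV f" "f 0 = x" "disc_velocity V f \<nu>"
    by blast
  then show "kobayashi_royden V x \<nu> = 0" by (rule kobayashi_royden_entire_curve)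
qed

end
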